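(* Let $V$ satisfy the assumptions listed in the context and let $F(x)=\frac{\alpha}{2}x^2$ with $\alpha>0$. If $V''$ is a convex function, then there exists $\epsilon_0>0$ such that for every $\epsilon\in(0,\epsilon_0)$ the self-stabilizing diffusion $$X_t^{\epsilon}=X_0+\sqrt{\epsilon}\,B_t-\int_0^t V'(X_s^{\epsilon})\,ds-\alpha\int_0^t\Big(X_s^{\epsilon}-\int_{\mathbb{R}}x\,du_s^{\epsilon}(x)\Big)ds,\qquad u_s^\epsilon=\text{law of }X_s^\epsilon,$$ has exactly three stationary (invariant) measures.
   Context: Assumptions on $V$: $V:\mathbb{R}\to\mathbb{R}$ is infinitely differentiable and even; the equation $V'(x)=0$ has exactly three solutions $-a,0,a$ with $a>0$, $V''(a)>0$ and $V''(0)<0$ (double well with bottoms at $\pm a$); there are constants $C_4,C_2>0$ with $V(x)\ge C_4x^4-C_2x^2$ for all $x\in\mathbb{R}$; $\lim_{x\to\pm\infty}V''(x)=+\infty$ and $V''(x)>0$ for all $x\ge a$; there are $q\in\mathbb{N}$, $q\ge1$, and $C_q>0$ with $|V'(x)|\le C_q(1+x^{2q})$ for all $x$ (with $q$ and $C_q$ also such that $|F'(x)-F'(y)|\le C_q|x-y|(1+|x|^{2q-2}+|y|^{2q-2})$); $V(0)=0$. $(B_t)_{t\ge0}$ is a standard one-dimensional Brownian motion independent of $X_0$. Throughout, initial laws are assumed to have finite moment of order $8q^2$; under this condition the equation has a unique strong solution (known). A stationary (invariant) measure is a probability measure $u$ on $\mathbb{R}$ with $\int x^{8q^2}u(dx)<\infty$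 such that if $X_0$ has law $u$ then $X_t^\epsilon$ has law $u$ for all $t\ge0$. *)

theory Defs
  imports "HOL-Probability.Probability"
begin

definition double_well :: "(real \<Rightarrow> real) \<Rightarrow> real \<Rightarrow> bool" where
  "double_well V a \<longleftrightarrow>
     (\<forall>n x. (deriv ^^ n) V differentiable (at x)) \<and>
     (\<forall>x. V (- x) = V x) \<and>
     a > 0 \<and> {x. deriv V x = 0} = {- a, 0, a} \<and>
     deriv (deriv V) a > 0 \<and> deriv (deriv V) 0 < 0 \<and>
     (\<exists>C4 C2. C4 > 0 \<and> C2 > 0 \<and> (\<forall>x. V x \<ge> C4 * x ^ 4 - C2 * x\<^sup>2)) \<and>
     filterlim (deriv (deriv V)) at_top at_top \<and>
     filterlim (deriv (deriv V)) at_top at_bot \<and>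
     (\<forall>x\<ge>a. deriv (deriv V) x > 0) \<and>
     V 0 = 0"

(* One exponent q and one constant Cq serve both for the potential V and for the
   interaction F. *)
definition polynomial_growth :: "(real \<Rightarrow> real) \<Rightarrow> (real \<Rightarrow> real) \<Rightarrow> nat \<Rightarrow> bool" where
  "polynomial_growth V F q \<longleftrightarrow>
     q \<ge> 1 \<and>
     (\<exists>Cq>0. (\<forall>x. \<bar>deriv V x\<bar> \<le> Cq * (1 + x ^ (2 * q))) \<and>
       (\<forall>x y. \<bar>deriv F x - deriv F y\<bar>
          \<le> Cq * \<bar>x - y\<bar> * (1 + \<bar>x\<bar> ^ (2 * q - 2) + \<bar>y\<bar> ^ (2 * q - 2))))"

definition quadratic_interaction :: "real \<Rightarrow> real \<Rightarrow> real" where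
  "quadratic_interaction \<alpha> x = \<alpha> / 2 * x\<^sup>2"

(* The events of the sigma-algebra on the sample space generated by (Y t), t in T. *)
definition generated_events :: "'w measure \<Rightarrow> 't set \<Rightarrow> ('t \<Rightarrow> 'w \<Rightarrow> real) \<Rightarrow> 'w set set" where
  "generated_events M T Y =
     sigma_sets (space M) {Y t -` A \<inter> space M | t A. t \<in> T \<and> A \<in> sets borel}"

(* Processes are functions on all of real, of which only the times t >= 0 matter. *)
definition brownian_motion :: "'w measure \<Rightarrow> (real \<Rightarrow> 'w \<Rightarrow> real) \<Rightarrow> bool" where
  "brownian_motion M B \<longleftrightarrow>
     (\<forall>t\<ge>0. B t \<in> borel_measurable M) \<and>
     (AE \<omega> in M. B 0 \<omega> = 0) \<and>
     (\<forall>s\<ge>0. \<forall>t>s. distributed M lborel (\<lambda>\<omega>. B t \<omega> - B s \<omega>) (normal_density 0 (sqrt (t - s)))) \<and>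
     (\<forall>(n::nat) \<tau>. 0 \<le> \<tau> 0 \<and> mono \<tau> \<longrightarrow>
        prob_space.indep_vars M (\<lambda>_. borel) (\<lambda>i \<omega>. B (\<tau> (Suc i)) \<omega> - B (\<tau> i) \<omega>) {..<n}) \<and>
     (AE \<omega> in M. continuous_on {0..} (\<lambda>t. B t \<omega>))"

definition initial_value ::
    "'w measure \<Rightarrow> (real \<Rightarrow> 'w \<Rightarrow> real) \<Rightarrow> real measure \<Rightarrow> ('w \<Rightarrow> real) \<Rightarrow> bool" where
  "initial_value M B u X0 \<longleftrightarrow>
     X0 \<in> borel_measurable M \<and> distr M borel X0 = u \<and>
     prob_space.indep_set M (generated_events M UNIV (\<lambda>_::unit. X0)) (generated_events M {0..} B)"

(* A probability space with a Brownian motion, rich enough that the equation can be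
   started from every initial law independently of the Brownian motion. *)
definition noise_space :: "'w measure \<Rightarrow> (real \<Rightarrow> 'w \<Rightarrow> real) \<Rightarrow> bool" where
  "noise_space M B \<longleftrightarrow>
     prob_space M \<and> brownian_motion M B \<and>
     (\<forall>u::real measure. prob_space u \<and> sets u = sets borel \<longrightarrow> (\<exists>X0. initial_value M B u X0))"

(* The history up to time t: generated by X0, by B s for 0 <= s <= t and by the null events. *)
definition history ::
    "'w measure \<Rightarrow> (real \<Rightarrow> 'w \<Rightarrow> real) \<Rightarrow> ('w \<Rightarrow> real) \<Rightarrow> real \<Rightarrow> 'w measure" where
  "history M B X0 t =
     sigma (space M)
       (generated_events M UNIV (\<lambda>_::unit. X0) \<union> generated_events M {0..t} B \<union> null_sets M)"

definition law_mean :: "'w measure \<Rightarrow> ('w \<Rightarrow> real) \<Rightarrow> real" where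
  "law_mean M Y = (\<integral>x. x \<partial>distr M borel Y)"

(* Strong solution: adapted, with continuous paths. The noise is additive, so no stochastic
   integral occurs and the equation holds path by path. The two integrability conditions
   give a meaning to the mean of the law and to its time integral, since Isabelle's integrals
   are total functions. *)
definition self_stabilizing_solution ::
    "'w measure \<Rightarrow> (real \<Rightarrow> 'w \<Rightarrow> real) \<Rightarrow> (real \<Rightarrow> real) \<Rightarrow> real \<Rightarrow> real \<Rightarrow>
     ('w \<Rightarrow> real) \<Rightarrow> (real \<Rightarrow> 'w \<Rightarrow> real) \<Rightarrow> bool" where
  "self_stabilizing_solution M B V \<alpha> \<epsilon> X0 X \<longleftrightarrow>
     (\<forall>t\<ge>0. X t \<in> borel_measurable (history M B X0 t)) \<and>
     (\<forall>t\<ge>0. integrable (distr M borel (X t)) (\<lambda>x. x)) \<and>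
     (\<forall>t\<ge>0. set_integrable lborel {0..t} (\<lambda>s. law_mean M (X s))) \<and>
     (AE \<omega> in M. continuous_on {0..} (\<lambda>t. X t \<omega>) \<and>
       (\<forall>t\<ge>0. X t \<omega> = X0 \<omega> + sqrt \<epsilon> * B t \<omega>
          - (LINT s:{0..t}|lborel. deriv V (X s \<omega>))
          - \<alpha> * (LINT s:{0..t}|lborel. X s \<omega> - law_mean M (X s))))"

(* By the well-posedness of the equation for initial laws with finite moment of order 8q^2,
   there is exactly one solution up to null events. Here existence of a solution is
   demanded as well, so that no u is stationary vacuously. *)
definition stationary_measure ::
    "'w measure \<Rightarrow> (real \<Rightarrow> 'w \<Rightarrow> real) \<Rightarrow> (real \<Rightarrow> real) \<Rightarrow> real \<Rightarrow> nat \<Rightarrow> real \<Rightarrow>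
     real measure \<Rightarrow> bool" where
  "stationary_measure M B V \<alpha> q \<epsilon> u \<longleftrightarrow>
     prob_space u \<and> sets u = sets borel \<and> integrable u (\<lambda>x. x ^ (8 * q\<^sup>2)) \<and>
     (\<forall>X0. initial_value M B u X0 \<longrightarrow>
        (\<exists>X. self_stabilizing_solution M B V \<alpha> \<epsilon> X0 X) \<and>
        (\<forall>X. self_stabilizing_solution M B V \<alpha> \<epsilon> X0 X \<longrightarrow>
           (\<forall>t\<ge>0. distr M borel (X t) = u)))"

end

theory Submission
  imports Defs
begin

text \<open>
  A stationary solution has a constant mean \<open>m\<close>, so it also solves the equation in which the mean is
  frozen at \<open>m\<close>, whose drift is \<open>b x = - V' x - \<alpha> x + \<alpha> m\<close>.  The frozen equation has exactly one
  stationary law, the Gibbs law with density proportional to \<open>exp (- 2 W x / \<epsilon>)\<close>, where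
  \<open>W x = V x + \<alpha> x\<^sup>2 / 2 - \<alpha> m x\<close> and \<open>b = - W'\<close>.  Stationary measures therefore correspond
  to the values \<open>m\<close> that their own Gibbs law reproduces as its mean (\<open>stationary_measures_eq\<close>), and it
  remains to count these values.

  \<^bold>\<open>Counting.\<close>  Integration by parts turns the condition that the Gibbs law for \<open>m\<close> has mean \<open>m\<close> into
  the vanishing of the mean force, the integral of \<open>V'\<close> against the Boltzmann weight (\<open>force_balance\<close>).  By
  symmetry the mean force is odd in \<open>m\<close>, and it equals the integral of \<open>V' x sinh (2 \<alpha> m x / \<epsilon>)\<close>
  against a weight that does not depend on \<open>m\<close>.  On the positive half-line \<open>V'\<close> changes sign only once,
  at \<open>a\<close>, while \<open>sinh (p x) / sinh (r x)\<close> increases with \<open>x\<close> when \<open>p > r\<close>; increasing \<open>m\<close> shifts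
  the balance towards the region where \<open>V'\<close> is positive, so there is at most one zero \<open>m > 0\<close>
  (\<open>mean_force_single_crossing\<close>).  The mean force is positive for large \<open>m\<close>.  For small noise it is
  negative at \<open>m = a / 2\<close>, because there \<open>W\<close> attains values on the right of \<open>a / 2\<close> that are lower than
  all its values on the left (\<open>energy_gap\<close>, \<open>mean_force_neg_small_noise\<close>).  So the zeros are
  \<open>- m, 0, m\<close> for one \<open>m > 0\<close>.

  \<^bold>\<open>The frozen equation.\<close>  The noise is additive, so each path solves an ordinary integral equation with
  a continuous forcing term.  Convexity and symmetry of \<open>V''\<close> give
  \<open>b' \<le> - V'' 0\<close>, so for small \<open>h\<close> the map \<open>z \<mapsto> z - h b z\<close> is an increasing bijection.  The
  implicit Euler scheme \<open>Y\<^sub>k\<^sub>+\<^sub>1 - h b (Y\<^sub>k\<^sub>+\<^sub>1) = Y\<^sub>k + sqrt \<epsilon> (B\<^sub>k\<^sub>+\<^sub>1 - B\<^sub>k)\<close> is then well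
  defined and converges along every continuous path (\<open>euler_converges\<close>); its limit
  is an adapted solution, and properties of the law of this solution are read off from the scheme.

  \<^item> \<^emph>\<open>The Gibbs law is stationary.\<close>  Distribution functions evolve by the explicit formula
    \<open>P (Y\<^sub>k\<^sub>+\<^sub>1 \<le> z) = E (P (Y\<^sub>k \<le> y) at y = z - h b z - sqrt (\<epsilon> h) \<xi>)\<close> with \<open>\<xi>\<close> standard normal
    (\<open>chain_cdf_Suc\<close>).  This operator does not increase the supremum norm, and a Taylor expansion shows that
    it moves the Gibbs distribution function by at most a multiple of \<open>h sqrt h\<close>: the term of order \<open>h\<close>
    cancels because the Gibbs density \<open>p\<close> satisfies \<open>\<epsilon> / 2 p' = b p\<close> (\<open>gibbs_almost_invariant\<close>).  After
    \<open>t / h\<close> steps the error is of order \<open>sqrt h\<close>, and \<open>h\<close> tends to \<open>0\<close> (\<open>gibbs_invariant\<close>).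

  \<^item> \<^emph>\<open>Only the Gibbs law is stationary.\<close>  If the law \<open>u\<close> is preserved, then expanding \<open>E f\<close> along the
    scheme shows that \<open>b f' + \<epsilon> / 2 f''\<close> has integral \<open>0\<close> under \<open>u\<close> for every twice continuously
    differentiable \<open>f\<close> whose derivative has compact support (\<open>stationary_generator_zero\<close>).  For \<open>f' = k / \<rho>\<close> with \<open>\<rho>\<close> the Boltzmann weight this integrand is
    \<open>\<epsilon> / 2 k' / \<rho>\<close>, so \<open>u\<close> divided by \<open>\<rho>\<close> annihilates all derivatives \<open>k'\<close> and is a multiple of
    Lebesgue measure (\<open>generator_zero_imp_gibbs\<close>).

  Finally, a solution of the original equation that starts from a Gibbs law with the right mean might have a
  mean that moves.  Its distance to the frozen solution with the same noise is bounded by a multiple of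
  the integral of its mean displacement, and the displacement is bounded by the expected distance; Gronwall's
  inequality forces both to vanish (\<open>balanced_imp_stationary\<close>).
\<close>

section \<open>Integral equations and a Gronwall estimate\<close>

text \<open>
  Picard's theorem by a single contraction on the whole half-line.  The fixed point is sought in the form
  \<open>z t = exp (K t) f t\<close> with \<open>f\<close> bounded: since the integral of \<open>exp (K s)\<close> up to \<open>t\<close> is at most
  \<open>exp (K t) / K\<close>, the exponential weight makes the contraction factor \<open>L / K < 1 / 2\<close> on
  arbitrarily long time intervals.
\<close>

lemma lipschitz_integral_equation:
  fixes g w :: "real \<Rightarrow> real"
  assumes w: "continuous_on UNIV w"
    and lip: "\<And>x y. \<bar>g x - g y\<bar> \<le> L * \<bar>x - y\<bar>"
    and bdd: "\<And>x. \<bar>g x\<bar> \<le> M"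
  shows "\<exists>z. continuous_on {0..} z \<and> (\<forall>t\<ge>0. z t = integral {0..t} (\<lambda>s. g (w s + z s)))"
proof -
  have L0: "0 \<le> L" using order_trans[OF abs_ge_zero lip[of 1 0]] by simp
  have M0: "0 \<le> M" using bdd[of 0] by simp
  have g_cont: "continuous_on UNIV g"
  proof -
    have "L-lipschitz_on UNIV g" using lip L0 by (auto simp: lipschitz_on_def dist_real_def)
    then show ?thesis by (rule lipschitz_on_continuous_on)
  qed
  \<comment> \<open>Any weight exponent above \<open>2 L\<close> makes the map a contraction with factor \<open>1 / 2\<close>.\<close>
  define K where "K = 2 * L + 1"
  have K: "K > 0" using L0 by (simp add: K_def)
  define c where "c = (\<lambda>(f :: real \<Rightarrow>\<^sub>C real) s. g (w s + exp (K * s) * f s))"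
  have c_cont: "continuous_on S (c f)" for f S
    unfolding c_def
    by (intro continuous_on_compose2[OF g_cont] continuous_intros continuous_on_subset[OF w]) auto
  have c_int: "c f integrable_on {u..v}" for f u v
    by (rule integrable_continuous_real[OF c_cont])
  define P where "P = (\<lambda>(f :: real \<Rightarrow>\<^sub>C real) t. exp (- K * max 0 t) * integral {0..max 0 t} (c f))"
  have exp_bd: "exp (- K * s) * s \<le> 1 / K" if "s \<ge> 0" for s
  proof -
    have "K * s \<le> exp (K * s)" using exp_ge_add_one_self[of "K * s"] by linarith
    then have "exp (- K * s) * (K * s) \<le> exp (- K * s) * exp (K * s)" by (intro mult_left_mono) auto
    also have "\<dots> = 1" by (simp flip: exp_add)
    finally show ?thesis using K by (simp add: field_simps)
  qed
  have P_mem: "P f \<in> bcontfun" for f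
  proof (rule bcontfun_normI)
    have 1: "continuous_on {0..} (\<lambda>t. integral {0..t} (c f))"
    proof -
      have ct: "continuous_on {0..T} (\<lambda>t. integral {0..t} (c f))" for T
        by (rule indefinite_integral_continuous_1[OF c_int])
      then have "continuous (at x within {0..}) (\<lambda>t. integral {0..t} (c f))" if "x \<ge> 0" for x
      proof -
        have "continuous (at x within {0..x+1}) (\<lambda>t. integral {0..t} (c f))"
          using ct[of "x + 1"] that by (auto simp: continuous_on_eq_continuous_within)
        moreover have "at x within {0..x+1} = at x within {0..}"
          using that by (intro at_within_nhd[of x "{..<x+1}"]) auto
        ultimately show ?thesis by simp
      qed
      then show ?thesis by (auto simp: continuous_on_eq_continuous_within)
    qed
    show "continuous_on UNIV (P f)" unfolding P_def
      by (intro continuous_intros continuous_on_compose2[OF 1]) auto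
    show "norm (P f t) \<le> M / K" for t
    proof -
      let ?s = "max 0 t"
      have "norm (integral {0..?s} (c f)) \<le> M * (?s - 0)"
        by (rule integral_bound[OF _ c_cont]) (auto simp: c_def bdd)
      then have "norm (P f t) \<le> exp (- K * ?s) * (M * ?s)"
        by (simp add: P_def abs_mult)
      also have "\<dots> = M * (exp (- K * ?s) * ?s)" by simp
      also have "\<dots> \<le> M * (1 / K)" by (intro mult_left_mono exp_bd M0) auto
      finally show ?thesis by simp
    qed
  qed
  define Q where "Q = (\<lambda>f. Bcontfun (P f))"
  have Q: "apply_bcontfun (Q f) = P f" for f
    unfolding Q_def by (rule Bcontfun_inverse[OF P_mem])
  have contr: "dist (Q f) (Q h) \<le> (1/2) * dist f h" for f h
  proof (rule dist_bound)
    fix t :: real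
    let ?s = "max 0 t"
    have d: "\<bar>c f s - c h s\<bar> \<le> L * (exp (K * s) * dist f h)" for s
    proof -
      have "\<bar>c f s - c h s\<bar> \<le> L * \<bar>exp (K * s) * (f s - h s)\<bar>"
        unfolding c_def using lip[of "w s + exp (K * s) * f s" "w s + exp (K * s) * h s"]
        by (simp add: algebra_simps)
      also have "\<dots> = L * (exp (K * s) * dist (f s) (h s))" by (simp add: abs_mult dist_real_def)
      also have "\<dots> \<le> L * (exp (K * s) * dist f h)"
        by (intro mult_left_mono dist_bounded L0) auto
      finally show ?thesis .
    qed
    have hi: "((\<lambda>s. L * (exp (K * s) * dist f h)) has_integral
        (L * dist f h / K * exp (K * ?s) - L * dist f h / K * exp (K * 0))) {0..?s}"
      by (rule fundamental_theorem_of_calculus)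
         (use K in \<open>auto intro!: derivative_eq_intros simp flip: has_real_derivative_iff_has_vector_derivative\<close>)
    have "\<bar>integral {0..?s} (c f) - integral {0..?s} (c h)\<bar> = \<bar>integral {0..?s} (\<lambda>s. c f s - c h s)\<bar>"
      using c_int by (subst Henstock_Kurzweil_Integration.integral_diff) auto
    also have "\<dots> \<le> integral {0..?s} (\<lambda>s. L * (exp (K * s) * dist f h))"
      using d by (intro integral_norm_bound_integral[where 'a=real, simplified]
          integrable_diff c_int has_integral_integrable[OF hi]) auto
    also have "\<dots> = L * dist f h / K * (exp (K * ?s) - 1)"
      using integral_unique[OF hi] by (simp add: algebra_simps)
    also have "\<dots> \<le> L * dist f h / K * exp (K * ?s)"
      using L0 K by (intro mult_left_mono) auto
    finally have "exp (- K * ?s) * \<bar>integral {0..?s} (c f) - integral {0..?s} (c h)\<bar>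
        \<le> exp (- K * ?s) * (L * dist f h / K * exp (K * ?s))"
      by (intro mult_left_mono) auto
    also have "\<dots> = L / K * dist f h" by (simp add: field_simps flip: exp_add)
    also have "\<dots> \<le> (1/2) * dist f h"
      using L0 by (intro mult_right_mono) (auto simp: K_def field_simps)
    finally show "dist (Q f t) (Q h t) \<le> (1/2) * dist f h"
      by (simp add: Q P_def dist_real_def abs_mult flip: right_diff_distrib)
  qed
  have "\<exists>!f. Q f = f"
  proof -
    have "\<forall>f h. dist (Q f) (Q h) \<le> (1/2) * dist f h" using contr by blast
    from banach_fix_type[OF _ _ this] show ?thesis by simp
  qed
  then obtain f where f: "Q f = f" by auto
  define z where "z = (\<lambda>t. exp (K * t) * f t)"
  have "z t = integral {0..t} (\<lambda>s. g (w s + z s))" if "t \<ge> 0" for t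
  proof -
    have "f t = exp (- K * t) * integral {0..t} (c f)"
      using Q[of f] f that by (metis P_def max.absorb2)
    then have "z t = integral {0..t} (c f)"
      unfolding z_def by (simp add: mult.assoc[symmetric] flip: exp_add)
    then show ?thesis by (simp add: c_def z_def)
  qed
  moreover have "continuous_on {0..} z" unfolding z_def by (intro continuous_intros) auto
  ultimately show ?thesis by blast
qed

text \<open>
  A continuous path that ends above a level it started below has a last visit to that level.  After this time
  a dissipative drift has a known sign, which is how all one-sided estimates below are obtained.
\<close>

lemma last_crossing:
  fixes D :: "real \<Rightarrow> real"
  assumes "continuous_on {0..t} D" "0 \<le> t" "D 0 \<le> c" "c < D t"
  shows "\<exists>s. 0 \<le> s \<and> s < t \<and> D s = c \<and> (\<forall>r. s < r \<and> r \<le> t \<longrightarrow> c < D r)"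
proof -
  define S where "S = {r \<in> {0..t}. D r \<le> c}"
  have "closed S" unfolding S_def
    by (intro continuous_closed_preimage_constant continuous_on_closed_Collect_le assms) auto
  then have "compact S" unfolding compact_eq_bounded_closed
    by (auto simp: S_def intro: bounded_subset[of "{0..t}"])
  moreover have "S \<noteq> {}" using assms by (force simp: S_def)
  ultimately obtain s where s: "s \<in> S" "\<And>r. r \<in> S \<Longrightarrow> r \<le> s"
    using compact_attains_sup[of S] by metis
  have st0: "0 \<le> s" "s \<le> t" "D s \<le> c" using s(1) by (simp_all add: S_def)
  have "s \<noteq> t" using st0(3) assms(4) by auto
  then have st: "0 \<le> s" "s < t" "D s \<le> c" using st0 by simp_all
  have "D s = c"
  proof (rule ccontr)
    assume "D s \<noteq> c"
    then have "D s < c" using st by simp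
    obtain x where x: "s \<le> x" "x \<le> t" "D x = c"
      using IVT'[of D s c t] st assms continuous_on_subset[OF assms(1), of "{s..t}"] by auto
    then have "x \<in> S" using st by (auto simp: S_def)
    then have "x \<le> s" by (rule s(2))
    then have "x = s" using x by simp
    then show False using x \<open>D s < c\<close> by simp
  qed
  moreover have "c < D r" if "s < r" "r \<le> t" for r
  proof (rule ccontr)
    assume "\<not> c < D r"
    then have "r \<in> S" using that st by (simp add: S_def)
    then show False using s(2)[of r] that by simp
  qed
  ultimately show ?thesis using st by blast
qed

text \<open>
  The function \<open>exp (- K s) (A + K \<integral> f)\<close> is nonincreasing, its derivative being
  \<open>K exp (- K s) (f - (A + K \<integral> f))\<close>.
\<close>

lemma gronwall:
  fixes f :: "real \<Rightarrow> real"
  assumes f: "continuous_on {0..t} f" and t: "0 \<le> t" and K: "0 \<le> K"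
    and le: "\<And>s. 0 \<le> s \<Longrightarrow> s \<le> t \<Longrightarrow> f s \<le> A + K * integral {0..s} f"
  shows "f t \<le> A * exp (K * t)"
proof -
  define G where "G = (\<lambda>s. exp (- K * s) * (A + K * integral {0..s} f))"
  have "G t \<le> G 0"
  proof (rule DERIV_nonpos_imp_decreasing_open[OF t])
    show "continuous_on {0..t} G" unfolding G_def
      by (intro continuous_intros indefinite_integral_continuous_1 integrable_continuous_real f)
    fix s assume s: "0 < s" "s < t"
    have "((\<lambda>s. integral {0..s} f) has_real_derivative f s) (at s within {0..t})"
      using integral_has_real_derivative[OF f, of s] s by auto
    then have D: "((\<lambda>s. integral {0..s} f) has_real_derivative f s) (at s)"
      using s by (simp add: at_within_Icc_at)
    have "(G has_real_derivative (exp (- K * s) * (K * (f s - (A + K * integral {0..s} f))))) (at s)"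
      unfolding G_def by (rule derivative_eq_intros D refl | simp)+ (simp add: algebra_simps)
    moreover have "exp (- K * s) * (K * (f s - (A + K * integral {0..s} f))) \<le> 0"
      using le[of s] s K by (auto intro!: mult_nonneg_nonpos)
    ultimately show "\<exists>y. (G has_real_derivative y) (at s) \<and> y \<le> 0" by blast
  qed
  then have "exp (- K * t) * (A + K * integral {0..t} f) \<le> A" by (simp add: G_def)
  moreover have "exp (- K * t) * f t \<le> exp (- K * t) * (A + K * integral {0..t} f)"
    using le[of t] t by (intro mult_left_mono) auto
  ultimately have "exp (- K * t) * f t \<le> A" by linarith
  then have "exp (K * t) * (exp (- K * t) * f t) \<le> exp (K * t) * A" by (intro mult_left_mono) auto
  moreover have "exp (K * t) * (exp (- K * t) * f t) = f t"
  proof -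
    have "exp (K * t) * exp (- K * t) = 1" by (simp flip: exp_add)
    then show ?thesis by (metis mult.assoc mult_1)
  qed
  ultimately show ?thesis by (metis mult.commute)
qed

section \<open>Integral equations with a dissipative drift\<close>

text \<open>
  The drift may grow fast, but its derivative is bounded above, and outside of \<open>[- R, R]\<close> it points towards the
  origin.  The first property yields stability, the second prevents explosion.
\<close>

locale dissipative_drift =
  fixes b b' :: "real \<Rightarrow> real" and \<theta> R :: real
  assumes drift_deriv: "\<And>x. (b has_real_derivative b' x) (at x)"
    and drift_deriv_cont: "continuous_on UNIV b'"
    and drift_deriv_le: "\<And>x. b' x \<le> \<theta>"
    and theta_nonneg: "0 \<le> \<theta>"
    and radius_nonneg: "0 \<le> R"
    and inward_right: "\<And>x. R \<le> x \<Longrightarrow> b x \<le> 0"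
    and inward_left: "\<And>x. x \<le> - R \<Longrightarrow> 0 \<le> b x"
begin

lemma drift_cont: "continuous_on S b"
  using drift_deriv by (meson DERIV_continuous continuous_at_imp_continuous_on)

lemma drift_cont_compose: "continuous_on S f \<Longrightarrow> continuous_on S (\<lambda>x. b (f x))"
  by (rule continuous_on_compose2[OF drift_cont[of UNIV]]) auto

lemma drift_measurable [measurable]: "b \<in> borel_measurable borel"
  by (rule borel_measurable_continuous_onI[OF drift_cont])

lemma one_sided_lipschitz:
  assumes "x \<le> y"
  shows "b y - b x \<le> \<theta> * (y - x)"
proof (cases "x = y")
  case False
  with assms have "x < y" by simp
  then obtain z where "b y - b x = (y - x) * b' z"
    using MVT2[of x y b b'] drift_deriv by auto
  also have "\<dots> \<le> (y - x) * \<theta>" using assms drift_deriv_le by (intro mult_left_mono) auto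
  finally show ?thesis by (simp add: mult.commute)
qed simp

lemma drift_lipschitz_on_interval:
  "\<exists>L\<ge>0. \<forall>x\<in>{-N..N}. \<forall>y\<in>{-N..N}. \<bar>b x - b y\<bar> \<le> L * \<bar>x - y\<bar>"
proof -
  have "compact (b' ` {-N..N})"
    by (intro compact_continuous_image continuous_on_subset[OF drift_deriv_cont]) auto
  then obtain L where L: "\<And>x. x \<in> {-N..N} \<Longrightarrow> \<bar>b' x\<bar> \<le> L"
    by (meson bounded_real compact_imp_bounded image_eqI)
  have *: "\<bar>b x - b y\<bar> \<le> max L 0 * \<bar>x - y\<bar>" if "x \<in> {-N..N}" "y \<in> {-N..N}" "x < y" for x y
  proof -
    obtain z where z: "x < z" "z < y" "b y - b x = (y - x) * b' z"
      using MVT2[OF \<open>x < y\<close>, of b b'] drift_deriv by auto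
    have "\<bar>b x - b y\<bar> = \<bar>b y - b x\<bar>" by (rule abs_minus_commute)
    also have "\<dots> = \<bar>y - x\<bar> * \<bar>b' z\<bar>" unfolding z(3) by (rule abs_mult)
    also have "\<dots> \<le> \<bar>y - x\<bar> * max L 0"
      using L[of z] z that by (intro mult_left_mono) auto
    finally show ?thesis by (simp add: mult.commute abs_minus_commute)
  qed
  have "\<bar>b x - b y\<bar> \<le> max L 0 * \<bar>x - y\<bar>" if "x \<in> {-N..N}" "y \<in> {-N..N}" for x y
  proof (cases x y rule: linorder_cases)
    case less then show ?thesis using * that by blast
  next
    case greater then show ?thesis using *[of y x] that by (simp add: abs_minus_commute)
  qed simp
  then show ?thesis by (intro exI[of _ "max L 0"]) auto
qed

text \<open>
  The drift is only locally Lipschitz, so it is first frozen outside of \<open>[- N, N]\<close>.  The solution \<open>y\<close> of the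
  truncated equation is \<open>w + z\<close> with \<open>z\<close> differentiable.  If \<open>\<bar>w\<bar> \<le> A\<close>, then \<open>z\<close> cannot
  exceed \<open>R + A\<close>: after its last visit to this level \<open>w + z \<ge> R\<close>, where the drift is nonpositive.  Hence
  \<open>\<bar>y\<bar> \<le> R + 2 A\<close>, and with \<open>N = R + 2 A\<close> the truncation is never felt.
\<close>

lemma path_exists:
  fixes T :: real
  assumes w: "continuous_on {0..T} w" and T: "0 \<le> T"
  shows "\<exists>y. continuous_on {0..T} y \<and>
    (\<forall>s\<in>{0..T}. y s = w s + integral {0..s} (\<lambda>r. b (y r)))"
proof -
  define w' where "w' = (\<lambda>s. w (max 0 (min T s)))"
  have w'_cont: "continuous_on UNIV w'" unfolding w'_def
    using T by (intro continuous_on_compose2[OF w] continuous_intros) auto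
  have "compact (w ` {0..T})" by (intro compact_continuous_image w) auto
  then obtain A where A: "\<And>s. s \<in> {0..T} \<Longrightarrow> \<bar>w s\<bar> \<le> A"
    by (meson bounded_real compact_imp_bounded image_eqI)
  have w'A: "\<bar>w' s\<bar> \<le> A" for s unfolding w'_def using A T by auto
  have A0: "0 \<le> A" using w'A[of 0] by linarith
  define N where "N = R + 2 * A"
  have NR: "R \<le> N" "0 \<le> N" using A0 radius_nonneg by (auto simp: N_def)
  define g where "g = (\<lambda>x. b (max (-N) (min N x)))"
  have clamp: "max (-N) (min N x) \<in> {-N..N}" for x using NR by auto
  obtain L where L: "L \<ge> 0" "\<And>x y. x \<in> {-N..N} \<Longrightarrow> y \<in> {-N..N} \<Longrightarrow> \<bar>b x - b y\<bar> \<le> L * \<bar>x - y\<bar>"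
    using drift_lipschitz_on_interval[of N] by blast
  have lip: "\<bar>g x - g y\<bar> \<le> L * \<bar>x - y\<bar>" for x y
  proof -
    have "\<bar>g x - g y\<bar> \<le> L * \<bar>max (-N) (min N x) - max (-N) (min N y)\<bar>"
      unfolding g_def by (intro L clamp)
    also have "\<dots> \<le> L * \<bar>x - y\<bar>" using L(1) by (intro mult_left_mono) auto
    finally show ?thesis .
  qed
  have bdd: "\<bar>g x\<bar> \<le> \<bar>b 0\<bar> + L * N" for x
  proof -
    have "\<bar>g x - b 0\<bar> \<le> L * \<bar>max (-N) (min N x) - 0\<bar>"
      unfolding g_def using NR by (intro L clamp) auto
    also have "\<dots> \<le> L * N" using L(1) clamp[of x] by (intro mult_left_mono) auto
    finally show ?thesis by linarith
  qed
  have g_neg: "g x \<le> 0" if "R \<le> x" for x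
    unfolding g_def using that NR by (intro inward_right) auto
  have g_pos: "0 \<le> g x" if "x \<le> - R" for x
    unfolding g_def using that NR by (intro inward_left) auto
  have g_cont: "continuous_on S g" for S unfolding g_def
    by (intro drift_cont_compose continuous_intros)
  obtain z where z: "continuous_on {0..} z"
    "\<And>t. t \<ge> 0 \<Longrightarrow> z t = integral {0..t} (\<lambda>s. g (w' s + z s))"
    using lipschitz_integral_equation[OF w'_cont lip bdd] by blast
  have gz_cont: "continuous_on {0..} (\<lambda>s. g (w' s + z s))"
    by (intro continuous_on_compose2[OF g_cont[of UNIV]] continuous_intros z(1)
        continuous_on_subset[OF w'_cont]) auto
  have gz_int: "(\<lambda>s. g (w' s + z s)) integrable_on {u..v}" if "0 \<le> u" for u v
    using that by (intro integrable_continuous_real continuous_on_subset[OF gz_cont]) auto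
  have incr: "z t - z s = integral {s..t} (\<lambda>s. g (w' s + z s))" if "0 \<le> s" "s \<le> t" for s t
    using Henstock_Kurzweil_Integration.integral_combine[of 0 s t "\<lambda>s. g (w' s + z s)"] z(2)[of s] z(2)[of t]
      gz_int[of 0 t] that by simp
  have z0: "z 0 = 0" using z(2)[of 0] by simp
  have upper: "z t \<le> R + A" if "0 \<le> t" for t
  proof (rule ccontr)
    assume "\<not> z t \<le> R + A"
    then have "\<exists>s. 0 \<le> s \<and> s < t \<and> z s = R + A \<and> (\<forall>r. s < r \<and> r \<le> t \<longrightarrow> R + A < z r)"
      using that z0 A0 radius_nonneg by (intro last_crossing continuous_on_subset[OF z(1)]) auto
    then obtain s where s: "0 \<le> s" "s < t" "z s = R + A" "\<And>r. s < r \<Longrightarrow> r \<le> t \<Longrightarrow> R + A < z r"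
      by blast
    have "integral {s..t} (\<lambda>s. g (w' s + z s)) \<le> integral {s..t} (\<lambda>s. 0)"
    proof (intro integral_le gz_int s integrable_0 g_neg)
      fix r assume "r \<in> {s..t}"
      then have "R + A \<le> z r" using s(3) s(4)[of r] by (cases "r = s") auto
      then show "R \<le> w' r + z r" using w'A[of r] by linarith
    qed
    then show False using incr[of s t] s \<open>\<not> z t \<le> R + A\<close> by simp
  qed
  have lower: "- (R + A) \<le> z t" if "0 \<le> t" for t
  proof (rule ccontr)
    assume "\<not> - (R + A) \<le> z t"
    then have "\<exists>s. 0 \<le> s \<and> s < t \<and> - z s = R + A \<and> (\<forall>r. s < r \<and> r \<le> t \<longrightarrow> R + A < - z r)"
      using that z0 A0 radius_nonneg
      by (intro last_crossing continuous_on_minus continuous_on_subset[OF z(1)]) auto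
    then obtain s where s: "0 \<le> s" "s < t" "- z s = R + A" "\<And>r. s < r \<Longrightarrow> r \<le> t \<Longrightarrow> R + A < - z r"
      by blast
    have "integral {s..t} (\<lambda>s. 0) \<le> integral {s..t} (\<lambda>s. g (w' s + z s))"
    proof (intro integral_le gz_int s integrable_0 g_pos)
      fix r assume "r \<in> {s..t}"
      then have "R + A \<le> - z r" using s(3) s(4)[of r] by (cases "r = s") auto
      then show "w' r + z r \<le> - R" using w'A[of r] by linarith
    qed
    then show False using incr[of s t] s \<open>\<not> - (R + A) \<le> z t\<close> by simp
  qed
  define y where "y = (\<lambda>s. w' s + z s)"
  have gy: "g (y s) = b (y s)" if "0 \<le> s" for s
  proof -
    have "\<bar>y s\<bar> \<le> N" unfolding y_def N_def using upper[OF that] lower[OF that] w'A[of s] by linarith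
    then show ?thesis unfolding g_def by (auto simp: abs_le_iff max_def min_def)
  qed
  have "y s = w s + integral {0..s} (\<lambda>r. b (y r))" if "s \<in> {0..T}" for s
  proof -
    have "z s = integral {0..s} (\<lambda>r. g (y r))" using z(2) that unfolding y_def by auto
    also have "\<dots> = integral {0..s} (\<lambda>r. b (y r))" by (rule integral_cong) (simp add: gy)
    finally show ?thesis using that by (simp add: y_def w'_def)
  qed
  moreover have "continuous_on {0..T} y" unfolding y_def
    by (intro continuous_intros continuous_on_subset[OF w'_cont] continuous_on_subset[OF z(1)]) auto
  ultimately show ?thesis by blast
qed

text \<open>
  One step of size \<open>h\<close> of the implicit scheme, the inverse of \<open>z \<mapsto> z - h b z\<close>.  For step sizes at which
  this map might fail to be invertible the value is set to \<open>0\<close>, which keeps the map measurable.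
\<close>

definition step :: "real \<Rightarrow> real \<Rightarrow> real" where
  "step h y = (if h * \<theta> < 1 then THE z. z - h * b z = y else 0)"

primrec euler :: "real \<Rightarrow> real \<Rightarrow> (nat \<Rightarrow> real) \<Rightarrow> nat \<Rightarrow> real" where
  "euler h x d 0 = x"
| "euler h x d (Suc k) = step h (euler h x d k + d k)"

lemma backward_map_expands:
  assumes "0 \<le> h" "x \<le> y"
  shows "(1 - h * \<theta>) * (y - x) \<le> (y - h * b y) - (x - h * b x)"
proof -
  have "h * (b y - b x) \<le> h * (\<theta> * (y - x))"
    using one_sided_lipschitz[OF assms(2)] assms(1) by (rule mult_left_mono)
  then show ?thesis by (simp add: algebra_simps)
qed

lemma backward_map_strict_mono:
  assumes "0 \<le> h" "h * \<theta> < 1" "x < y"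
  shows "x - h * b x < y - h * b y"
proof -
  have "0 < (1 - h * \<theta>) * (y - x)" using assms by simp
  then show ?thesis using backward_map_expands[of h x y] assms by linarith
qed

lemma step_eq:
  assumes h: "0 \<le> h" "h * \<theta> < 1"
  shows "step h y - h * b (step h y) = y"
proof -
  let ?\<psi> = "\<lambda>z. z - h * b z"
  define c where "c = 1 - h * \<theta>"
  define \<delta> where "\<delta> = \<bar>y - ?\<psi> 0\<bar> / c"
  have c: "c > 0" using h by (simp add: c_def)
  have \<delta>: "0 \<le> \<delta>" "c * \<delta> = \<bar>y - ?\<psi> 0\<bar>" using c by (auto simp: \<delta>_def)
  have 1: "c * \<delta> \<le> ?\<psi> \<delta> - ?\<psi> 0"
    using backward_map_expands[of h 0 \<delta>] h \<delta> by (simp add: c_def)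
  have 2: "c * \<delta> \<le> ?\<psi> 0 - ?\<psi> (-\<delta>)"
    using backward_map_expands[of h "-\<delta>" 0] h \<delta> by (simp add: c_def)
  have "\<exists>z\<ge>-\<delta>. z \<le> \<delta> \<and> ?\<psi> z = y"
    using 1 2 \<delta> by (intro IVT' continuous_intros drift_cont) linarith+
  then obtain z where "?\<psi> z = y" by blast
  moreover have "x = z" if "?\<psi> x = y" for x
    using backward_map_strict_mono[OF h, of x z] backward_map_strict_mono[OF h, of z x] that \<open>?\<psi> z = y\<close>
    by (cases x z rule: linorder_cases) auto
  ultimately have "\<exists>!z. ?\<psi> z = y" by blast
  then show ?thesis unfolding step_def using h theI'[of "\<lambda>z. ?\<psi> z = y"] by simp
qed

text \<open>
  The implicit step is preferred to an explicit one because of this equivalence: it makes the distribution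
  function after a step explicit, since only the increasing map \<open>z \<mapsto> z - h b z\<close> occurs and not its inverse.
\<close>

lemma step_le_iff:
  assumes h: "0 \<le> h" "h * \<theta> < 1"
  shows "step h y \<le> z \<longleftrightarrow> y \<le> z - h * b z"
  using backward_map_strict_mono[OF h, of "step h y" z] backward_map_strict_mono[OF h, of z "step h y"]
    step_eq[OF h, of y]
  by (cases "step h y" z rule: linorder_cases) auto

lemma step_measurable [measurable]:
  assumes "0 \<le> h"
  shows "step h \<in> borel_measurable borel"
proof (cases "h * \<theta> < 1")
  case True
  have "mono (step h)"
    by (rule monoI) (metis step_le_iff[OF assms True] order.refl order.trans)
  then show ?thesis by (rule borel_measurable_mono)
next
  case False
  then have "step h = (\<lambda>_. 0)" by (auto simp: step_def)
  then show ?thesis by simp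
qed

lemma euler_measurable:
  assumes "0 \<le> h" "X0 \<in> borel_measurable M" "\<And>i. i < k \<Longrightarrow> D i \<in> borel_measurable M"
  shows "(\<lambda>\<omega>. euler h (X0 \<omega>) (\<lambda>i. D i \<omega>) k) \<in> borel_measurable M"
  using assms(3)
proof (induction k)
  case 0
  then show ?case using assms by simp
next
  case (Suc k)
  have "(\<lambda>\<omega>. euler h (X0 \<omega>) (\<lambda>i. D i \<omega>) k + D k \<omega>) \<in> borel_measurable M"
    using Suc by (intro borel_measurable_add) auto
  from measurable_compose[OF this step_measurable[OF assms(1)]] show ?case by simp
qed

end

definition grid :: "real \<Rightarrow> nat \<Rightarrow> nat \<Rightarrow> real" where
  "grid t n k = real k * (t / real n)"

definition increment :: "(real \<Rightarrow> real) \<Rightarrow> real \<Rightarrow> nat \<Rightarrow> nat \<Rightarrow> real" where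
  "increment w t n k = w (grid t n (Suc k)) - w (grid t n k)"

lemma grid_simps [simp]: "grid t n 0 = 0" "n > 0 \<Longrightarrow> grid t n n = t"
  by (auto simp: grid_def)

lemma grid_nonneg [simp]: "0 \<le> t \<Longrightarrow> 0 \<le> grid t n k"
  by (simp add: grid_def)

lemma grid_mono: "0 \<le> t \<Longrightarrow> k \<le> l \<Longrightarrow> grid t n k \<le> grid t n l"
  unfolding grid_def by (intro mult_right_mono) auto

lemma grid_le: "0 \<le> t \<Longrightarrow> k \<le> n \<Longrightarrow> grid t n k \<le> t"
  using grid_mono[of t k n n] by (cases "n = 0") (auto simp: grid_def)

lemma grid_Suc: "grid t n (Suc k) = grid t n k + t / real n"
  by (simp add: grid_def algebra_simps add_divide_distrib)

context dissipative_drift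
begin

text \<open>
  An exact solution satisfies the implicit recursion up to a defect of size \<open>h \<kappa>\<close>, where \<open>\<kappa>\<close> is the
  oscillation of the continuous function \<open>b (y s)\<close> over one step.  As \<open>z \<mapsto> z - h b z\<close> expands distances at
  least by the factor \<open>1 - h \<theta>\<close>, a step multiplies errors by at most \<open>q = 1 / (1 - h \<theta>) \<le> exp (2 h \<theta>)\<close>, and
  after \<open>t / h\<close> steps the accumulated error is at most \<open>exp (2 \<theta> t) t \<kappa>\<close>.
\<close>

lemma euler_converges:
  assumes y: "continuous_on {0..t} y" and t: "0 \<le> t" and w0: "w 0 = 0" and \<eta>: "0 < \<eta>"
    and eq: "\<And>s. s \<in> {0..t} \<Longrightarrow> y s = x + w s + integral {0..s} (\<lambda>r. b (y r))"
  shows "\<exists>N. \<forall>n\<ge>N. \<forall>k\<le>n. \<bar>euler (t / real n) x (increment w t n) k - y (grid t n k)\<bar> \<le> \<eta>"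
proof -
  define \<kappa> where "\<kappa> = \<eta> / (exp (2 * \<theta> * t) * t + 1)"
  have pos: "0 < exp (2 * \<theta> * t) * t + 1" using t by (simp add: add_nonneg_pos)
  have \<kappa>: "\<kappa> > 0" unfolding \<kappa>_def using pos \<eta> by simp
  have by_cont: "continuous_on {0..t} (\<lambda>s. b (y s))" by (rule drift_cont_compose[OF y])
  have by_int: "(\<lambda>s. b (y s)) integrable_on {u..v}" if "0 \<le> u" "v \<le> t" for u v
    using that by (intro integrable_continuous_real continuous_on_subset[OF by_cont]) auto
  have "uniformly_continuous_on {0..t} (\<lambda>s. b (y s))"
    by (rule compact_uniformly_continuous[OF by_cont]) auto
  then obtain d where d: "d > 0"
    "\<And>s r. s \<in> {0..t} \<Longrightarrow> r \<in> {0..t} \<Longrightarrow> \<bar>s - r\<bar> < d \<Longrightarrow> \<bar>b (y s) - b (y r)\<bar> < \<kappa>"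
    unfolding uniformly_continuous_on_def dist_real_def using \<kappa> by (metis abs_minus_commute)
  obtain N where N: "real N > t / d + 2 * \<theta> * t + 1" using reals_Archimedean2 by blast
  have "\<bar>euler (t / real n) x (increment w t n) k - y (grid t n k)\<bar> \<le> \<eta>" if n: "N \<le> n" and k: "k \<le> n" for n k
  proof -
    \<comment> \<open>The choice of \<open>N\<close> makes the step smaller than the modulus \<open>d\<close> and \<open>h \<theta> \<le> 1 / 2\<close>.\<close>
    define h where "h = t / real n"
    have td: "0 \<le> t / d" "0 \<le> 2 * \<theta> * t" using d t theta_nonneg by auto
    have n_gt: "real n > t / d" "real n > 2 * \<theta> * t" "real n > 0"
      using N n td by linarith+
    have h0: "0 \<le> h" using t by (simp add: h_def)
    have hd: "h < d" unfolding h_def using n_gt d by (simp add: field_simps)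
    have h\<theta>: "h * \<theta> \<le> 1/2" unfolding h_def using n_gt by (simp add: field_simps)
    define q where "q = 1 / (1 - h * \<theta>)"
    have q1: "1 \<le> q" using h\<theta> h0 theta_nonneg unfolding q_def by (simp add: field_simps)
    have q_exp: "q \<le> exp (2 * (h * \<theta>))"
    proof -
      have "1 \<le> (1 - h * \<theta>) * (1 + 2 * (h * \<theta>))"
      proof -
        have "0 \<le> (h * \<theta>) * (1 - 2 * (h * \<theta>))" using h\<theta> h0 theta_nonneg by simp
        then show ?thesis by (simp add: algebra_simps)
      qed
      then have "q \<le> 1 + 2 * (h * \<theta>)" unfolding q_def using h\<theta> by (simp add: field_simps)
      then show ?thesis using exp_ge_add_one_self[of "2 * (h * \<theta>)"] by linarith
    qed
    let ?E = "euler h x (increment w t n)"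
    have err: "\<bar>?E k - y (grid t n k)\<bar> \<le> q ^ k * (real k * (h * \<kappa>))" if "k \<le> n" for k
      using that
    proof (induction k)
      case 0
      then show ?case using eq[of 0] t w0 by simp
    next
      case (Suc k)
      define u where "u = grid t n k"
      define v where "v = grid t n (Suc k)"
      have uv: "0 \<le> u" "u \<le> v" "v \<le> t" "v - u = h"
        using t grid_mono[of t k "Suc k" n] grid_le[of t "Suc k" n] Suc.prems
        unfolding u_def v_def by (auto simp: grid_Suc h_def)
      have "integral {0..v} (\<lambda>r. b (y r)) = integral {0..u} (\<lambda>r. b (y r)) + integral {u..v} (\<lambda>r. b (y r))"
        using Henstock_Kurzweil_Integration.integral_combine[of 0 u v "\<lambda>r. b (y r)"] uv by_int[of 0 v] by simp
      then have yv: "y v = y u + increment w t n k + integral {u..v} (\<lambda>r. b (y r))"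
        using eq[of u] eq[of v] uv by (simp add: increment_def u_def v_def)
      have "\<bar>integral {u..v} (\<lambda>r. b (y r)) - h * b (y v)\<bar> = \<bar>integral {u..v} (\<lambda>r. b (y r) - b (y v))\<bar>"
        using uv by_int[of u v] by (subst Henstock_Kurzweil_Integration.integral_diff) auto
      also have "\<dots> \<le> \<kappa> * (v - u)"
      proof (rule integral_bound[where 'a=real, simplified])
        show "u \<le> v" by (rule uv)
        show "continuous_on {u..v} (\<lambda>r. b (y r) - b (y v))"
          using uv by (intro continuous_intros continuous_on_subset[OF by_cont]) auto
        show "\<bar>b (y r) - b (y v)\<bar> \<le> \<kappa>" if "u \<le> r \<and> r \<le> v" for r
          using d(2)[of r v] that uv hd by auto
      qed
      finally have res: "\<bar>y v - h * b (y v) - (y u + increment w t n k)\<bar> \<le> \<kappa> * h"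
        using yv uv by simp
      have Ev: "?E (Suc k) - h * b (?E (Suc k)) = ?E k + increment w t n k"
        using step_eq[of h "?E k + increment w t n k"] h0 h\<theta> by simp
      have "(1 - h * \<theta>) * \<bar>?E (Suc k) - y v\<bar>
          \<le> \<bar>(?E (Suc k) - h * b (?E (Suc k))) - (y v - h * b (y v))\<bar>"
        using backward_map_expands[OF h0, of "?E (Suc k)" "y v"] backward_map_expands[OF h0, of "y v" "?E (Suc k)"]
        by (cases "?E (Suc k) \<le> y v") (simp_all add: abs_if)
      also have "\<dots> \<le> \<bar>?E k - y u\<bar> + \<kappa> * h" using res Ev by linarith
      also have "\<dots> \<le> q ^ k * (real k * (h * \<kappa>)) + \<kappa> * h" using Suc by (simp add: u_def)
      also have "\<dots> \<le> q ^ k * (real k * (h * \<kappa>)) + q ^ k * (\<kappa> * h)"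
      proof -
        have "1 * (\<kappa> * h) \<le> q ^ k * (\<kappa> * h)"
          using q1 \<kappa> h0 by (intro mult_right_mono) (auto simp: one_le_power)
        then show ?thesis by simp
      qed
      also have "\<dots> = q ^ k * (real (Suc k) * (h * \<kappa>))" by (simp add: algebra_simps)
      finally have "q * ((1 - h * \<theta>) * \<bar>?E (Suc k) - y v\<bar>) \<le> q * (q ^ k * (real (Suc k) * (h * \<kappa>)))"
        using q1 by (intro mult_left_mono) auto
      moreover have "q * (1 - h * \<theta>) = 1" unfolding q_def using h\<theta> by (simp add: field_simps)
      ultimately show ?case unfolding v_def by (simp add: mult.assoc[symmetric])
    qed
    have "q ^ k * (real k * (h * \<kappa>)) \<le> exp (2 * \<theta> * t) * (t * \<kappa>)"
    proof (rule mult_mono)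
      have "q ^ k \<le> q ^ n" using q1 k by (rule power_increasing[rotated])
      also have "\<dots> \<le> exp (2 * (h * \<theta>)) ^ n" using q1 q_exp by (intro power_mono) auto
      also have "\<dots> = exp (2 * \<theta> * t)" using n_gt
        by (simp add: h_def field_simps flip: exp_of_nat_mult)
      finally show "q ^ k \<le> exp (2 * \<theta> * t)" .
      have "real k * h \<le> real n * h" using k h0 by (intro mult_right_mono) auto
      also have "\<dots> = t" using n_gt by (simp add: h_def)
      finally have "real k * h * \<kappa> \<le> t * \<kappa>" using \<kappa> by (intro mult_right_mono) auto
      then show "real k * (h * \<kappa>) \<le> t * \<kappa>" by (simp add: mult.assoc)
      show "0 \<le> real k * (h * \<kappa>)" using h0 \<kappa> by simp
    qed auto
    also have "\<dots> = (exp (2 * \<theta> * t) * t) * \<kappa>" by simp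
    also have "\<dots> \<le> (exp (2 * \<theta> * t) * t + 1) * \<kappa>" using \<kappa> by (simp add: algebra_simps)
    also have "\<dots> = \<eta>" using pos by (simp add: \<kappa>_def)
    finally show ?thesis using err[OF k] by (simp add: h_def)
  qed
  then show ?thesis by blast
qed

text \<open>
  The solution is defined as the limit of the scheme and not by choosing a solution for each path: as a limit of
  explicit functions of finitely many values of the noise it is measurable and adapted, and the solutions on
  different time intervals agree, being limits of the same scheme.
\<close>

definition flow :: "real \<Rightarrow> (real \<Rightarrow> real) \<Rightarrow> real \<Rightarrow> real" where
  "flow x w t = lim (\<lambda>n. euler (t / real n) x (increment w t n) n)"

lemma euler_tendsto:
  assumes y: "continuous_on {0..t} y" and t: "0 \<le> t" and w0: "w 0 = 0"
    and eq: "\<And>s. s \<in> {0..t} \<Longrightarrow> y s = x + w s + integral {0..s} (\<lambda>r. b (y r))"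
  shows "(\<lambda>n. euler (t / real n) x (increment w t n) n) \<longlonglongrightarrow> y t"
proof (rule LIMSEQ_I)
  fix r :: real assume "0 < r"
  then obtain N where N: "\<And>n k. n \<ge> N \<Longrightarrow> k \<le> n \<Longrightarrow>
      \<bar>euler (t / real n) x (increment w t n) k - y (grid t n k)\<bar> \<le> r / 2"
    using euler_converges[OF y t w0 _ eq, of "r/2"] by auto
  show "\<exists>no. \<forall>n\<ge>no. norm (euler (t / real n) x (increment w t n) n - y t) < r"
  proof (intro exI[of _ "max N 1"] allI impI)
    fix n assume "max N 1 \<le> n"
    then show "norm (euler (t / real n) x (increment w t n) n - y t) < r"
      using N[of n n] \<open>0 < r\<close> by simp
  qed
qed

lemma flow_solves:
  assumes w: "continuous_on {0..} w" and w0: "w 0 = 0"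
  shows "continuous_on {0..} (flow x w)"
    and "t \<ge> 0 \<Longrightarrow> flow x w t = x + w t + integral {0..t} (\<lambda>r. b (flow x w r))"
    and "t \<ge> 0 \<Longrightarrow> (\<lambda>n. euler (t / real n) x (increment w t n) n) \<longlonglongrightarrow> flow x w t"
proof -
  have loc: "\<exists>y. continuous_on {0..T} y \<and> (\<forall>s\<in>{0..T}. flow x w s = y s) \<and>
      (\<forall>s\<in>{0..T}. y s = x + w s + integral {0..s} (\<lambda>r. b (y r)))" if T: "0 \<le> T" for T
  proof -
    have "continuous_on {0..T} (\<lambda>s. x + w s)"
      by (intro continuous_intros continuous_on_subset[OF w]) auto
    then obtain y where y: "continuous_on {0..T} y"
      "\<And>s. s \<in> {0..T} \<Longrightarrow> y s = x + w s + integral {0..s} (\<lambda>r. b (y r))"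
      using path_exists[OF _ T, of "\<lambda>s. x + w s"] by auto
    have "flow x w s = y s" if s: "s \<in> {0..T}" for s
      unfolding flow_def
      by (intro limI euler_tendsto w0 continuous_on_subset[OF y(1)] y(2)) (use s in auto)
    then show ?thesis using y by blast
  qed
  have ct: "continuous_on {0..T} (flow x w)" if "0 \<le> T" for T
    using loc[OF that] by (metis (no_types, lifting) continuous_on_cong)
  have "continuous (at s within {0..}) (flow x w)" if "s \<ge> 0" for s
  proof -
    have "continuous (at s within {0..s+1}) (flow x w)"
      using ct[of "s+1"] that by (auto simp: continuous_on_eq_continuous_within)
    moreover have "at s within {0..s+1} = at s within {0..}"
      using that by (intro at_within_nhd[of s "{..<s+1}"]) auto
    ultimately show ?thesis by simp
  qed
  then show 1: "continuous_on {0..} (flow x w)"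
    by (auto simp: continuous_on_eq_continuous_within)
  show 2: "flow x w t = x + w t + integral {0..t} (\<lambda>r. b (flow x w r))" if t: "t \<ge> 0" for t
  proof -
    obtain y where y: "\<forall>s\<in>{0..t}. flow x w s = y s"
      "\<forall>s\<in>{0..t}. y s = x + w s + integral {0..s} (\<lambda>r. b (y r))"
      using loc[OF t] by blast
    have "integral {0..t} (\<lambda>r. b (y r)) = integral {0..t} (\<lambda>r. b (flow x w r))"
      using y(1) by (intro integral_cong) auto
    then show ?thesis using y t by auto
  qed
  show "(\<lambda>n. euler (t / real n) x (increment w t n) n) \<longlonglongrightarrow> flow x w t" if t: "t \<ge> 0" for t
    using 2 t by (intro euler_tendsto w0 continuous_on_subset[OF 1]) auto
qed

text \<open>
  Since the last time when \<open>X = Y\<close>, the difference \<open>X - Y\<close> has been positive, so the drifts have contributed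
  at most \<open>\<theta> (X - Y)\<close> per unit of time.  Only integrals of \<open>p\<close> are used, because the extra drift will be the
  displacement of a mean, about which nothing but integrability is known.
\<close>

lemma comparison_upper:
  fixes t :: real
  assumes D: "continuous_on {0..t} X" "continuous_on {0..t} Y"
    and p: "p absolutely_integrable_on {0..t}"
    and eq: "\<And>r. r \<in> {0..t} \<Longrightarrow> X r - Y r = integral {0..r} (\<lambda>s. b (X s) - b (Y s)) + integral {0..r} p"
    and s: "s \<in> {0..t}"
  shows "X s - Y s \<le> integral {0..t} (\<lambda>r. \<bar>p r\<bar>) + \<theta> * integral {0..s} (\<lambda>r. \<bar>X r - Y r\<bar>)"
proof (cases "X s - Y s \<le> 0")
  case True
  moreover have "0 \<le> integral {0..t} (\<lambda>r. \<bar>p r\<bar>)" "0 \<le> integral {0..s} (\<lambda>r. \<bar>X r - Y r\<bar>)"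
    using p s by (auto intro!: integral_nonneg integrable_continuous_real continuous_intros
        continuous_on_subset[OF D(1)] continuous_on_subset[OF D(2)] simp: absolutely_integrable_on_def)
  ultimately show ?thesis using theta_nonneg by (smt (verit) mult_nonneg_nonneg)
next
  case False
  let ?D = "\<lambda>r. X r - Y r"
  have Dc: "continuous_on {0..s} ?D"
    using s by (intro continuous_intros continuous_on_subset[OF D(1)] continuous_on_subset[OF D(2)]) auto
  have D0: "?D 0 = 0" using eq[of 0] s by simp
  obtain u where u: "0 \<le> u" "u < s" "?D u = 0" "\<And>r. u < r \<Longrightarrow> r \<le> s \<Longrightarrow> 0 < ?D r"
    using last_crossing[OF Dc, of 0] False D0 s by auto
  have u': "0 < ?D r \<or> ?D r = 0" if "r \<in> {u..s}" for r
    using that u(3) u(4)[of r] by (cases "r = u") auto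
  let ?f = "\<lambda>r. b (X r) - b (Y r)"
  have f_int: "?f integrable_on {c..d}" if "0 \<le> c" "d \<le> t" for c d
    using that by (intro integrable_continuous_real continuous_intros drift_cont_compose
        continuous_on_subset[OF D(1)] continuous_on_subset[OF D(2)]) auto
  have absD_int: "(\<lambda>r. \<bar>?D r\<bar>) integrable_on {c..d}" if "0 \<le> c" "d \<le> t" for c d
    using that by (intro integrable_continuous_real continuous_intros
        continuous_on_subset[OF D(1)] continuous_on_subset[OF D(2)]) auto
  have p_abs: "p absolutely_integrable_on {c..d}" if "0 \<le> c" "d \<le> t" for c d
    using that by (intro absolutely_integrable_on_subinterval[OF p]) auto
  have p_int: "p integrable_on {c..d}" "(\<lambda>r. \<bar>p r\<bar>) integrable_on {c..d}" if "0 \<le> c" "d \<le> t" for c d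
    using p_abs[OF that] by (auto simp: absolutely_integrable_on_def)
  have "?D s = ?D s - ?D u" using u by simp
  also have "\<dots> = integral {u..s} ?f + integral {u..s} p"
    using Henstock_Kurzweil_Integration.integral_combine[of 0 u s ?f]
      Henstock_Kurzweil_Integration.integral_combine[of 0 u s p] f_int[of 0 s] p_int(1)[of 0 s] u s eq[of u] eq[of s]
    by simp
  also have "\<dots> \<le> integral {u..s} (\<lambda>r. \<theta> * \<bar>?D r\<bar>) + integral {u..s} (\<lambda>r. \<bar>p r\<bar>)"
  proof (intro add_mono integral_le)
    show "(\<lambda>r. \<theta> * \<bar>?D r\<bar>) integrable_on {u..s}"
      using integrable_on_cmult_left[OF absD_int[of u s], of \<theta>] u s by auto
    fix r assume "r \<in> {u..s}"
    then show "?f r \<le> \<theta> * \<bar>?D r\<bar>" using u'[of r] one_sided_lipschitz[of "Y r" "X r"] by auto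
  qed (use u s f_int p_int in auto)
  also have "\<dots> \<le> \<theta> * integral {0..s} (\<lambda>r. \<bar>?D r\<bar>) + integral {0..t} (\<lambda>r. \<bar>p r\<bar>)"
    unfolding integral_mult_right
    using u s absD_int p_int theta_nonneg
    by (intro add_mono mult_left_mono integral_subset_le) auto
  finally show ?thesis by simp
qed

lemma comparison:
  assumes D: "continuous_on {0..t} X" "continuous_on {0..t} Y"
    and p: "p absolutely_integrable_on {0..t}" and t: "0 \<le> t"
    and eq: "\<And>r. r \<in> {0..t} \<Longrightarrow> X r - Y r = integral {0..r} (\<lambda>s. b (X s) - b (Y s)) + integral {0..r} p"
  shows "\<bar>X t - Y t\<bar> \<le> integral {0..t} (\<lambda>r. \<bar>p r\<bar>) * exp (\<theta> * t)"
proof (rule gronwall[OF _ t theta_nonneg])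
  show "continuous_on {0..t} (\<lambda>t. \<bar>X t - Y t\<bar>)" by (intro continuous_intros D)
  fix s assume s: "0 \<le> s" "s \<le> t"
  have eq': "Y r - X r = integral {0..r} (\<lambda>s. b (Y s) - b (X s)) + integral {0..r} (\<lambda>s. - p s)"
    if "r \<in> {0..t}" for r
  proof -
    have "integral {0..r} (\<lambda>s. b (Y s) - b (X s)) = integral {0..r} (\<lambda>s. - (b (X s) - b (Y s)))" by simp
    then show ?thesis using eq[OF that] unfolding integral_neg by simp
  qed
  have "X s - Y s \<le> integral {0..t} (\<lambda>r. \<bar>p r\<bar>) + \<theta> * integral {0..s} (\<lambda>r. \<bar>X r - Y r\<bar>)"
    using comparison_upper[OF D p eq, of s] s by simp
  moreover have "Y s - X s \<le> integral {0..t} (\<lambda>r. \<bar>p r\<bar>) + \<theta> * integral {0..s} (\<lambda>r. \<bar>X r - Y r\<bar>)"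
  proof -
    have "(\<lambda>s. - p s) absolutely_integrable_on {0..t}"
      using p by (auto simp: absolutely_integrable_on_def intro: integrable_neg)
    from comparison_upper[OF D(2,1) this eq', of s] s show ?thesis
      by (simp add: abs_minus_commute)
  qed
  ultimately show "\<bar>X s - Y s\<bar> \<le> integral {0..t} (\<lambda>r. \<bar>p r\<bar>) + \<theta> * integral {0..s} (\<lambda>r. \<bar>X r - Y r\<bar>)"
    by linarith
qed

end

section \<open>Gaussian averages and Boltzmann weights\<close>

text \<open>
  The hypothesis on \<open>G''\<close> covers both cases that are needed: a Lipschitz \<open>G''\<close> (with \<open>\<kappa> = 0\<close>), and a
  bounded uniformly continuous \<open>G''\<close>, for which \<open>\<kappa>\<close> can be chosen arbitrarily small at the price of a
  large \<open>L\<close>.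
\<close>

lemma second_order_taylor:
  fixes G G' G'' :: "real \<Rightarrow> real"
  assumes "\<And>x. (G has_real_derivative G' x) (at x)" "\<And>x. (G' has_real_derivative G'' x) (at x)"
    and mod: "\<And>s. \<bar>G'' (y + s) - G'' y\<bar> \<le> \<kappa> + L * \<bar>s\<bar>" and L: "0 \<le> L"
  shows "\<bar>G (y + d) - (G y + G' y * d + G'' y / 2 * d\<^sup>2)\<bar> \<le> (\<kappa> * d\<^sup>2 + L * \<bar>d\<bar> ^ 3) / 2"
proof -
  define diff where "diff = (\<lambda>m::nat. if m = 0 then (\<lambda>s. G (y + s)) else if m = 1 then (\<lambda>s. G' (y + s)) else (\<lambda>s. G'' (y + s)))"
  have D: "((\<lambda>s. H (y + s)) has_real_derivative H' (y + s)) (at s)"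
    if "\<And>x. (H has_real_derivative H' x) (at x)" for H H' :: "real \<Rightarrow> real" and s
    using that[of "y + s"] DERIV_shift[of H "H' (y+s)" s y] by (simp add: add.commute)
  have "\<exists>t. \<bar>t\<bar> \<le> \<bar>d\<bar> \<and> G (y + d) = (\<Sum>m<2. diff m 0 / (fact m) * d ^ m) + diff 2 t / (fact 2) * d ^ 2"
    using assms(1,2)
    by (intro Maclaurin_bi_le) (auto simp: diff_def less_2_cases_iff intro!: D)
  then obtain t where t: "\<bar>t\<bar> \<le> \<bar>d\<bar>" "G (y + d) = G y + G' y * d + G'' (y + t) / 2 * d\<^sup>2"
    by (auto simp: diff_def eval_nat_numeral)
  have "\<bar>G (y + d) - (G y + G' y * d + G'' y / 2 * d\<^sup>2)\<bar> = \<bar>G'' (y + t) - G'' y\<bar> * (d\<^sup>2 / 2)"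
  proof -
    have "G (y + d) - (G y + G' y * d + G'' y / 2 * d\<^sup>2) = (G'' (y + t) - G'' y) * (d\<^sup>2 / 2)"
      unfolding t(2) by (simp add: algebra_simps)
    then show ?thesis by (simp only: abs_mult) simp
  qed
  also have "\<dots> \<le> (\<kappa> + L * \<bar>d\<bar>) * (d\<^sup>2 / 2)"
  proof (intro mult_right_mono)
    have "L * \<bar>t\<bar> \<le> L * \<bar>d\<bar>" using t L by (intro mult_left_mono) auto
    then show "\<bar>G'' (y + t) - G'' y\<bar> \<le> \<kappa> + L * \<bar>d\<bar>" using mod[of t] by linarith
  qed simp
  also have "\<dots> = (\<kappa> * d\<^sup>2 + L * \<bar>d\<bar> ^ 3) / 2"
    by (simp add: field_simps power2_eq_square power3_eq_cube)
  finally show ?thesis .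
qed

definition gaussian :: "real \<Rightarrow> real measure" where
  "gaussian \<sigma> = density lborel (normal_density 0 \<sigma>)"

lemma sets_gaussian [simp, measurable_cong]: "sets (gaussian \<sigma>) = sets borel"
  and space_gaussian [simp]: "space (gaussian \<sigma>) = UNIV"
  by (simp_all add: gaussian_def)

lemma prob_space_gaussian: "0 < \<sigma> \<Longrightarrow> prob_space (gaussian \<sigma>)"
  unfolding gaussian_def by (rule prob_space_normal_density)

lemma gaussian_moments:
  assumes \<sigma>: "0 < \<sigma>"
  shows "integrable (gaussian \<sigma>) (\<lambda>x. x)" "(\<integral>x. x \<partial>gaussian \<sigma>) = 0"
    and "integrable (gaussian \<sigma>) (\<lambda>x. x\<^sup>2)" "(\<integral>x. x\<^sup>2 \<partial>gaussian \<sigma>) = \<sigma>\<^sup>2"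
    and "integrable (gaussian \<sigma>) (\<lambda>x. \<bar>x\<bar> ^ 3)" "(\<integral>x. \<bar>x\<bar> ^ 3 \<partial>gaussian \<sigma>) \<le> 2 * \<sigma> ^ 3"
proof -
  have tr: "integrable (gaussian \<sigma>) f \<and> (\<integral>x. f x \<partial>gaussian \<sigma>) = c"
    if "has_bochner_integral lborel (\<lambda>x. normal_density 0 \<sigma> x * f x) c" "f \<in> borel_measurable borel"
    for f :: "real \<Rightarrow> real" and c
    using that unfolding gaussian_def
    by (auto simp: has_bochner_integral_iff integrable_real_density integral_real_density)
  from tr[of "\<lambda>x. x" 0] normal_moment_odd[OF \<sigma>, of 0 0]
  show "integrable (gaussian \<sigma>) (\<lambda>x. x)" "(\<integral>x. x \<partial>gaussian \<sigma>) = 0" by auto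
  have "fact (2 * 1) / ((2 / \<sigma>\<^sup>2)^1 * fact 1) = \<sigma>\<^sup>2" by (simp add: fact_2)
  with tr[of "\<lambda>x. x\<^sup>2" "\<sigma>\<^sup>2"] normal_moment_even[OF \<sigma>, of 0 1]
  show "integrable (gaussian \<sigma>) (\<lambda>x. x\<^sup>2)" "(\<integral>x. x\<^sup>2 \<partial>gaussian \<sigma>) = \<sigma>\<^sup>2" by auto
  have m3: "integrable (gaussian \<sigma>) (\<lambda>x. \<bar>x\<bar> ^ 3)" "(\<integral>x. \<bar>x\<bar> ^ 3 \<partial>gaussian \<sigma>) = 2 * \<sigma> ^ 3 * sqrt (2 / pi)"
    using tr[of "\<lambda>x. \<bar>x\<bar> ^ 3" "2 * \<sigma> ^ 3 * sqrt (2 / pi)"] normal_moment_abs_odd[OF \<sigma>, of 0 1]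
    by (auto simp: eval_nat_numeral)
  have "sqrt (2 / pi) \<le> 1" using pi_gt3 by simp
  then have "2 * \<sigma> ^ 3 * sqrt (2 / pi) \<le> 2 * \<sigma> ^ 3 * 1" using \<sigma> by (intro mult_left_mono) auto
  then show "integrable (gaussian \<sigma>) (\<lambda>x. \<bar>x\<bar> ^ 3)" "(\<integral>x. \<bar>x\<bar> ^ 3 \<partial>gaussian \<sigma>) \<le> 2 * \<sigma> ^ 3"
    using m3 by auto
qed

text \<open>
  The first moment vanishes and the second is \<open>\<sigma>\<^sup>2\<close>, so averaging adds \<open>c\<^sup>2 \<sigma>\<^sup>2 / 2 G''\<close> up to the remainder
  of the Taylor expansion.
\<close>

lemma gaussian_average_expansion:
  fixes G G' G'' :: "real \<Rightarrow> real"
  assumes d1: "\<And>x. (G has_real_derivative G' x) (at x)" and d2: "\<And>x. (G' has_real_derivative G'' x) (at x)"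
    and mod: "\<And>x s. \<bar>G'' (x + s) - G'' x\<bar> \<le> \<kappa> + L * \<bar>s\<bar>" and L: "0 \<le> L"
    and bdd: "\<And>x. \<bar>G x\<bar> \<le> K" and \<sigma>: "0 < \<sigma>"
  shows "\<bar>(\<integral>x. G (y + c * x) \<partial>gaussian \<sigma>) - (G y + c\<^sup>2 * \<sigma>\<^sup>2 / 2 * G'' y)\<bar>
    \<le> \<kappa> * c\<^sup>2 * \<sigma>\<^sup>2 + L * \<bar>c\<bar> ^ 3 * \<sigma> ^ 3"
proof -
  interpret N: prob_space "gaussian \<sigma>" by (rule prob_space_gaussian[OF \<sigma>])
  note m = gaussian_moments[OF \<sigma>]
  have G_cont: "continuous_on UNIV G" using d1 by (meson DERIV_continuous continuous_at_imp_continuous_on)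
  then have [measurable]: "G \<in> borel_measurable borel" by (rule borel_measurable_continuous_onI)
  have int: "integrable (gaussian \<sigma>) (\<lambda>x. G (y + c * x))"
    by (rule N.integrable_const_bound[of _ K]) (auto simp: bdd)
  have \<kappa>: "0 \<le> \<kappa>" using mod[of 0 0] by simp
  let ?P = "\<lambda>x. G y + G' y * (c * x) + G'' y / 2 * (c * x)\<^sup>2"
  have P: "integrable (gaussian \<sigma>) ?P" "(\<integral>x. ?P x \<partial>gaussian \<sigma>) = G y + c\<^sup>2 * \<sigma>\<^sup>2 / 2 * G'' y"
    using m by (simp_all add: power_mult_distrib N.prob_space[simplified])
  let ?E = "\<lambda>x. (\<kappa> * (c * x)\<^sup>2 + L * \<bar>c * x\<bar> ^ 3) / 2"
  have E: "integrable (gaussian \<sigma>) ?E"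
    "(\<integral>x. ?E x \<partial>gaussian \<sigma>) = (\<kappa> * c\<^sup>2 * \<sigma>\<^sup>2 + L * \<bar>c\<bar> ^ 3 * (\<integral>x. \<bar>x\<bar> ^ 3 \<partial>gaussian \<sigma>)) / 2"
    using m by (simp_all add: power_mult_distrib abs_mult)
  have "\<bar>(\<integral>x. G (y + c * x) \<partial>gaussian \<sigma>) - (\<integral>x. ?P x \<partial>gaussian \<sigma>)\<bar>
      = \<bar>\<integral>x. G (y + c * x) - ?P x \<partial>gaussian \<sigma>\<bar>"
    using int P(1) by (subst Bochner_Integration.integral_diff) auto
  also have "\<dots> \<le> (\<integral>x. \<bar>G (y + c * x) - ?P x\<bar> \<partial>gaussian \<sigma>)" by (rule integral_abs_bound)
  also have "\<dots> \<le> (\<integral>x. ?E x \<partial>gaussian \<sigma>)"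
    using second_order_taylor[OF d1 d2 mod L]
    by (intro integral_mono E Bochner_Integration.integrable_diff integrable_abs int P) auto
  also have "\<dots> \<le> \<kappa> * c\<^sup>2 * \<sigma>\<^sup>2 + L * \<bar>c\<bar> ^ 3 * \<sigma> ^ 3"
  proof -
    have "L * \<bar>c\<bar> ^ 3 * (\<integral>x. \<bar>x\<bar> ^ 3 \<partial>gaussian \<sigma>) \<le> L * \<bar>c\<bar> ^ 3 * (2 * \<sigma> ^ 3)"
      using m(6) L by (intro mult_left_mono) auto
    moreover have "0 \<le> \<kappa> * c\<^sup>2 * \<sigma>\<^sup>2" using \<kappa> by simp
    ultimately show ?thesis unfolding E(2) by (simp add: field_simps)
  qed
  finally show ?thesis unfolding P(2) .
qed


text \<open>
  Use \<open>1 + \<bar>x\<bar> \<le> exp \<bar>x\<bar>\<close> and complete the square in \<open>j \<bar>x\<bar> - 2 x\<^sup>2 / \<epsilon>\<close>.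
\<close>

lemma polynomial_times_boltzmann_bounded:
  fixes W :: "real \<Rightarrow> real"
  assumes W: "\<And>x. x\<^sup>2 - K \<le> W x" and \<epsilon>: "0 < \<epsilon>"
  shows "(1 + \<bar>x\<bar>) ^ j * exp (- 2 * W x / \<epsilon>) \<le> exp (\<epsilon> * (real j)\<^sup>2 / 8 + 2 * K / \<epsilon>)"
proof -
  have "(1 + \<bar>x\<bar>) ^ j \<le> exp \<bar>x\<bar> ^ j" by (intro power_mono exp_ge_add_one_self) auto
  also have "\<dots> = exp (real j * \<bar>x\<bar>)" by (rule exp_of_nat_mult[symmetric])
  finally have "(1 + \<bar>x\<bar>) ^ j * exp (- 2 * W x / \<epsilon>) \<le> exp (real j * \<bar>x\<bar>) * exp (- 2 * W x / \<epsilon>)"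
    by (intro mult_right_mono) auto
  also have "\<dots> = exp (real j * \<bar>x\<bar> - 2 * W x / \<epsilon>)" by (simp flip: exp_add)
  also have "\<dots> \<le> exp (\<epsilon> * (real j)\<^sup>2 / 8 + 2 * K / \<epsilon>)"
  proof -
    have "0 \<le> 2 / \<epsilon> * (\<bar>x\<bar> - \<epsilon> * real j / 4)\<^sup>2" using \<epsilon> by simp
    also have "\<dots> = 2 * x\<^sup>2 / \<epsilon> - real j * \<bar>x\<bar> + \<epsilon> * (real j)\<^sup>2 / 8"
      using \<epsilon> by (simp add: power2_diff field_simps) (simp add: power2_eq_square algebra_simps)
    finally have "real j * \<bar>x\<bar> \<le> 2 * x\<^sup>2 / \<epsilon> + \<epsilon> * (real j)\<^sup>2 / 8" by simp
    moreover have "2 * (x\<^sup>2 - K) / \<epsilon> \<le> 2 * W x / \<epsilon>"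
      using W[of x] \<epsilon> by (intro divide_right_mono mult_left_mono) auto
    ultimately show ?thesis by (simp add: diff_divide_distrib)
  qed
  finally show ?thesis .
qed

lemma polynomial_times_boltzmann_integrable:
  fixes W p :: "real \<Rightarrow> real"
  assumes W: "\<And>x. x\<^sup>2 - K \<le> W x" and \<epsilon>: "0 < \<epsilon>"
    and p: "\<And>x. \<bar>p x\<bar> \<le> C * (1 + \<bar>x\<bar>) ^ j"
    and [measurable]: "p \<in> borel_measurable borel" "W \<in> borel_measurable borel"
  shows "integrable lborel (\<lambda>x. p x * exp (- 2 * W x / \<epsilon>))"
proof (rule Bochner_Integration.integrable_bound)
  define A where "A = exp (\<epsilon> * (real (j + 2))\<^sup>2 / 8 + 2 * K / \<epsilon>)"
  have "set_integrable lborel (einterval (-\<infinity>) \<infinity>) (\<lambda>x::real. inverse (1 + x\<^sup>2))"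
    by (rule integrable_inverse_1_plus_square)
  then have "integrable lborel (\<lambda>x::real. inverse (1 + x\<^sup>2))"
    by (simp add: set_integrable_def einterval_def)
  then show "integrable lborel (\<lambda>x::real. C * A * inverse (1 + x\<^sup>2))" by simp
  have C: "0 \<le> C" using order_trans[OF abs_ge_zero p[of 0]] by simp
  show "AE x in lborel. norm (p x * exp (- 2 * W x / \<epsilon>)) \<le> norm (C * A * inverse (1 + x\<^sup>2))"
  proof (rule AE_I2)
    fix x :: real
    have pos: "1 + x\<^sup>2 > 0" by (simp add: add_pos_nonneg)
    have "(1 + x\<^sup>2) * ((1 + \<bar>x\<bar>) ^ j * exp (- 2 * W x / \<epsilon>)) \<le> (1 + \<bar>x\<bar>)\<^sup>2 * ((1 + \<bar>x\<bar>) ^ j * exp (- 2 * W x / \<epsilon>))"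
      by (intro mult_right_mono) (auto simp: power2_eq_square algebra_simps)
    also have "\<dots> = (1 + \<bar>x\<bar>) ^ (j + 2) * exp (- 2 * W x / \<epsilon>)"
      by (simp add: power_add power2_eq_square mult_ac)
    also have "\<dots> \<le> A" unfolding A_def by (rule polynomial_times_boltzmann_bounded[OF W \<epsilon>])
    finally have *: "(1 + \<bar>x\<bar>) ^ j * exp (- 2 * W x / \<epsilon>) \<le> A * inverse (1 + x\<^sup>2)"
      using pos by (simp add: field_simps)
    have "\<bar>p x * exp (- 2 * W x / \<epsilon>)\<bar> \<le> C * (1 + \<bar>x\<bar>) ^ j * exp (- 2 * W x / \<epsilon>)"
      unfolding abs_mult using p[of x] by (intro mult_mono) auto
    also have "\<dots> \<le> C * (A * inverse (1 + x\<^sup>2))"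
      using * C by (simp add: mult.assoc mult_left_mono)
    finally show "norm (p x * exp (- 2 * W x / \<epsilon>)) \<le> norm (C * A * inverse (1 + x\<^sup>2))"
      by (simp add: mult.assoc)
  qed
qed measurable

lemma AE_lborel_False: "\<not> (AE x in (lborel :: real measure). False)"
  by (simp add: eventually_False ae_filter_eq_bot_iff)

text \<open>
  The fundamental theorem of calculus for integrals over an unbounded half-line.
\<close>

lemma integral_atMost_deriv:
  fixes g :: "real \<Rightarrow> real"
  assumes g: "continuous_on UNIV g" and int: "integrable lborel g"
  shows "((\<lambda>x. LINT y:{..x}|lborel. g y) has_real_derivative g z) (at z)"
proof -
  let ?G = "\<lambda>x. LINT y:{..x}|lborel. g y"
  have set_int: "set_integrable lborel A g" if "A \<in> sets borel" for A
    using integrable_mult_indicator[OF _ int, of A] that by (simp add: set_integrable_def)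
  have incr: "?G y = ?G (z - 1) + integral {z - 1..y} g" if "z - 1 < y" for y
  proof -
    have "{..y} = {..z - 1} \<union> {z - 1<..y}" using that by auto
    then have "?G y = ?G (z - 1) + (LINT x:{z - 1<..y}|lborel. g x)"
      by (simp only:) (rule set_integral_Un, auto intro: set_int)
    also have "(LINT x:{z - 1<..y}|lborel. g x) = (LINT x:{z - 1..y}|lborel. g x)"
      unfolding set_lebesgue_integral_def
    proof (rule integral_cong_AE)
      have [measurable]: "g \<in> borel_measurable borel" by (rule borel_measurable_continuous_onI[OF g])
      show "(\<lambda>x. indicator {z - 1<..y} x *\<^sub>R g x) \<in> borel_measurable lborel" by measurable
      show "(\<lambda>x. indicator {z - 1..y} x *\<^sub>R g x) \<in> borel_measurable lborel" by measurable
      have "AE x in lborel. x \<noteq> z - 1" by (rule AE_lborel_singleton)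
      then show "AE x in lborel. indicator {z - 1<..y} x *\<^sub>R g x = indicator {z - 1..y} x *\<^sub>R g x"
        by eventually_elim (auto simp: indicator_def)
    qed
    also have "\<dots> = integral {z - 1..y} g"
      by (rule set_borel_integral_eq_integral) (auto intro: set_int)
    finally show ?thesis .
  qed
  have "((\<lambda>y. integral {z - 1..y} g) has_real_derivative g z) (at z within {z - 1..z + 1})"
    by (rule integral_has_real_derivative) (auto intro: continuous_on_subset[OF g])
  then have "((\<lambda>y. integral {z - 1..y} g) has_real_derivative g z) (at z)"
    by (simp add: at_within_Icc_at)
  then have "((\<lambda>y. ?G (z - 1) + integral {z - 1..y} g) has_real_derivative g z) (at z)"
    by (auto intro!: derivative_eq_intros)
  then show ?thesis
    by (rule has_field_derivative_transform_within[where d=1])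
       (auto simp: incr[symmetric] dist_real_def abs_if split: if_splits)
qed

section \<open>The Gibbs law is almost invariant under one step of the scheme\<close>

text \<open>
  The drift is minus the gradient of an energy \<open>W\<close> that grows at least quadratically.  Polynomial growth of the
  drift and its derivative ensures that the Gibbs density dominates every term of the expansions below.
\<close>

locale gibbs_drift = dissipative_drift +
  fixes W :: "real \<Rightarrow> real" and \<epsilon> K C :: real and j :: nat
  assumes potential_deriv: "\<And>x. (W has_real_derivative - b x) (at x)"
    and noise_pos: "0 < \<epsilon>"
    and potential_coercive: "\<And>x. x\<^sup>2 - K \<le> W x"
    and drift_growth: "\<And>x. \<bar>b x\<bar> \<le> C * (1 + \<bar>x\<bar>) ^ j"
    and drift_deriv_growth: "\<And>x. \<bar>b' x\<bar> \<le> C * (1 + \<bar>x\<bar>) ^ j"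
begin

definition weight :: "real \<Rightarrow> real" where
  "weight x = exp (- 2 * W x / \<epsilon>)"

definition mass :: real where
  "mass = (\<integral>x. weight x \<partial>lborel)"

definition gibbs_density :: "real \<Rightarrow> real" where
  "gibbs_density x = weight x / mass"

definition gibbs :: "real measure" where
  "gibbs = density lborel (\<lambda>x. ennreal (gibbs_density x))"

lemma potential_cont: "continuous_on S W"
  using potential_deriv by (meson DERIV_continuous continuous_at_imp_continuous_on)

lemma potential_measurable [measurable]: "W \<in> borel_measurable borel"
  by (rule borel_measurable_continuous_onI[OF potential_cont])

lemma weight_pos: "0 < weight x"
  by (simp add: weight_def)

lemma weight_measurable [measurable]: "weight \<in> borel_measurable borel"
  unfolding weight_def by measurable

lemma weight_integrable_poly:
  assumes "\<And>x. \<bar>p x\<bar> \<le> A * (1 + \<bar>x\<bar>) ^ i" "p \<in> borel_measurable borel"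
  shows "integrable lborel (\<lambda>x. p x * weight x)"
  unfolding weight_def
  by (rule polynomial_times_boltzmann_integrable[OF potential_coercive noise_pos assms]) measurable

lemma weight_integrable: "integrable lborel weight"
  using weight_integrable_poly[of "\<lambda>_. 1" 1 0] by simp

lemma mass_pos: "0 < mass"
proof -
  have "mass \<noteq> 0"
  proof
    assume "mass = 0"
    then have "AE x in lborel. weight x = 0"
      unfolding mass_def using weight_pos
      by (subst (asm) integral_nonneg_eq_0_iff_AE[OF weight_integrable]) (auto simp: less_imp_le)
    then have "AE x in (lborel :: real measure). False"
      by eventually_elim (metis weight_pos less_irrefl)
    then show False using AE_lborel_False by simp
  qed
  moreover have "0 \<le> mass" unfolding mass_def
    using weight_pos by (intro integral_nonneg_AE) (auto simp: less_imp_le)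
  ultimately show ?thesis by simp
qed

lemma gibbs_density_measurable [measurable]: "gibbs_density \<in> borel_measurable borel"
  unfolding gibbs_density_def by measurable

lemma gibbs_density_pos: "0 < gibbs_density x"
  using weight_pos mass_pos by (simp add: gibbs_density_def)

lemma gibbs_density_integrable: "integrable lborel gibbs_density"
  unfolding gibbs_density_def using weight_integrable by simp

lemma integral_gibbs_density: "(\<integral>x. gibbs_density x \<partial>lborel) = 1"
  unfolding gibbs_density_def using mass_pos by (simp add: mass_def)

lemma sets_gibbs [simp, measurable_cong]: "sets gibbs = sets borel"
  and space_gibbs [simp]: "space gibbs = UNIV"
  by (simp_all add: gibbs_def)

lemma prob_space_gibbs: "prob_space gibbs"
proof (rule prob_spaceI)
  have "emeasure gibbs (space gibbs) = (\<integral>\<^sup>+x. ennreal (gibbs_density x) \<partial>lborel)"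
    unfolding gibbs_def by (subst emeasure_density) auto
  also have "\<dots> = ennreal (\<integral>x. gibbs_density x \<partial>lborel)"
    using gibbs_density_pos by (intro nn_integral_eq_integral gibbs_density_integrable) (auto simp: less_imp_le)
  finally show "emeasure gibbs (space gibbs) = 1" by (simp add: integral_gibbs_density)
qed

lemma gibbs_integral:
  assumes [measurable]: "f \<in> borel_measurable borel"
  shows "integrable gibbs f \<longleftrightarrow> integrable lborel (\<lambda>x. f x * weight x)"
    and "(\<integral>x. f x \<partial>gibbs) = (\<integral>x. f x * weight x \<partial>lborel) / mass"
proof -
  have eq: "gibbs_density x * f x = (1 / mass) * (f x * weight x)" for x
    by (simp add: gibbs_density_def)
  have "integrable gibbs f \<longleftrightarrow> integrable lborel (\<lambda>x. gibbs_density x * f x)"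
    unfolding gibbs_def using gibbs_density_pos by (intro integrable_real_density) (auto simp: less_imp_le)
  then show "integrable gibbs f \<longleftrightarrow> integrable lborel (\<lambda>x. f x * weight x)"
    unfolding eq using mass_pos by (subst (asm) integrable_mult_left_iff) auto
  have "(\<integral>x. f x \<partial>gibbs) = (\<integral>x. gibbs_density x * f x \<partial>lborel)"
    unfolding gibbs_def using gibbs_density_pos by (intro integral_real_density) (auto simp: less_imp_le)
  then show "(\<integral>x. f x \<partial>gibbs) = (\<integral>x. f x * weight x \<partial>lborel) / mass"
    unfolding eq by simp
qed

lemma weight_deriv: "(weight has_real_derivative 2 / \<epsilon> * b x * weight x) (at x)"
  unfolding weight_def
  using noise_pos by (auto intro!: derivative_eq_intros potential_deriv simp: field_simps)

text \<open>
  This is the equation \<open>\<epsilon> / 2 p' = b p\<close>, which says that the stationary probability current vanishes.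
\<close>

lemma gibbs_density_deriv: "(gibbs_density has_real_derivative 2 / \<epsilon> * b x * gibbs_density x) (at x)"
  unfolding gibbs_density_def
  using mass_pos by (auto intro!: derivative_eq_intros weight_deriv)

lemma gibbs_density_deriv2:
  "((\<lambda>x. 2 / \<epsilon> * b x * gibbs_density x) has_real_derivative
     2 / \<epsilon> * (b' x + 2 / \<epsilon> * (b x)\<^sup>2) * gibbs_density x) (at x)"
  using noise_pos
  by (auto intro!: derivative_eq_intros gibbs_density_deriv drift_deriv simp: field_simps power2_eq_square)

lemma gibbs_density_cont: "continuous_on S gibbs_density"
  using gibbs_density_deriv by (meson DERIV_continuous continuous_at_imp_continuous_on)

lemma cdf_gibbs_deriv: "(cdf gibbs has_real_derivative gibbs_density z) (at z)"
proof -
  have "cdf gibbs y = (LINT x:{..y}|lborel. gibbs_density x)" for y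
  proof -
    have "cdf gibbs y = (\<integral>x. indicator {..y} x \<partial>gibbs)" by (simp add: cdf_def)
    also have "\<dots> = (\<integral>x. gibbs_density x * indicator {..y} x \<partial>lborel)"
      unfolding gibbs_def using gibbs_density_pos by (subst integral_real_density) (auto simp: less_imp_le)
    finally show ?thesis by (simp add: set_lebesgue_integral_def mult.commute)
  qed
  then have "cdf gibbs = (\<lambda>y. LINT x:{..y}|lborel. gibbs_density x)" by (rule ext)
  then show ?thesis
    using integral_atMost_deriv[OF gibbs_density_cont gibbs_density_integrable] by simp
qed

lemma poly_times_density_bounded: "\<exists>B>0. \<forall>x. (1 + \<bar>x\<bar>) ^ i * gibbs_density x \<le> B"
proof (intro exI[of _ "exp (\<epsilon> * (real i)\<^sup>2 / 8 + 2 * K / \<epsilon>) / mass"] conjI allI)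
  show "(1 + \<bar>x\<bar>) ^ i * gibbs_density x \<le> exp (\<epsilon> * (real i)\<^sup>2 / 8 + 2 * K / \<epsilon>) / mass" for x
    using polynomial_times_boltzmann_bounded[OF potential_coercive noise_pos, of x i] mass_pos
    by (simp add: gibbs_density_def weight_def divide_right_mono)
qed (use mass_pos in simp)

lemma growth_const_nonneg: "0 \<le> C"
  using order_trans[OF abs_ge_zero drift_growth[of 0]] by simp

text \<open>
  The implicit step moves the argument of the density from \<open>z\<close> to \<open>z - h b z\<close>, and \<open>b z\<close> has to be controlled
  by the density at an intermediate point \<open>\<zeta>\<close>.  Outside of \<open>[- R, R]\<close> the drift points inwards, so
  \<open>z - h b z\<close> lies further out and \<open>\<bar>z\<bar> \<le> \<bar>\<zeta>\<bar>\<close>; inside, \<open>b z\<close> is bounded by a constant.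
\<close>

lemma drift_le_outward:
  assumes "0 \<le> h" "\<zeta> \<in> closed_segment z (z - h * b z)"
  shows "\<bar>b z\<bar> \<le> C * (1 + R) ^ j * (1 + \<bar>\<zeta>\<bar>) ^ j"
proof (cases "\<bar>z\<bar> \<le> R")
  case True
  have "\<bar>b z\<bar> \<le> C * (1 + \<bar>z\<bar>) ^ j" by (rule drift_growth)
  also have "\<dots> \<le> C * (1 + R) ^ j" using True growth_const_nonneg by (intro mult_left_mono power_mono) auto
  also have "\<dots> \<le> C * (1 + R) ^ j * (1 + \<bar>\<zeta>\<bar>) ^ j"
    using mult_left_mono[of 1 "(1 + \<bar>\<zeta>\<bar>) ^ j" "C * (1 + R) ^ j"] growth_const_nonneg radius_nonneg
    by simp
  finally show ?thesis .
next
  case False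
  have "\<bar>z\<bar> \<le> \<bar>\<zeta>\<bar>"
  proof (cases "R < z")
    case True
    then have "h * b z \<le> 0" using inward_right[of z] assms(1) by (intro mult_nonneg_nonpos) auto
    then show ?thesis using assms(2) True radius_nonneg by (auto simp: closed_segment_eq_real_ivl split: if_splits)
  next
    case False
    with \<open>\<not> \<bar>z\<bar> \<le> R\<close> have "z < - R" by auto
    then have "0 \<le> h * b z" using inward_left[of z] assms(1) by (intro mult_nonneg_nonneg) auto
    then show ?thesis using assms(2) \<open>z < - R\<close> radius_nonneg by (auto simp: closed_segment_eq_real_ivl split: if_splits)
  qed
  have "\<bar>b z\<bar> \<le> C * (1 + \<bar>z\<bar>) ^ j" by (rule drift_growth)
  also have "\<dots> \<le> C * (1 + \<bar>\<zeta>\<bar>) ^ j"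
    using \<open>\<bar>z\<bar> \<le> \<bar>\<zeta>\<bar>\<close> growth_const_nonneg by (intro mult_left_mono power_mono) auto
  also have "\<dots> \<le> C * (1 + \<bar>\<zeta>\<bar>) ^ j * (1 + R) ^ j"
    using mult_left_mono[of 1 "(1 + R) ^ j" "C * (1 + \<bar>\<zeta>\<bar>) ^ j"] growth_const_nonneg radius_nonneg
    by simp
  finally show ?thesis by (simp add: mult_ac)
qed

text \<open>
  Let \<open>F\<close> be the Gibbs distribution function, \<open>p = F'\<close> and \<open>y = z - h b z\<close>.  The Gaussian average is
  \<open>F y + \<epsilon> h / 2 p' y\<close> up to order \<open>h sqrt h\<close>, because \<open>p''\<close> is bounded.  Moreover
  \<open>F y = F z - h b z p z\<close> and \<open>\<epsilon> h / 2 p' y = \<epsilon> h / 2 p' z = h b z p z\<close> up to order \<open>h\<^sup>2\<close>, so the terms of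
  order \<open>h\<close> cancel.  All estimates are uniform in \<open>z\<close>, since \<open>b z\<close> occurs only in products with a
  derivative of \<open>p\<close> at a point \<open>\<zeta>\<close> as in the preceding lemma, and \<open>p\<close> absorbs every power.
\<close>

lemma gibbs_almost_invariant:
  "\<exists>A\<ge>0. \<forall>h z. 0 < h \<and> h \<le> 1 \<longrightarrow>
    \<bar>(\<integral>x. cdf gibbs (z - h * b z - sqrt \<epsilon> * x) \<partial>gaussian (sqrt h)) - cdf gibbs z\<bar> \<le> A * (h * sqrt h)"
proof -
  interpret prob_space gibbs by (rule prob_space_gibbs)
  interpret real_distribution gibbs by unfold_locales simp_all
  define p where "p = gibbs_density"
  define p1 where "p1 = (\<lambda>x. 2 / \<epsilon> * b x * p x)"
  define p2 where "p2 = (\<lambda>x. 2 / \<epsilon> * (b' x + 2 / \<epsilon> * (b x)\<^sup>2) * p x)"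
  define F where "F = cdf gibbs"
  have F1: "(F has_real_derivative p x) (at x)" for x unfolding F_def p_def by (rule cdf_gibbs_deriv)
  have F2: "(p has_real_derivative p1 x) (at x)" for x unfolding p1_def p_def by (rule gibbs_density_deriv)
  have F3: "(p1 has_real_derivative p2 x) (at x)" for x unfolding p1_def p2_def p_def by (rule gibbs_density_deriv2)
  have p_pos: "0 < p x" for x unfolding p_def by (rule gibbs_density_pos)
  define C' where "C' = C * (1 + R) ^ j"
  have C: "0 \<le> C" "0 \<le> C'" using growth_const_nonneg radius_nonneg by (auto simp: C'_def)
  have one_le: "1 \<le> (1 + \<bar>x\<bar>) ^ j" for x :: real by (intro one_le_power) auto
  obtain B where B: "0 < B" "\<And>x. (1 + \<bar>x\<bar>) ^ (3 * j) * p x \<le> B"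
    using poly_times_density_bounded[of "3 * j"] unfolding p_def by blast
  define u where "u = (\<lambda>x::real. (1 + \<bar>x\<bar>) ^ j)"
  have u1: "1 \<le> u x" for x unfolding u_def by (rule one_le)
  have uB: "u x * u x * u x * p x \<le> B" for x
  proof -
    have "u x * u x * u x = (1 + \<bar>x\<bar>) ^ (3 * j)" unfolding u_def power_add[symmetric]
      by (rule arg_cong[where f = "\<lambda>n. (1 + \<bar>x\<bar>) ^ n"]) simp
    then show ?thesis using B(2)[of x] by simp
  qed
  have bu: "\<bar>b x\<bar> \<le> C * u x" "\<bar>b' x\<bar> \<le> C * u x" for x
    using drift_growth drift_deriv_growth by (auto simp: u_def)
  define P1 where "P1 = 2 / \<epsilon> * C"
  define P2 where "P2 = 2 / \<epsilon> * (C + 2 / \<epsilon> * C\<^sup>2)"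
  have P0: "0 \<le> P1" "0 \<le> P2" using C noise_pos by (auto simp: P1_def P2_def)
  have p1u: "\<bar>p1 x\<bar> \<le> P1 * (u x * p x)" for x
  proof -
    have "\<bar>p1 x\<bar> = 2 / \<epsilon> * \<bar>b x\<bar> * p x" using noise_pos p_pos[of x] by (simp add: p1_def abs_mult)
    also have "\<dots> \<le> 2 / \<epsilon> * (C * u x) * p x"
      using bu(1)[of x] noise_pos p_pos[of x] by (intro mult_right_mono mult_left_mono) auto
    finally show ?thesis by (simp add: P1_def mult_ac)
  qed
  have p2u: "\<bar>p2 x\<bar> \<le> P2 * (u x * u x * p x)" for x
  proof -
    have "\<bar>b' x + 2 / \<epsilon> * (b x)\<^sup>2\<bar> \<le> \<bar>b' x\<bar> + 2 / \<epsilon> * (b x)\<^sup>2"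
      using noise_pos by (intro order_trans[OF abs_triangle_ineq]) (simp add: abs_mult)
    also have "\<dots> \<le> C * (u x * u x) + 2 / \<epsilon> * (C * u x)\<^sup>2"
    proof (intro add_mono mult_left_mono)
      have "C * (u x * 1) \<le> C * (u x * u x)" using u1[of x] C by (intro mult_left_mono) auto
      then show "\<bar>b' x\<bar> \<le> C * (u x * u x)" using bu(2)[of x] by simp
      show "(b x)\<^sup>2 \<le> (C * u x)\<^sup>2" using bu(1)[of x] by (metis abs_ge_zero power2_abs power_mono)
    qed (use noise_pos in auto)
    also have "\<dots> = (C + 2 / \<epsilon> * C\<^sup>2) * (u x * u x)" by (simp add: algebra_simps power2_eq_square)
    finally have *: "\<bar>b' x + 2 / \<epsilon> * (b x)\<^sup>2\<bar> \<le> (C + 2 / \<epsilon> * C\<^sup>2) * (u x * u x)" .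
    have "\<bar>p2 x\<bar> = 2 / \<epsilon> * \<bar>b' x + 2 / \<epsilon> * (b x)\<^sup>2\<bar> * p x"
      using noise_pos p_pos[of x] unfolding p2_def abs_mult by simp
    also have "\<dots> \<le> 2 / \<epsilon> * ((C + 2 / \<epsilon> * C\<^sup>2) * (u x * u x)) * p x"
      using * noise_pos p_pos[of x] by (intro mult_right_mono mult_left_mono) auto
    finally show ?thesis by (simp add: P2_def mult_ac)
  qed
  have up_mono: "u x * u x * p x \<le> B" for x
  proof -
    have "1 * (u x * u x * p x) \<le> u x * (u x * u x * p x)"
      using u1[of x] p_pos[of x] by (intro mult_right_mono) auto
    then show ?thesis using uB[of x] by (simp add: mult_ac)
  qed
  have p2B: "\<bar>p2 x\<bar> \<le> P2 * B" for x
    using p2u[of x] mult_left_mono[OF up_mono P0(2), of x] by linarith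
  define A where "A = P2 * B * \<epsilon> * sqrt \<epsilon> + (C' * C' * P1 * B + \<epsilon> / 2 * (C' * P2 * B))"
  have lip: "\<bar>p1 (x + s) - p1 x\<bar> \<le> P2 * B * \<bar>s\<bar>" for x s
  proof -
    have "norm (p1 (x + s) - p1 x) \<le> P2 * B * norm (x + s - x)"
      by (rule field_differentiable_bound[of UNIV]) (auto intro: F3 has_field_derivative_at_within p2B)
    then show ?thesis by simp
  qed
  have "\<bar>(\<integral>x. F (z - h * b z - sqrt \<epsilon> * x) \<partial>gaussian (sqrt h)) - F z\<bar> \<le> A * (h * sqrt h)"
    if h: "0 < h" "h \<le> 1" for h z
  proof -
    define y where "y = z - h * b z"
    have sq: "sqrt \<epsilon> ^ 3 = \<epsilon> * sqrt \<epsilon>" "sqrt h ^ 3 = h * sqrt h"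
      using noise_pos h by (simp_all add: power3_eq_cube)
    have "\<bar>(\<integral>x. F (y + (- sqrt \<epsilon>) * x) \<partial>gaussian (sqrt h)) - (F y + (- sqrt \<epsilon>)\<^sup>2 * (sqrt h)\<^sup>2 / 2 * p1 y)\<bar>
        \<le> 0 * (- sqrt \<epsilon>)\<^sup>2 * (sqrt h)\<^sup>2 + P2 * B * \<bar>- sqrt \<epsilon>\<bar> ^ 3 * sqrt h ^ 3"
      by (rule gaussian_average_expansion[where G'=p and K=1])
         (use F1 F2 lip P0 B h cdf_nonneg cdf_bounded_prob in \<open>auto simp: F_def abs_le_iff intro: order_trans[of _ 0]\<close>)
    then have E1: "\<bar>(\<integral>x. F (y - sqrt \<epsilon> * x) \<partial>gaussian (sqrt h)) - (F y + \<epsilon> * h / 2 * p1 y)\<bar>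
        \<le> P2 * B * \<epsilon> * sqrt \<epsilon> * (h * sqrt h)"
      using noise_pos h by (simp add: sq mult.assoc)
    have seg: "\<bar>b z\<bar> \<le> C' * u \<zeta>" if "\<zeta> \<in> closed_segment z y" for \<zeta>
      using drift_le_outward[of h \<zeta> z] h that by (simp add: C'_def u_def y_def)
    have E2: "\<bar>F y - (F z - h * b z * p z)\<bar> \<le> C' * C' * P1 * B * h\<^sup>2"
    proof -
      have "\<exists>t. \<bar>t\<bar> \<le> \<bar>y - z\<bar> \<and> t \<in> closed_segment 0 (y - z) \<and> F y = F z + p z * (y - z) + p1 (z + t) / 2 * (y - z)\<^sup>2"
      proof (cases "y = z")
        case False
        define df where "df = (\<lambda>m::nat. if m = 0 then F else if m = 1 then p else p1)"
        have "\<exists>t. (if y < z then y < t \<and> t < z else z < t \<and> t < y) \<and>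
            F y = (\<Sum>m<2. (df m z / fact m) * (y - z) ^ m) + (df 2 t / fact 2) * (y - z) ^ 2"
          by (rule Taylor[of 2 df F "min y z" "max y z"])
             (use False F1 F2 in \<open>auto simp: df_def less_2_cases_iff\<close>)
        then obtain t where t: "if y < z then y < t \<and> t < z else z < t \<and> t < y"
          "F y = (\<Sum>m<2. (df m z / fact m) * (y - z) ^ m) + (df 2 t / fact 2) * (y - z) ^ 2" by blast
        show ?thesis using t False
          by (intro exI[of _ "t - z"]) (auto simp: df_def eval_nat_numeral closed_segment_eq_real_ivl split: if_splits)
      qed auto
      then obtain t where t: "t \<in> closed_segment 0 (y - z)" "F y = F z + p z * (y - z) + p1 (z + t) / 2 * (y - z)\<^sup>2" by blast
      define \<zeta> where "\<zeta> = z + t"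
      have \<zeta>: "\<zeta> \<in> closed_segment z y"
        using t(1) unfolding \<zeta>_def by (auto simp: closed_segment_eq_real_ivl split: if_splits)
      have "\<bar>F y - (F z - h * b z * p z)\<bar> = \<bar>p1 \<zeta>\<bar> / 2 * (h\<^sup>2 * (\<bar>b z\<bar> * \<bar>b z\<bar>))"
        unfolding t(2) \<zeta>_def[symmetric] by (simp add: y_def abs_mult power2_eq_square algebra_simps)
      also have "\<dots> \<le> (P1 * (u \<zeta> * p \<zeta>)) * (h\<^sup>2 * ((C' * u \<zeta>) * (C' * u \<zeta>)))"
        using p1u[of \<zeta>] seg[OF \<zeta>] C u1[of \<zeta>] P0 p_pos[of \<zeta>]
        by (intro mult_mono) auto
      also have "\<dots> = (C' * C' * P1 * h\<^sup>2) * (u \<zeta> * u \<zeta> * u \<zeta> * p \<zeta>)" by (simp add: mult_ac)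
      also have "\<dots> \<le> (C' * C' * P1 * h\<^sup>2) * B"
        using C P0 by (intro mult_left_mono uB) auto
      finally show ?thesis by (simp add: mult_ac)
    qed
    have E3: "\<bar>p1 y - p1 z\<bar> \<le> C' * P2 * B * h"
    proof -
      have "\<exists>\<zeta>\<in>closed_segment z y. p1 y - p1 z = (y - z) * p2 \<zeta>"
      proof (cases z y rule: linorder_cases)
        case less
        then obtain t where "z < t" "t < y" "p1 y - p1 z = (y - z) * p2 t" using MVT2[of z y p1 p2] F3 by auto
        then show ?thesis by (intro bexI[of _ t]) (auto simp: closed_segment_eq_real_ivl)
      next
        case greater
        then obtain t where "y < t" "t < z" "p1 z - p1 y = (z - y) * p2 t" using MVT2[of y z p1 p2] F3 by auto
        then show ?thesis by (intro bexI[of _ t]) (auto simp: closed_segment_eq_real_ivl algebra_simps)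
      qed auto
      then obtain \<zeta> where \<zeta>: "\<zeta> \<in> closed_segment z y" "p1 y - p1 z = (y - z) * p2 \<zeta>" by blast
      have "\<bar>p1 y - p1 z\<bar> = h * \<bar>b z\<bar> * \<bar>p2 \<zeta>\<bar>" unfolding \<zeta>(2) using h by (simp add: y_def abs_mult)
      also have "\<dots> \<le> h * (C' * u \<zeta>) * (P2 * (u \<zeta> * u \<zeta> * p \<zeta>))"
        using p2u[of \<zeta>] seg[OF \<zeta>(1)] C u1[of \<zeta>] h by (intro mult_mono) auto
      also have "\<dots> = (C' * P2 * h) * (u \<zeta> * u \<zeta> * u \<zeta> * p \<zeta>)" by (simp add: mult_ac)
      also have "\<dots> \<le> (C' * P2 * h) * B" using C P0 h by (intro mult_left_mono uB) auto
      finally show ?thesis by (simp add: mult_ac)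
    qed
    have bp: "\<epsilon> * h / 2 * p1 z = h * b z * p z" using noise_pos by (simp add: p1_def)
    have E3': "\<bar>\<epsilon> * h / 2 * p1 y - h * b z * p z\<bar> \<le> \<epsilon> / 2 * (C' * P2 * B) * h\<^sup>2"
    proof -
      have "\<bar>\<epsilon> * h / 2 * p1 y - h * b z * p z\<bar> = \<epsilon> * h / 2 * \<bar>p1 y - p1 z\<bar>"
        unfolding bp[symmetric] right_diff_distrib[symmetric] abs_mult using noise_pos h by simp
      also have "\<dots> \<le> \<epsilon> * h / 2 * (C' * P2 * B * h)" using E3 noise_pos h by (intro mult_left_mono) auto
      finally show ?thesis by (simp add: power2_eq_square mult_ac)
    qed
    have hh: "h\<^sup>2 \<le> h * sqrt h"
      using h real_le_rsqrt[of h h] by (auto simp: power2_eq_square intro!: mult_left_mono mult_left_le)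
    have "C' * C' * P1 * B * h\<^sup>2 + \<epsilon> / 2 * (C' * P2 * B) * h\<^sup>2
        \<le> (C' * C' * P1 * B + \<epsilon> / 2 * (C' * P2 * B)) * (h * sqrt h)"
      unfolding distrib_right[symmetric] using hh C P0 B noise_pos
      by (intro mult_left_mono add_nonneg_nonneg) auto
    then have "\<bar>(\<integral>x. F (y - sqrt \<epsilon> * x) \<partial>gaussian (sqrt h)) - F z\<bar> \<le>
        P2 * B * \<epsilon> * sqrt \<epsilon> * (h * sqrt h) + (C' * C' * P1 * B + \<epsilon> / 2 * (C' * P2 * B)) * (h * sqrt h)"
      using E1 E2 E3' by linarith
    also have "\<dots> = A * (h * sqrt h)" by (simp add: A_def algebra_simps)
    finally show ?thesis by (simp add: y_def)
  qed
  moreover have "0 \<le> A" unfolding A_def using P0 C B noise_pos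
    by (intro add_nonneg_nonneg mult_nonneg_nonneg) auto
  ultimately show ?thesis unfolding F_def by blast
qed

end

section \<open>The scheme driven by Brownian increments\<close>

lemma (in prob_space) indep_var_expectation:
  fixes g :: "real \<Rightarrow> real \<Rightarrow> real"
  assumes ind: "indep_var borel X borel D"
    and g [measurable]: "(\<lambda>z. g (fst z) (snd z)) \<in> borel_measurable (borel \<Otimes>\<^sub>M borel)"
    and bdd: "\<And>x d. \<bar>g x d\<bar> \<le> K"
  shows "expectation (\<lambda>\<omega>. g (X \<omega>) (D \<omega>)) = expectation (\<lambda>\<omega>. \<integral>d. g (X \<omega>) d \<partial>distr M borel D)"
    and "expectation (\<lambda>\<omega>. g (X \<omega>) (D \<omega>)) = (\<integral>d. expectation (\<lambda>\<omega>. g (X \<omega>) d) \<partial>distr M borel D)"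
proof -
  have [measurable]: "X \<in> borel_measurable M" "D \<in> borel_measurable M"
    using ind by (auto dest: indep_var_rv1 indep_var_rv2)
  interpret X: prob_space "distr M borel X" by (rule prob_space_distr) measurable
  interpret D: prob_space "distr M borel D" by (rule prob_space_distr) measurable
  interpret P: pair_prob_space "distr M borel X" "distr M borel D" ..
  have int: "integrable (distr M borel X \<Otimes>\<^sub>M distr M borel D) (\<lambda>z. g (fst z) (snd z))"
    by (rule P.integrable_const_bound[of _ K]) (auto simp: bdd)
  have "expectation (\<lambda>\<omega>. g (X \<omega>) (D \<omega>))
      = (\<integral>z. g (fst z) (snd z) \<partial>distr M (borel \<Otimes>\<^sub>M borel) (\<lambda>\<omega>. (X \<omega>, D \<omega>)))"
    by (subst integral_distr) auto
  also have "distr M (borel \<Otimes>\<^sub>M borel) (\<lambda>\<omega>. (X \<omega>, D \<omega>)) = distr M borel X \<Otimes>\<^sub>M distr M borel D"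
    using ind unfolding indep_var_distribution_eq by simp
  finally have E: "expectation (\<lambda>\<omega>. g (X \<omega>) (D \<omega>))
      = (\<integral>z. g (fst z) (snd z) \<partial>(distr M borel X \<Otimes>\<^sub>M distr M borel D))" .
  also have "\<dots> = (\<integral>x. (\<integral>d. g x d \<partial>distr M borel D) \<partial>distr M borel X)"
    using P.integral_fst'[of "\<lambda>z. g (fst z) (snd z)"] int by simp
  also have "\<dots> = expectation (\<lambda>\<omega>. \<integral>d. g (X \<omega>) d \<partial>distr M borel D)"
    by (subst integral_distr) (auto intro!: D.borel_measurable_lebesgue_integral)
  finally show "expectation (\<lambda>\<omega>. g (X \<omega>) (D \<omega>)) = expectation (\<lambda>\<omega>. \<integral>d. g (X \<omega>) d \<partial>distr M borel D)" .
  have "(\<integral>z. g (fst z) (snd z) \<partial>(distr M borel X \<Otimes>\<^sub>M distr M borel D))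
      = (\<integral>d. (\<integral>x. g x d \<partial>distr M borel X) \<partial>distr M borel D)"
    using P.integral_snd[of "\<lambda>x d. g x d"] int by (simp add: case_prod_beta')
  also have "\<dots> = (\<integral>d. expectation (\<lambda>\<omega>. g (X \<omega>) d) \<partial>distr M borel D)"
  proof -
    have "(\<lambda>x. g x d) \<in> borel_measurable borel" for d
      using measurable_compose[OF measurable_Pair[OF measurable_id measurable_const] g, of d] by simp
    then have "(\<integral>x. g x d \<partial>distr M borel X) = expectation (\<lambda>\<omega>. g (X \<omega>) d)" for d
      by (intro integral_distr) auto
    then show ?thesis by simp
  qed
  finally show "expectation (\<lambda>\<omega>. g (X \<omega>) (D \<omega>)) = (\<integral>d. expectation (\<lambda>\<omega>. g (X \<omega>) d) \<partial>distr M borel D)"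
    using E by simp
qed

locale noise =  prob_space M for M :: "'w measure" +
  fixes B :: "real \<Rightarrow> 'w \<Rightarrow> real" and u :: "real measure" and X0 :: "'w \<Rightarrow> real"
  assumes brownian: "brownian_motion M B"
    and initial: "initial_value M B u X0"
begin

lemma initial_measurable [measurable]: "X0 \<in> borel_measurable M"
  using initial by (simp add: initial_value_def)

lemma distr_initial: "distr M borel X0 = u"
  using initial by (simp add: initial_value_def)

lemma brownian_measurable: "0 \<le> t \<Longrightarrow> B t \<in> borel_measurable M"
  using brownian by (simp add: brownian_motion_def)

lemma brownian_path: "AE \<omega> in M. B 0 \<omega> = 0 \<and> continuous_on {0..} (\<lambda>t. B t \<omega>)"
  using brownian by (simp add: brownian_motion_def)

lemma generated_events_subset:
  assumes "\<And>t. t \<in> T \<Longrightarrow> Y t \<in> borel_measurable M"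
  shows "generated_events M T Y \<subseteq> sets M"
  unfolding generated_events_def
  by (rule sets.sigma_sets_subset) (use assms in \<open>auto intro: measurable_sets\<close>)

lemma space_history: "space (history M B X0 t) = space M"
  by (simp add: history_def space_measure_of_conv)

lemma history_generators:
  "0 \<le> t \<Longrightarrow> generated_events M UNIV (\<lambda>_::unit. X0) \<union> generated_events M {0..t} B \<union> null_sets M \<subseteq> sets M"
  using generated_events_subset[of UNIV "\<lambda>_::unit. X0"] generated_events_subset[of "{0..t}" B]
    brownian_measurable by (auto simp: null_sets_def)

lemma sets_history:
  "0 \<le> t \<Longrightarrow> sets (history M B X0 t) = sigma_sets (space M)
      (generated_events M UNIV (\<lambda>_::unit. X0) \<union> generated_events M {0..t} B \<union> null_sets M)"
  unfolding history_def using history_generators[of t] sets.sets_into_space[of _ M]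
  by (intro sets_measure_of) blast

lemma history_subset: "0 \<le> t \<Longrightarrow> sets (history M B X0 t) \<subseteq> sets M"
  unfolding sets_history using history_generators by (intro sets.sigma_sets_subset) auto

lemma history_measurableD:
  assumes "0 \<le> t" "f \<in> borel_measurable (history M B X0 t)"
  shows "f \<in> borel_measurable M"
  using assms(2) history_subset[OF assms(1)] space_history
  by (auto simp: measurable_def)

lemma history_measurable:
  assumes "0 \<le> t"
  shows "X0 \<in> borel_measurable (history M B X0 t)"
    and "\<And>s. s \<in> {0..t} \<Longrightarrow> B s \<in> borel_measurable (history M B X0 t)"
proof -
  have gen: "Y s \<in> borel_measurable (history M B X0 t)"
    if "s \<in> T" "generated_events M T Y \<subseteq> sets (history M B X0 t)" for T :: "'t set" and Y s
  proof (rule measurableI)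
    fix A :: "real set" assume "A \<in> sets borel"
    then have "Y s -` A \<inter> space M \<in> generated_events M T Y"
      unfolding generated_events_def using that by (intro sigma_sets.Basic) auto
    then show "Y s -` A \<inter> space (history M B X0 t) \<in> sets (history M B X0 t)"
      using that by (auto simp: space_history)
  qed simp
  show "X0 \<in> borel_measurable (history M B X0 t)"
    by (rule gen[of "()" UNIV "\<lambda>_. X0"]) (auto simp: sets_history[OF assms] intro: sigma_sets.Basic)
  show "B s \<in> borel_measurable (history M B X0 t)" if "s \<in> {0..t}" for s
    by (rule gen[of s "{0..t}" B]) (use that in \<open>auto simp: sets_history[OF assms] intro: sigma_sets.Basic\<close>)
qed

text \<open>
  The initial value and the Brownian increments as one sequence.  The \<open>k\<close>-th state of the scheme depends on the
  first \<open>k + 1\<close> entries and the next increment is the entry after these, so mutual independence of the entries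
  is what makes the scheme a Markov chain.
\<close>

definition stage :: "(nat \<Rightarrow> real) \<Rightarrow> nat \<Rightarrow> 'w \<Rightarrow> real" where
  "stage \<tau> i = (case i of 0 \<Rightarrow> X0 | Suc i \<Rightarrow> (\<lambda>\<omega>. B (\<tau> (Suc i)) \<omega> - B (\<tau> i) \<omega>))"

text \<open>
  Increments are independent of each other, and the initial value is independent of the whole Brownian motion.
  Intersections of events on increments belong to the sigma-algebra of the Brownian motion, so the product formula
  for the increments extends by one further factor for the initial value.
\<close>

lemma indep_vars_stages:
  assumes \<tau>: "0 \<le> \<tau> 0" "mono \<tau>"
  shows "indep_vars (\<lambda>_. borel) (stage \<tau>) {..n}"
proof -
  have \<tau>0: "0 \<le> \<tau> i" for i using \<tau> monoD[OF \<tau>(2), of 0 i] by simp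
  let ?D = "\<lambda>i \<omega>. B (\<tau> (Suc i)) \<omega> - B (\<tau> i) \<omega>"
  have D_meas: "?D i \<in> borel_measurable M" for i
    using brownian_measurable[OF \<tau>0] by (intro borel_measurable_diff)
  have incr: "indep_vars (\<lambda>_. borel) ?D {..<n}"
    using brownian \<tau> unfolding brownian_motion_def by blast
  have set_indep: "indep_set (generated_events M UNIV (\<lambda>_::unit. X0)) (generated_events M {0..} B)"
    using initial unfolding initial_value_def by blast
  define \<B> where "\<B> = sigma (space M) {B t -` A \<inter> space M | t A. t \<in> {0..} \<and> A \<in> sets borel}"
  have sets_\<B>: "sets \<B> = generated_events M {0..} B"
    unfolding \<B>_def generated_events_def by (rule sets_measure_of) auto
  have space_\<B>: "space \<B> = space M" unfolding \<B>_def by (simp add: space_measure_of_conv)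
  have "B t \<in> borel_measurable \<B>" if "0 \<le> t" for t
  proof (rule measurableI)
    fix A :: "real set" assume "A \<in> sets borel"
    then show "B t -` A \<inter> space \<B> \<in> sets \<B>"
      unfolding space_\<B> sets_\<B> generated_events_def using that by (intro sigma_sets.Basic) auto
  qed simp
  then have D_\<B>: "?D i \<in> borel_measurable \<B>" for i using \<tau>0 by (intro borel_measurable_diff) auto
  show ?thesis
    unfolding indep_vars_def2
  proof (intro conjI ballI)
    show "random_variable borel (stage \<tau> i)" for i
      using D_meas by (cases i) (auto simp: stage_def)
    show "indep_sets (\<lambda>i. {stage \<tau> i -` A \<inter> space M |A. A \<in> sets borel}) {..n}"
    proof (rule indep_setsI)
      show "{stage \<tau> i -` A \<inter> space M |A. A \<in> sets borel} \<subseteq> events" for i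
        using D_meas by (cases i) (auto simp: stage_def intro: measurable_sets)
      fix A and J :: "nat set"
      assume J: "J \<noteq> {}" "J \<subseteq> {..n}" "finite J"
        and A: "\<forall>j\<in>J. A j \<in> {stage \<tau> j -` A \<inter> space M |A. A \<in> sets borel}"
      define J' where "J' = {i. Suc i \<in> J}"
      have finJ': "finite J'" unfolding J'_def using J(3) by (rule finite_vimageI[of _ Suc, unfolded vimage_def]) simp
      have J'n: "J' \<subseteq> {..<n}" using J(2) by (auto simp: J'_def)
      have A': "\<forall>i\<in>J'. A (Suc i) \<in> {?D i -` A \<inter> space M |A. A \<in> sets borel}"
        using A by (force simp: J'_def stage_def)
      have prod': "prob (\<Inter>i\<in>J'. A (Suc i)) = (\<Prod>i\<in>J'. prob (A (Suc i)))" if "J' \<noteq> {}"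
        using incr J'n finJ' that A' unfolding indep_vars_def2
        by (intro indep_setsD[of _ "{..<n}"]) auto
      have Suc_img: "J - {0} = Suc ` J'"
        unfolding J'_def by (auto simp: image_iff) (metis not0_implies_Suc)
      have prod'': "(\<Prod>j\<in>J - {0}. prob (A j)) = (\<Prod>i\<in>J'. prob (A (Suc i)))"
        unfolding Suc_img by (subst prod.reindex) auto
      have Int'': "(\<Inter>j\<in>J - {0}. A j) = (\<Inter>i\<in>J'. A (Suc i))" unfolding Suc_img by auto
      show "prob (\<Inter>j\<in>J. A j) = (\<Prod>j\<in>J. prob (A j))"
      proof (cases "0 \<in> J")
        case False
        then have "J - {0} = J" by auto
        moreover from this have "J' \<noteq> {}" using J(1) Suc_img by auto
        ultimately show ?thesis using prod' prod'' Int'' by simp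
      next
        case True
        have J_eq: "J = insert 0 (J - {0})" using True by auto
        have split: "(\<Prod>j\<in>J. prob (A j)) = prob (A 0) * (\<Prod>j\<in>J - {0}. prob (A j))"
          using J(3) True by (simp add: prod.remove)
        show ?thesis
        proof (cases "J' = {}")
          case True
          then have "J = {0}" using J_eq Suc_img by auto
          then show ?thesis by simp
        next
          case False
          have A0: "A 0 \<in> generated_events M UNIV (\<lambda>_::unit. X0)"
          proof -
            have "A 0 \<in> {stage \<tau> 0 -` A \<inter> space M |A. A \<in> sets borel}" using A True by blast
            then show ?thesis
              unfolding generated_events_def by (intro sigma_sets.Basic) (auto simp: stage_def)
          qed
          have "A (Suc i) \<in> sets \<B>" if "i \<in> J'" for i
            using A' that measurable_sets[OF D_\<B>[of i]] by (auto simp: space_\<B>)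
          then have "(\<Inter>i\<in>J'. A (Suc i)) \<in> sets \<B>" using finJ' False by (intro sets.finite_INT) auto
          then have "prob (A 0 \<inter> (\<Inter>i\<in>J'. A (Suc i))) = prob (A 0) * prob (\<Inter>i\<in>J'. A (Suc i))"
            using indep_setD[OF set_indep A0] by (simp add: sets_\<B>)
          moreover have "(\<Inter>j\<in>J. A j) = A 0 \<inter> (\<Inter>i\<in>J'. A (Suc i))"
            unfolding Int''[symmetric] using True by auto
          ultimately show ?thesis using prod'[OF False] split prod'' by simp
        qed
      qed
    qed
  qed
qed

end

locale driven_drift = dissipative_drift b b' \<theta> R + noise M B u X0
  for b b' :: "real \<Rightarrow> real" and \<theta> R :: real
    and M :: "'w measure" and B :: "real \<Rightarrow> 'w \<Rightarrow> real" and u X0 +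
  fixes \<epsilon> :: real
  assumes noise_scale_pos: "0 < \<epsilon>"
begin

definition chain :: "real \<Rightarrow> nat \<Rightarrow> nat \<Rightarrow> 'w \<Rightarrow> real" where
  "chain t n k \<omega> = euler (t / real n) (X0 \<omega>) (increment (\<lambda>s. sqrt \<epsilon> * B s \<omega>) t n) k"

definition noise_step :: "real \<Rightarrow> nat \<Rightarrow> nat \<Rightarrow> 'w \<Rightarrow> real" where
  "noise_step t n k \<omega> = B (grid t n (Suc k)) \<omega> - B (grid t n k) \<omega>"

lemma chain_0: "chain t n 0 \<omega> = X0 \<omega>"
  by (simp add: chain_def)

lemma chain_Suc: "chain t n (Suc k) \<omega> = step (t / real n) (chain t n k \<omega> + sqrt \<epsilon> * noise_step t n k \<omega>)"
  by (simp add: chain_def noise_step_def increment_def right_diff_distrib)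

lemma noise_step_measurable: "0 \<le> t \<Longrightarrow> noise_step t n k \<in> borel_measurable M"
  unfolding noise_step_def by (intro borel_measurable_diff brownian_measurable) auto

lemma chain_measurable: "0 \<le> t \<Longrightarrow> chain t n k \<in> borel_measurable M"
  unfolding chain_def increment_def
  by (intro euler_measurable borel_measurable_diff borel_measurable_times borel_measurable_const
      brownian_measurable initial_measurable) auto

lemma chain_measurable_history:
  "0 \<le> t \<Longrightarrow> chain t n n \<in> borel_measurable (history M B X0 t)"
  unfolding chain_def increment_def
  by (intro euler_measurable borel_measurable_diff borel_measurable_times borel_measurable_const
      history_measurable) (auto intro: grid_le)

lemma distr_noise_step:
  assumes "0 < t" "0 < n"
  shows "distr M borel (noise_step t n k) = gaussian (sqrt (t / real n))"
proof -
  have "\<forall>s\<ge>0. \<forall>t>s. distributed M lborel (\<lambda>\<omega>. B t \<omega> - B s \<omega>) (normal_density 0 (sqrt (t - s)))"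
    using brownian unfolding brownian_motion_def by blast
  moreover have "0 \<le> grid t n k" "grid t n k < grid t n (Suc k)"
    using assms by (auto simp: grid_Suc)
  ultimately have "distributed M lborel (noise_step t n k) (normal_density 0 (sqrt (grid t n (Suc k) - grid t n k)))"
    unfolding noise_step_def[abs_def] by blast
  then have "distr M lborel (noise_step t n k) = density lborel (normal_density 0 (sqrt (t / real n)))"
    by (auto simp: distributed_def grid_Suc)
  moreover have "distr M lborel (noise_step t n k) = distr M borel (noise_step t n k)"
    by (rule distr_cong) auto
  ultimately show ?thesis by (simp add: gaussian_def)
qed

lemma chain_indep_noise_step:
  assumes t: "0 \<le> t"
  shows "indep_var borel (chain t n k) borel (noise_step t n k)"
proof -
  define \<tau> where "\<tau> = grid t n"
  have "mono \<tau>" unfolding \<tau>_def by (rule monoI) (rule grid_mono[OF t])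
  then have iv: "indep_vars (\<lambda>_. borel) (stage \<tau>) {..Suc k}"
    by (intro indep_vars_stages) (auto simp: \<tau>_def)
  have "indep_var (PiM {..k} (\<lambda>_. borel)) (\<lambda>\<omega>. restrict (\<lambda>i. stage \<tau> i \<omega>) {..k})
      (PiM {Suc k} (\<lambda>_. borel)) (\<lambda>\<omega>. restrict (\<lambda>i. stage \<tau> i \<omega>) {Suc k})"
    by (rule indep_var_restrict[OF iv]) auto
  moreover define \<Phi> where "\<Phi> = (\<lambda>z. euler (t / real n) (z 0) (\<lambda>i. sqrt \<epsilon> * z (Suc i)) k)"
  moreover have "\<Phi> \<in> borel_measurable (PiM {..k} (\<lambda>_. borel :: real measure))"
    unfolding \<Phi>_def using t
    by (intro euler_measurable borel_measurable_times borel_measurable_const measurable_component_singleton) auto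
  moreover have "(\<lambda>z. z (Suc k)) \<in> borel_measurable (PiM {Suc k} (\<lambda>_. borel :: real measure))"
    by (intro measurable_component_singleton) auto
  ultimately have iv2: "indep_var borel (\<Phi> \<circ> (\<lambda>\<omega>. restrict (\<lambda>i. stage \<tau> i \<omega>) {..k}))
      borel ((\<lambda>z. z (Suc k)) \<circ> (\<lambda>\<omega>. restrict (\<lambda>i. stage \<tau> i \<omega>) {Suc k}))"
    using indep_var_compose by blast
  have euler_cong: "euler h x d l = euler h x d' l" if "\<And>i. i < l \<Longrightarrow> d i = d' i" for h x d d' l
    using that by (induction l) auto
  have "\<Phi> \<circ> (\<lambda>\<omega>. restrict (\<lambda>i. stage \<tau> i \<omega>) {..k}) = chain t n k"
  proof (rule ext)
    fix \<omega>
    have "euler (t / real n) (X0 \<omega>) (\<lambda>i. sqrt \<epsilon> * restrict (\<lambda>i. stage \<tau> i \<omega>) {..k} (Suc i)) k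
        = euler (t / real n) (X0 \<omega>) (increment (\<lambda>s. sqrt \<epsilon> * B s \<omega>) t n) k"
      by (rule euler_cong) (simp add: stage_def \<tau>_def increment_def right_diff_distrib)
    then show "(\<Phi> \<circ> (\<lambda>\<omega>. restrict (\<lambda>i. stage \<tau> i \<omega>) {..k})) \<omega> = chain t n k \<omega>"
      by (simp add: \<Phi>_def chain_def stage_def)
  qed
  moreover have "(\<lambda>z. z (Suc k)) \<circ> (\<lambda>\<omega>. restrict (\<lambda>i. stage \<tau> i \<omega>) {Suc k}) = noise_step t n k"
    by (auto simp: stage_def noise_step_def \<tau>_def fun_eq_iff)
  ultimately show ?thesis using iv2 by simp
qed

text \<open>
  By \<open>step_le_iff\<close> the event \<open>Y\<^sub>k\<^sub>+\<^sub>1 \<le> z\<close> is \<open>Y\<^sub>k + sqrt \<epsilon> \<xi> \<le> z - h b z\<close> with \<open>\<xi>\<close> Gaussian and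
  independent of \<open>Y\<^sub>k\<close>; condition on \<open>\<xi>\<close>.
\<close>

lemma chain_cdf_Suc:
  assumes t: "0 < t" "0 < n" "t / real n * \<theta> < 1"
  shows "cdf (distr M borel (chain t n (Suc k))) z =
    (\<integral>x. cdf (distr M borel (chain t n k)) (z - t / real n * b z - sqrt \<epsilon> * x) \<partial>gaussian (sqrt (t / real n)))"
proof -
  define c where "c = z - t / real n * b z"
  note [measurable] = chain_measurable[of t] noise_step_measurable[of t]
  have t0: "0 \<le> t" using t by simp
  have iff: "step (t / real n) y \<le> z \<longleftrightarrow> y \<le> c" for y
    unfolding c_def using t by (intro step_le_iff) auto
  have cdf_eq: "cdf (distr M borel Y) y = expectation (\<lambda>\<omega>. indicator {..y} (Y \<omega>))"
    if [measurable]: "Y \<in> borel_measurable M" for Y y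
  proof -
    have "cdf (distr M borel Y) y = prob (Y -` {..y} \<inter> space M)"
      by (simp add: cdf_def measure_distr)
    also have "\<dots> = expectation (indicator (Y -` {..y} \<inter> space M))" by simp
    also have "\<dots> = expectation (\<lambda>\<omega>. indicator {..y} (Y \<omega>))"
      by (intro Bochner_Integration.integral_cong) (auto simp: indicator_def)
    finally show ?thesis .
  qed
  have "cdf (distr M borel (chain t n (Suc k))) z
      = expectation (\<lambda>\<omega>. indicator {..c} (chain t n k \<omega> + sqrt \<epsilon> * noise_step t n k \<omega>))"
    unfolding cdf_eq[OF chain_measurable[OF t0]]
    by (intro Bochner_Integration.integral_cong)
       (simp_all add: indicator_def chain_Suc iff)
  also have "\<dots> = (\<integral>x. expectation (\<lambda>\<omega>. indicator {..c} (chain t n k \<omega> + sqrt \<epsilon> * x)) \<partial>distr M borel (noise_step t n k))"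
    by (rule indep_var_expectation(2)[OF chain_indep_noise_step[OF t0], where K=1]) (auto simp: indicator_def)
  also have "\<dots> = (\<integral>x. cdf (distr M borel (chain t n k)) (c - sqrt \<epsilon> * x) \<partial>gaussian (sqrt (t / real n)))"
    unfolding distr_noise_step[OF t(1,2)] cdf_eq[OF chain_measurable[OF t0]]
    by (intro Bochner_Integration.integral_cong refl) (auto simp: indicator_def algebra_simps)
  finally show ?thesis by (simp add: c_def)
qed

lemma chain_converges:
  assumes t: "0 \<le> t"
  shows "AE \<omega> in M. (\<lambda>n. chain t n n \<omega>) \<longlonglongrightarrow> flow (X0 \<omega>) (\<lambda>s. sqrt \<epsilon> * B s \<omega>) t"
  using brownian_path
proof eventually_elim
  case (elim \<omega>)
  then show ?case unfolding chain_def using t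
    by (intro flow_solves(3) continuous_intros) auto
qed

lemma flow_measurable_history:
  assumes "0 \<le> t"
  shows "(\<lambda>\<omega>. flow (X0 \<omega>) (\<lambda>s. sqrt \<epsilon> * B s \<omega>) t) \<in> borel_measurable (history M B X0 t)"
  unfolding flow_def
  using chain_measurable_history[OF assms]
  by (intro borel_measurable_lim_metric) (simp add: chain_def[abs_def])

end

section \<open>Constant laws annihilate the generator\<close>

lemma compact_support_bounded:
  fixes g :: "real \<Rightarrow> real"
  assumes g: "continuous_on UNIV g" and supp: "\<And>x. r \<le> \<bar>x\<bar> \<Longrightarrow> g x = 0"
  shows "\<exists>K\<ge>0. \<forall>x. \<bar>g x\<bar> \<le> K"
proof -
  have "compact (g ` {-r..r})"
    by (intro compact_continuous_image continuous_on_subset[OF g]) auto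
  then obtain K where K: "\<And>x. x \<in> {-r..r} \<Longrightarrow> \<bar>g x\<bar> \<le> K"
    by (meson bounded_real compact_imp_bounded image_eqI)
  have "\<bar>g x\<bar> \<le> max K 0" for x
    using K[of x] supp[of x] by (cases "x \<in> {-r..r}") auto
  then show ?thesis by (intro exI[of _ "max K 0"]) auto
qed

lemma compact_support_uniformly_continuous:
  fixes g :: "real \<Rightarrow> real"
  assumes g: "continuous_on UNIV g" and supp: "\<And>x. r \<le> \<bar>x\<bar> \<Longrightarrow> g x = 0" and \<kappa>: "0 < \<kappa>"
  shows "\<exists>d>0. \<forall>x y. \<bar>x - y\<bar> < d \<longrightarrow> \<bar>g x - g y\<bar> < \<kappa>"
proof -
  have "uniformly_continuous_on {-(\<bar>r\<bar>+1)..\<bar>r\<bar>+1} g"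
    by (intro compact_uniformly_continuous continuous_on_subset[OF g]) auto
  then obtain d where d: "d > 0" "\<And>x y. x \<in> {-(\<bar>r\<bar>+1)..\<bar>r\<bar>+1} \<Longrightarrow> y \<in> {-(\<bar>r\<bar>+1)..\<bar>r\<bar>+1} \<Longrightarrow> \<bar>x - y\<bar> < d \<Longrightarrow> \<bar>g x - g y\<bar> < \<kappa>"
    using \<kappa> unfolding uniformly_continuous_on_def dist_real_def by (metis abs_minus_commute)
  have "\<bar>g x - g y\<bar> < \<kappa>" if xy: "\<bar>x - y\<bar> < min d 1" for x y
  proof (cases "\<bar>x\<bar> \<le> \<bar>r\<bar> \<or> \<bar>y\<bar> \<le> \<bar>r\<bar>")
    case True
    then have "\<bar>x\<bar> \<le> \<bar>r\<bar> + 1" "\<bar>y\<bar> \<le> \<bar>r\<bar> + 1" using xy by auto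
    then show ?thesis using xy by (intro d) (auto simp: abs_le_iff)
  next
    case False
    then show ?thesis using supp[of x] supp[of y] \<kappa> by auto
  qed
  then show ?thesis using d(1) by (intro exI[of _ "min d 1"]) auto
qed

lemma compact_support_integrable:
  fixes g :: "real \<Rightarrow> real"
  assumes g: "continuous_on UNIV g" and supp: "\<And>x. r \<le> \<bar>x\<bar> \<Longrightarrow> g x = 0"
  shows "integrable lborel g"
proof -
  have "set_integrable lborel {-r..r} g"
    by (intro borel_integrable_atLeastAtMost' continuous_on_subset[OF g]) auto
  moreover have "(\<lambda>x. indicator {-r..r} x *\<^sub>R g x) = g"
  proof (rule ext)
    fix x
    show "indicator {-r..r} x *\<^sub>R g x = g x"
      using supp[of x] by (cases "r \<le> \<bar>x\<bar>") (auto simp: indicator_def abs_le_iff)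
  qed
  ultimately show ?thesis by (simp add: set_integrable_def)
qed

context driven_drift
begin

abbreviation X :: "real \<Rightarrow> 'w \<Rightarrow> real" where
  "X t \<omega> \<equiv> flow (X0 \<omega>) (\<lambda>s. sqrt \<epsilon> * B s \<omega>) t"

lemma X_measurable: "0 \<le> t \<Longrightarrow> X t \<in> borel_measurable M"
  by (rule history_measurableD[OF _ flow_measurable_history])

lemma expectation_chain_tendsto:
  fixes f :: "real \<Rightarrow> 'a::{banach, second_countable_topology}"
  assumes t: "0 \<le> t" and f: "continuous_on UNIV f" and bdd: "\<And>x. norm (f x) \<le> K"
  shows "(\<lambda>n. \<integral>\<omega>. f (chain t n n \<omega>) \<partial>M) \<longlonglongrightarrow> (\<integral>\<omega>. f (X t \<omega>) \<partial>M)"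
proof (rule integral_dominated_convergence[where w="\<lambda>_. K"])
  have [measurable]: "f \<in> borel_measurable borel" by (rule borel_measurable_continuous_onI[OF f])
  note [measurable] = chain_measurable[OF t] X_measurable[OF t]
  show "(\<lambda>\<omega>. f (X t \<omega>)) \<in> borel_measurable M" by measurable
  show "(\<lambda>\<omega>. f (chain t n n \<omega>)) \<in> borel_measurable M" for n by measurable
  show "AE \<omega> in M. (\<lambda>n. f (chain t n n \<omega>)) \<longlonglongrightarrow> f (X t \<omega>)"
    using chain_converges[OF t]
    by eventually_elim (rule continuous_on_tendsto_compose[OF f], auto)
qed (auto simp: bdd)

text \<open>
  Along each path the states of the scheme are uniformly close to the values of the solution at the grid times, and
  those all have law \<open>u\<close>; bounded convergence passes to expectations.  The shift \<open>i\<close> serves to evaluate the average before or after the step.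
\<close>

lemma chain_average_tendsto:
  fixes g :: "real \<Rightarrow> real"
  assumes g: "continuous_on UNIV g" and supp: "\<And>x. r \<le> \<bar>x\<bar> \<Longrightarrow> g x = 0" and i: "i \<le> 1"
    and stat: "\<And>t. 0 \<le> t \<Longrightarrow> distr M borel (X t) = u"
  shows "(\<lambda>n. (\<Sum>k<n. expectation (\<lambda>\<omega>. g (chain 1 n (k + i) \<omega>))) / real n) \<longlonglongrightarrow> (\<integral>x. g x \<partial>u)"
proof -
  obtain K where K: "\<And>x. \<bar>g x\<bar> \<le> K" "0 \<le> K" using compact_support_bounded[OF g supp] by blast
  have [measurable]: "g \<in> borel_measurable borel" by (rule borel_measurable_continuous_onI[OF g])
  define D where "D = (\<lambda>n k \<omega>. g (chain 1 n (k + i) \<omega>) - g (X (grid 1 n (k + i)) \<omega>))"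
  note [measurable] = chain_measurable[of 1, simplified]
  have Xm [measurable]: "X (grid 1 n k) \<in> borel_measurable M" for n k by (rule X_measurable) simp
  have Dm [measurable]: "D n k \<in> borel_measurable M" for n k unfolding D_def by measurable
  have Dbd: "\<bar>D n k \<omega>\<bar> \<le> 2 * K" for n k \<omega>
    unfolding D_def using K(1)[of "chain 1 n (k + i) \<omega>"] K(1)[of "X (grid 1 n (k + i)) \<omega>"] by linarith
  have conv: "AE \<omega> in M. (\<lambda>n. (\<Sum>k<n. D n k \<omega>) / real n) \<longlonglongrightarrow> 0"
    using brownian_path
  proof eventually_elim
    case (elim \<omega>)
    let ?w = "\<lambda>s. sqrt \<epsilon> * B s \<omega>"
    have w: "continuous_on {0..} ?w" "?w 0 = 0" using elim by (auto intro!: continuous_intros)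
    note fl = flow_solves[OF w]
    show ?case
    proof (rule LIMSEQ_I)
      fix \<kappa> :: real assume "0 < \<kappa>"
      then obtain d where d: "d > 0" "\<And>x y. \<bar>x - y\<bar> < d \<Longrightarrow> \<bar>g x - g y\<bar> < \<kappa> / 2"
        using compact_support_uniformly_continuous[OF g supp half_gt_zero[OF \<open>0 < \<kappa>\<close>]] by blast
      have "\<exists>N. \<forall>n\<ge>N. \<forall>k\<le>n. \<bar>euler (1 / real n) (X0 \<omega>) (increment ?w 1 n) k - X (grid 1 n k) \<omega>\<bar> \<le> d / 2"
        using d by (intro euler_converges continuous_on_subset[OF fl(1)] fl(2) w) auto
      then obtain N where N: "\<And>n k. n \<ge> N \<Longrightarrow> k \<le> n \<Longrightarrow> \<bar>chain 1 n k \<omega> - X (grid 1 n k) \<omega>\<bar> \<le> d / 2"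
        unfolding chain_def by blast
      show "\<exists>no. \<forall>n\<ge>no. norm ((\<Sum>k<n. D n k \<omega>) / real n - 0) < \<kappa>"
      proof (intro exI[of _ "max N 1"] allI impI)
        fix n assume n: "max N 1 \<le> n"
        have "\<bar>\<Sum>k<n. D n k \<omega>\<bar> \<le> (\<Sum>k<n. \<kappa> / 2)"
        proof (intro order_trans[OF sum_abs] sum_mono)
          fix k assume k: "k \<in> {..<n}"
          then have "k + i \<le> n" using i by auto
          then have "\<bar>chain 1 n (k + i) \<omega> - X (grid 1 n (k + i)) \<omega>\<bar> < d"
            using N[of n "k + i"] n d(1) by auto
          from d(2)[OF this] show "\<bar>D n k \<omega>\<bar> \<le> \<kappa> / 2" by (simp add: D_def)
        qed
        then have "\<bar>\<Sum>k<n. D n k \<omega>\<bar> / real n \<le> \<kappa> / 2" using n by (simp add: field_simps)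
        then have "norm ((\<Sum>k<n. D n k \<omega>) / real n - 0) \<le> \<kappa> / 2" by simp
        then show "norm ((\<Sum>k<n. D n k \<omega>) / real n - 0) < \<kappa>" using \<open>0 < \<kappa>\<close> by linarith
      qed
    qed
  qed
  have lim0: "(\<lambda>n. expectation (\<lambda>\<omega>. (\<Sum>k<n. D n k \<omega>) / real n)) \<longlonglongrightarrow> expectation (\<lambda>_. 0)"
  proof (rule integral_dominated_convergence[where w="\<lambda>_. 2 * K"])
    show "AE \<omega> in M. norm ((\<Sum>k<n. D n k \<omega>) / real n) \<le> 2 * K" for n
    proof (rule AE_I2)
      fix \<omega>
      have "\<bar>\<Sum>k<n. D n k \<omega>\<bar> \<le> (\<Sum>k<n. 2 * K)"
        by (intro order_trans[OF sum_abs] sum_mono Dbd)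
      then show "norm ((\<Sum>k<n. D n k \<omega>) / real n) \<le> 2 * K"
        using K(2) by (cases "n = 0") (auto simp: field_simps)
    qed
  qed (use conv in auto)
  have ED: "expectation (\<lambda>\<omega>. (\<Sum>k<n. D n k \<omega>) / real n)
      = (\<Sum>k<n. expectation (\<lambda>\<omega>. g (chain 1 n (k + i) \<omega>))) / real n - (\<integral>x. g x \<partial>u)" if n: "n > 0" for n
  proof -
    have EX: "expectation (\<lambda>\<omega>. g (X (grid 1 n k) \<omega>)) = (\<integral>x. g x \<partial>u)" for k
      using integral_distr[OF Xm, of g n k] stat[of "grid 1 n k"] by simp
    have intg: "integrable M (\<lambda>\<omega>. g (chain 1 n k \<omega>))" "integrable M (\<lambda>\<omega>. g (X (grid 1 n k) \<omega>))" for k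
      by (rule integrable_const_bound[of _ K]; auto simp: K)+
    have "expectation (D n k) = expectation (\<lambda>\<omega>. g (chain 1 n (k + i) \<omega>)) - (\<integral>x. g x \<partial>u)" for k
      unfolding D_def using intg by (subst Bochner_Integration.integral_diff) (auto simp: EX)
    moreover have "integrable M (D n k)" for k unfolding D_def using intg by auto
    ultimately have "expectation (\<lambda>\<omega>. (\<Sum>k<n. D n k \<omega>))
        = (\<Sum>k<n. expectation (\<lambda>\<omega>. g (chain 1 n (k + i) \<omega>)) - (\<integral>x. g x \<partial>u))"
      by (subst Bochner_Integration.integral_sum) auto
    then show ?thesis using n by (simp add: sum_subtractf diff_divide_distrib)
  qed
  have "(\<lambda>n. expectation (\<lambda>\<omega>. (\<Sum>k<n. D n k \<omega>) / real n) + (\<integral>x. g x \<partial>u)) \<longlonglongrightarrow> 0 + (\<integral>x. g x \<partial>u)"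
    using lim0 by (intro tendsto_intros) simp
  moreover have "\<forall>\<^sub>F n in sequentially. expectation (\<lambda>\<omega>. (\<Sum>k<n. D n k \<omega>) / real n) + (\<integral>x. g x \<partial>u) =
       (\<Sum>k<n. expectation (\<lambda>\<omega>. g (chain 1 n (k + i) \<omega>))) / real n"
  proof (rule eventually_mono[OF eventually_gt_at_top[of 0]])
    fix n :: nat assume "0 < n"
    from ED[OF this] show "expectation (\<lambda>\<omega>. (\<Sum>k<n. D n k \<omega>) / real n) + (\<integral>x. g x \<partial>u) =
       (\<Sum>k<n. expectation (\<lambda>\<omega>. g (chain 1 n (k + i) \<omega>))) / real n" by linarith
  qed
  ultimately show ?thesis by (auto intro: Lim_transform_eventually)
qed

text \<open>
  The estimate is uniform in \<open>y\<close> although \<open>b\<close> is unbounded: far out, \<open>y\<close> and \<open>y - h b y\<close> lie on the same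
  side of the support of \<open>f'\<close>, so all terms vanish.
\<close>

lemma backward_expansion:
  fixes f f' f'' :: "real \<Rightarrow> real"
  assumes f1: "\<And>x. (f has_real_derivative f' x) (at x)" and f2: "\<And>x. (f' has_real_derivative f'' x) (at x)"
    and supp: "\<And>x. r \<le> \<bar>x\<bar> \<Longrightarrow> f' x = 0" and bdd: "\<And>x. \<bar>f'' x\<bar> \<le> K"
  shows "\<exists>A\<ge>0. \<forall>h\<ge>0. \<forall>y. \<bar>f y - f (y - h * b y) - h * (b y * f' y)\<bar> \<le> A * h\<^sup>2"
proof -
  define r' where "r' = max \<bar>r\<bar> R"
  have "compact (b ` {-r'..r'})" by (intro compact_continuous_image drift_cont) auto
  then obtain \<beta> where \<beta>: "\<And>x. x \<in> {-r'..r'} \<Longrightarrow> \<bar>b x\<bar> \<le> \<beta>"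
    by (meson bounded_real compact_imp_bounded image_eqI)
  have K0: "0 \<le> K" using order_trans[OF abs_ge_zero bdd[of 0]] .
  have "\<bar>f y - f (y - h * b y) - h * (b y * f' y)\<bar> \<le> (2 * K * \<beta>\<^sup>2) * h\<^sup>2" if h: "0 \<le> h" for h y
  proof (cases "y \<in> {-r'..r'}")
    case True
    define d where "d = - (h * b y)"
    have mod: "\<bar>f'' (y + s) - f'' y\<bar> \<le> 2 * K + 0 * \<bar>s\<bar>" for s
      using bdd[of "y + s"] bdd[of y] by linarith
    have "\<bar>f (y + d) - (f y + f' y * d + f'' y / 2 * d\<^sup>2)\<bar> \<le> K * d\<^sup>2"
      using second_order_taylor[OF f1 f2 mod, of d] by simp
    moreover have "\<bar>f'' y / 2 * d\<^sup>2\<bar> \<le> K * d\<^sup>2"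
    proof -
      have "\<bar>f'' y / 2 * d\<^sup>2\<bar> = \<bar>f'' y\<bar> / 2 * d\<^sup>2" by (simp add: abs_mult)
      also have "\<dots> \<le> K * d\<^sup>2" using bdd[of y] K0 by (intro mult_right_mono) auto
      finally show ?thesis .
    qed
    ultimately have "\<bar>f y - f (y + d) - (- f' y * d)\<bar> \<le> 2 * K * d\<^sup>2" by linarith
    have dh: "d\<^sup>2 \<le> \<beta>\<^sup>2 * h\<^sup>2"
    proof -
      have "(b y)\<^sup>2 \<le> \<beta>\<^sup>2" using \<beta>[OF True] by (metis abs_ge_zero power2_abs power_mono)
      from mult_right_mono[OF this, of "h\<^sup>2"] show ?thesis
        by (simp add: d_def power_mult_distrib mult.commute)
    qed
    note le = \<open>\<bar>f y - f (y + d) - (- f' y * d)\<bar> \<le> 2 * K * d\<^sup>2\<close>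
    also have "2 * K * d\<^sup>2 \<le> 2 * K * (\<beta>\<^sup>2 * h\<^sup>2)" using dh K0 by (intro mult_left_mono) auto
    finally show ?thesis by (simp add: d_def mult_ac)
  next
    case False
    have "f (y - h * b y) = f y"
    proof (cases "0 \<le> y")
      case True
      then have y: "r' < y" using False by auto
      then have hb: "h * b y \<le> 0" using inward_right[of y] h by (intro mult_nonneg_nonpos) (auto simp: r'_def)
      show ?thesis
      proof (cases "h * b y = 0")
        case False
        then have "y < y - h * b y" using hb by (simp add: less_le)
        then obtain z where "y < z" "f (y - h * b y) - f y = (y - h * b y - y) * f' z"
          using MVT2[of y "y - h * b y" f f'] f1 by auto
        then show ?thesis using supp[of z] y by (auto simp: r'_def)
      qed auto
    next
      case neg: False
      then have y: "y < - r'" using False by auto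
      then have hb: "0 \<le> h * b y" using inward_left[of y] h by (intro mult_nonneg_nonneg) (auto simp: r'_def)
      show ?thesis
      proof (cases "h * b y = 0")
        case False
        then have "y - h * b y < y" using hb by (simp add: less_le)
        then obtain z where "z < y" "f y - f (y - h * b y) = (y - (y - h * b y)) * f' z"
          using MVT2[of "y - h * b y" y f f'] f1 by auto
        then show ?thesis using supp[of z] y by (auto simp: r'_def)
      qed auto
    qed
    moreover have "f' y = 0" using False by (intro supp) (auto simp: r'_def)
    ultimately show ?thesis using K0 by simp
  qed
  then show ?thesis using K0 by (intro exI[of _ "2 * K * \<beta>\<^sup>2"]) auto
qed

text \<open>
  Split a step at \<open>Z = Y\<^sub>k + sqrt \<epsilon> \<xi>\<close>.  The Gaussian part contributes \<open>\<epsilon> h / 2 E (f'' (Y\<^sub>k))\<close>.  For the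
  drift part \<open>Z = Y\<^sub>k\<^sub>+\<^sub>1 - h b (Y\<^sub>k\<^sub>+\<^sub>1)\<close> is expanded around the new state \<open>Y\<^sub>k\<^sub>+\<^sub>1\<close>, so that only \<open>f\<close>, and
  not its composition with the implicit step, is differentiated; this contributes \<open>h E (b f') (Y\<^sub>k\<^sub>+\<^sub>1)\<close>.  Summing
  over the steps up to time \<open>1\<close> and letting \<open>h\<close> tend to \<open>0\<close>, the left side is \<open>E (f (X 1)) - E (f X0) = 0\<close> and
  the averages on the right side converge to integrals with respect to \<open>u\<close>.
\<close>

lemma stationary_generator_zero:
  fixes f f' f'' :: "real \<Rightarrow> real"
  assumes f1: "\<And>x. (f has_real_derivative f' x) (at x)" and f2: "\<And>x. (f' has_real_derivative f'' x) (at x)"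
    and f2_cont: "continuous_on UNIV f''" and f_bdd: "\<And>x. \<bar>f x\<bar> \<le> F"
    and supp1: "\<And>x. r \<le> \<bar>x\<bar> \<Longrightarrow> f' x = 0" and supp2: "\<And>x. r \<le> \<bar>x\<bar> \<Longrightarrow> f'' x = 0"
    and stat: "\<And>t. 0 \<le> t \<Longrightarrow> distr M borel (X t) = u"
  shows "(\<integral>x. b x * f' x \<partial>u) + \<epsilon> / 2 * (\<integral>x. f'' x \<partial>u) = 0"
proof -
  obtain K where K: "\<And>x. \<bar>f'' x\<bar> \<le> K" "0 \<le> K" using compact_support_bounded[OF f2_cont supp2] by blast
  have f_cont: "continuous_on UNIV f" "continuous_on UNIV f'"
    using f1 f2 by (meson DERIV_continuous continuous_at_imp_continuous_on)+
  have bf_cont: "continuous_on UNIV (\<lambda>x. b x * f' x)" by (intro continuous_intros drift_cont f_cont)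
  have bf_supp: "b x * f' x = 0" if "r \<le> \<bar>x\<bar>" for x using supp1[OF that] by simp
  obtain G where G: "\<And>x. \<bar>b x * f' x\<bar> \<le> G" using compact_support_bounded[OF bf_cont bf_supp] by blast
  have [measurable]: "f \<in> borel_measurable borel" "f'' \<in> borel_measurable borel" "(\<lambda>x. b x * f' x) \<in> borel_measurable borel"
    by (intro borel_measurable_continuous_onI f_cont f2_cont bf_cont)+
  from backward_expansion[OF f1 f2 supp1 K(1)]
  obtain A where A': "0 \<le> A \<and> (\<forall>h\<ge>0. \<forall>y. \<bar>f y - f (y - h * b y) - h * (b y * f' y)\<bar> \<le> A * h\<^sup>2)" ..
  then have A: "0 \<le> A" "\<And>h y. 0 \<le> h \<Longrightarrow> \<bar>f y - f (y - h * b y) - h * (b y * f' y)\<bar> \<le> A * h\<^sup>2"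
    by simp_all
  let ?L = "(\<integral>x. b x * f' x \<partial>u) + \<epsilon> / 2 * (\<integral>x. f'' x \<partial>u)"
  have "\<bar>?L\<bar> \<le> \<kappa> * \<epsilon>" if \<kappa>: "0 < \<kappa>" for \<kappa>
  proof -
    obtain d where d: "d > 0" "\<And>x y. \<bar>x - y\<bar> < d \<Longrightarrow> \<bar>f'' x - f'' y\<bar> < \<kappa>"
      using compact_support_uniformly_continuous[OF f2_cont supp2 \<kappa>] by blast
    \<comment> \<open>Where \<open>\<bar>s\<bar> \<ge> d\<close> the trivial bound \<open>2 K\<close> is at most \<open>L \<bar>s\<bar>\<close>.\<close>
    define L where "L = 2 * K / d"
    have L0: "0 \<le> L" using K d by (simp add: L_def)
    have mod: "\<bar>f'' (x + s) - f'' x\<bar> \<le> \<kappa> + L * \<bar>s\<bar>" for x s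
    proof (cases "\<bar>s\<bar> < d")
      case True
      then have "\<bar>f'' (x + s) - f'' x\<bar> < \<kappa>" by (intro d) simp
      then show ?thesis using L0 by (smt (verit) mult_nonneg_nonneg abs_ge_zero)
    next
      case False
      have "2 * K = L * d" using d by (simp add: L_def)
      also have "\<dots> \<le> L * \<bar>s\<bar>" using False L0 by (intro mult_left_mono) auto
      finally show ?thesis using K(1)[of "x + s"] K(1)[of x] \<kappa> by linarith
    qed
    define e where "e = (\<lambda>n k. expectation (\<lambda>\<omega>. f (chain 1 n k \<omega>)))"
    define g1 where "g1 = (\<lambda>n k. expectation (\<lambda>\<omega>. b (chain 1 n k \<omega>) * f' (chain 1 n k \<omega>)))"
    define g2 where "g2 = (\<lambda>n k. expectation (\<lambda>\<omega>. f'' (chain 1 n k \<omega>)))"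
    note cm [measurable] = chain_measurable[of 1, simplified] noise_step_measurable[of 1, simplified]
    define err where "err = (\<lambda>h::real. A * h\<^sup>2 + (\<kappa> * \<epsilon> * h + L * (\<epsilon> * sqrt \<epsilon>) * (h * sqrt h)))"
    have one: "\<bar>e n (Suc k) - e n k - (1 / real n * g1 n (k + 1) + \<epsilon> / 2 * (1 / real n) * g2 n (k + 0))\<bar> \<le> err (1 / real n)"
      if n: "0 < n" "\<theta> < real n" for n k
    proof -
      define h where "h = 1 / real n"
      have h: "0 < h" "h * \<theta> < 1" using n theta_nonneg by (auto simp: h_def)
      define Z where "Z = (\<lambda>\<omega>. chain 1 n k \<omega> + sqrt \<epsilon> * noise_step 1 n k \<omega>)"
      have [measurable]: "Z \<in> borel_measurable M" unfolding Z_def by measurable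
      have Zeq: "chain 1 n (Suc k) \<omega> - h * b (chain 1 n (Suc k) \<omega>) = Z \<omega>" for \<omega>
        unfolding chain_Suc Z_def h_def[symmetric] by (rule step_eq) (use h in auto)
      have int: "integrable M (\<lambda>\<omega>. f (Y \<omega>))" "integrable M (\<lambda>\<omega>. b (Y \<omega>) * f' (Y \<omega>))" "integrable M (\<lambda>\<omega>. f'' (Y \<omega>))"
        if [measurable]: "Y \<in> borel_measurable M" for Y
        using integrable_const_bound[of "\<lambda>\<omega>. f (Y \<omega>)" F] integrable_const_bound[of "\<lambda>\<omega>. b (Y \<omega>) * f' (Y \<omega>)" G]
          integrable_const_bound[of "\<lambda>\<omega>. f'' (Y \<omega>)" K] measurable_compose[OF that, of "\<lambda>x. b x * f' x" borel]
        by (auto simp: f_bdd G K)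
      have first: "\<bar>e n (Suc k) - expectation (\<lambda>\<omega>. f (Z \<omega>)) - h * g1 n (Suc k)\<bar> \<le> A * h\<^sup>2"
      proof -
        let ?y = "chain 1 n (Suc k)"
        have eq: "e n (Suc k) - expectation (\<lambda>\<omega>. f (Z \<omega>)) - h * g1 n (Suc k)
            = expectation (\<lambda>\<omega>. f (?y \<omega>) - f (Z \<omega>) - h * (b (?y \<omega>) * f' (?y \<omega>)))"
          unfolding e_def g1_def using int(1)[of ?y] int(1)[of Z] int(2)[of ?y] by simp
        have "\<bar>expectation (\<lambda>\<omega>. f (?y \<omega>) - f (Z \<omega>) - h * (b (?y \<omega>) * f' (?y \<omega>)))\<bar> \<le> expectation (\<lambda>\<omega>. \<bar>f (?y \<omega>) - f (Z \<omega>) - h * (b (?y \<omega>) * f' (?y \<omega>))\<bar>)"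
          by (rule integral_abs_bound)
        also have "\<dots> \<le> expectation (\<lambda>\<omega>. A * h\<^sup>2)"
        proof (rule integral_mono)
          show "integrable M (\<lambda>\<omega>. \<bar>f (?y \<omega>) - f (Z \<omega>) - h * (b (?y \<omega>) * f' (?y \<omega>))\<bar>)"
            using int(1)[of ?y] int(1)[of Z] int(2)[of ?y] by auto
          show "\<bar>f (?y \<omega>) - f (Z \<omega>) - h * (b (?y \<omega>) * f' (?y \<omega>))\<bar> \<le> A * h\<^sup>2" for \<omega>
            using A(2)[of h "?y \<omega>"] h unfolding Zeq by simp
        qed auto
        finally show ?thesis unfolding eq by (simp add: prob_space)
      qed
      have second: "\<bar>expectation (\<lambda>\<omega>. f (Z \<omega>)) - e n k - \<epsilon> / 2 * h * g2 n k\<bar> \<le> \<kappa> * \<epsilon> * h + L * (\<epsilon> * sqrt \<epsilon>) * (h * sqrt h)"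
      proof -
        let ?y = "chain 1 n k" and ?I = "\<lambda>y. \<integral>x. f (y + sqrt \<epsilon> * x) \<partial>gaussian (sqrt h)"
        have sq: "(sqrt \<epsilon>)\<^sup>2 = \<epsilon>" "(sqrt h)\<^sup>2 = h" "\<bar>sqrt \<epsilon>\<bar> ^ 3 = \<epsilon> * sqrt \<epsilon>" "sqrt h ^ 3 = h * sqrt h"
          using noise_scale_pos h by (simp_all add: power3_eq_cube)
        have I: "\<bar>?I y - (f y + \<epsilon> * h / 2 * f'' y)\<bar> \<le> \<kappa> * \<epsilon> * h + L * (\<epsilon> * sqrt \<epsilon>) * (h * sqrt h)" for y
          using gaussian_average_expansion[OF f1 f2 mod L0 f_bdd, of "sqrt h" y "sqrt \<epsilon>"] h unfolding sq by simp
        have EZ: "expectation (\<lambda>\<omega>. f (Z \<omega>)) = expectation (\<lambda>\<omega>. ?I (?y \<omega>))"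
          using indep_var_expectation(1)[OF chain_indep_noise_step[of 1 n k], of "\<lambda>x d. f (x + sqrt \<epsilon> * d)" F]
            distr_noise_step[of 1 n k] n by (simp add: Z_def h_def f_bdd)
        interpret N: prob_space "gaussian (sqrt h)" by (rule prob_space_gaussian) (use h in simp)
        have I_meas [measurable]: "?I \<in> borel_measurable borel"
          by (rule N.borel_measurable_lebesgue_integral) (simp add: case_prod_beta')
        have I_bdd: "\<bar>?I y\<bar> \<le> F" for y
        proof -
          have "\<bar>?I y\<bar> \<le> (\<integral>x. \<bar>f (y + sqrt \<epsilon> * x)\<bar> \<partial>gaussian (sqrt h))" by (rule integral_abs_bound)
          also have "\<dots> \<le> (\<integral>x. F \<partial>gaussian (sqrt h))"
            by (rule integral_mono) (auto simp: f_bdd intro!: N.integrable_const_bound[of _ F])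
          finally show ?thesis using N.prob_space by simp
        qed
        have intI: "integrable M (\<lambda>\<omega>. ?I (?y \<omega>))"
          by (rule integrable_const_bound[of _ F]) (auto simp: I_bdd intro!: measurable_compose[OF _ I_meas])
        have eq: "expectation (\<lambda>\<omega>. f (Z \<omega>)) - e n k - \<epsilon> / 2 * h * g2 n k
            = expectation (\<lambda>\<omega>. ?I (?y \<omega>) - (f (?y \<omega>) + \<epsilon> * h / 2 * f'' (?y \<omega>)))"
          unfolding EZ e_def g2_def using intI int(1)[of ?y] int(3)[of ?y] by simp
        have "\<bar>expectation (\<lambda>\<omega>. ?I (?y \<omega>) - (f (?y \<omega>) + \<epsilon> * h / 2 * f'' (?y \<omega>)))\<bar> \<le> expectation (\<lambda>\<omega>. \<bar>?I (?y \<omega>) - (f (?y \<omega>) + \<epsilon> * h / 2 * f'' (?y \<omega>))\<bar>)"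
          by (rule integral_abs_bound)
        also have "\<dots> \<le> expectation (\<lambda>\<omega>. \<kappa> * \<epsilon> * h + L * (\<epsilon> * sqrt \<epsilon>) * (h * sqrt h))"
          by (rule integral_mono) (use intI int(1)[of ?y] int(3)[of ?y] I in auto)
        finally show ?thesis unfolding eq by (simp add: prob_space)
      qed
      show ?thesis using first second unfolding err_def h_def[symmetric] by (simp add: mult.assoc)
    qed
    have total: "\<bar>e n n - e n 0 - ((\<Sum>k<n. g1 n (k + 1)) / real n + \<epsilon> / 2 * ((\<Sum>k<n. g2 n (k + 0)) / real n))\<bar>
        \<le> real n * err (1 / real n)" if n: "0 < n" "\<theta> < real n" for n
    proof -
      have eq: "e n n - e n 0 - ((\<Sum>k<n. g1 n (k + 1)) / real n + \<epsilon> / 2 * ((\<Sum>k<n. g2 n (k + 0)) / real n))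
          = (\<Sum>k<n. e n (Suc k) - e n k - (1 / real n * g1 n (k + 1) + \<epsilon> / 2 * (1 / real n) * g2 n (k + 0)))"
        using sum_lessThan_telescope[of "e n" n]
        by (simp add: sum_subtractf sum.distrib flip: sum_distrib_left sum_divide_distrib)
      have "\<bar>\<Sum>k<n. e n (Suc k) - e n k - (1 / real n * g1 n (k + 1) + \<epsilon> / 2 * (1 / real n) * g2 n (k + 0))\<bar>
          \<le> (\<Sum>k<n. err (1 / real n))"
        by (intro order_trans[OF sum_abs] sum_mono one n)
      then show ?thesis unfolding eq by simp
    qed
    have lim_err: "(\<lambda>n. real n * err (1 / real n)) \<longlonglongrightarrow> \<kappa> * \<epsilon>"
    proof -
      have "(\<lambda>n. A * (1 / real n) + (\<kappa> * \<epsilon> + L * (\<epsilon> * sqrt \<epsilon>) * sqrt (1 / real n))) \<longlonglongrightarrow> A * 0 + (\<kappa> * \<epsilon> + L * (\<epsilon> * sqrt \<epsilon>) * sqrt 0)"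
        by (intro tendsto_intros lim_1_over_n)
      moreover have "\<forall>\<^sub>F n in sequentially. A * (1 / real n) + (\<kappa> * \<epsilon> + L * (\<epsilon> * sqrt \<epsilon>) * sqrt (1 / real n)) = real n * err (1 / real n)"
        using eventually_gt_at_top[of 0]
        by eventually_elim (simp add: err_def power2_eq_square field_simps)
      ultimately show ?thesis by (auto intro: Lim_transform_eventually)
    qed
    have "(\<lambda>n. \<bar>e n n - e n 0 - ((\<Sum>k<n. g1 n (k + 1)) / real n + \<epsilon> / 2 * ((\<Sum>k<n. g2 n (k + 0)) / real n))\<bar>)
        \<longlonglongrightarrow> \<bar>(\<integral>x. f x \<partial>u) - (\<integral>x. f x \<partial>u) - ?L\<bar>"
    proof (intro tendsto_intros)
      have "expectation (\<lambda>\<omega>. f (X 1 \<omega>)) = (\<integral>x. f x \<partial>u)"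
        using integral_distr[OF X_measurable[of 1], of f] stat[of 1] by simp
      then show "(\<lambda>n. e n n) \<longlonglongrightarrow> (\<integral>x. f x \<partial>u)"
        unfolding e_def using expectation_chain_tendsto[of 1 f F] f_cont f_bdd by simp
      have "expectation (\<lambda>\<omega>. f (X0 \<omega>)) = (\<integral>x. f x \<partial>u)"
        using integral_distr[OF initial_measurable, of f] distr_initial by simp
      then show "(\<lambda>n. e n 0) \<longlonglongrightarrow> (\<integral>x. f x \<partial>u)" by (simp add: e_def chain_0)
      show "(\<lambda>n. (\<Sum>k<n. g1 n (k + 1)) / real n) \<longlonglongrightarrow> (\<integral>x. b x * f' x \<partial>u)"
        unfolding g1_def by (rule chain_average_tendsto[OF bf_cont bf_supp _ stat]) auto
      show "(\<lambda>n. (\<Sum>k<n. g2 n (k + 0)) / real n) \<longlonglongrightarrow> (\<integral>x. f'' x \<partial>u)"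
        unfolding g2_def by (rule chain_average_tendsto[OF f2_cont supp2 _ stat]) auto
    qed
    moreover have "\<forall>\<^sub>F n in sequentially. \<bar>e n n - e n 0 - ((\<Sum>k<n. g1 n (k + 1)) / real n + \<epsilon> / 2 * ((\<Sum>k<n. g2 n (k + 0)) / real n))\<bar>
        \<le> real n * err (1 / real n)"
    proof -
      obtain N where N: "\<theta> < real N" using reals_Archimedean2 by blast
      show ?thesis
        by (rule eventually_mono[OF eventually_ge_at_top[of "max N 1"]], rule total) (use N in auto)
    qed
    ultimately have "\<bar>(\<integral>x. f x \<partial>u) - (\<integral>x. f x \<partial>u) - ?L\<bar> \<le> \<kappa> * \<epsilon>"
      using lim_err by (intro tendsto_le[OF sequentially_bot, rotated 2])
    then show ?thesis by simp
  qed
  note small = this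
  show ?thesis
  proof (rule ccontr)
    assume "?L \<noteq> 0"
    then have pos: "0 < \<bar>?L\<bar>" by simp
    then have "\<bar>?L\<bar> \<le> \<bar>?L\<bar> / (2 * \<epsilon>) * \<epsilon>"
      using noise_scale_pos by (intro small) simp
    also have "\<dots> = \<bar>?L\<bar> / 2" using noise_scale_pos by simp
    finally have le: "\<bar>?L\<bar> \<le> \<bar>?L\<bar> / 2" .
    have "\<not> l \<le> l / 2" if "0 < l" for l :: real using that by simp
    from this[OF pos] le show False by contradiction
  qed
qed

end

section \<open>Invariance and uniqueness of the Gibbs law\<close>

locale driven_gibbs = driven_drift b b' \<theta> R M B u X0 \<epsilon> + gibbs_drift b b' \<theta> R W \<epsilon> K C j
  for b b' :: "real \<Rightarrow> real" and \<theta> R :: real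
    and M :: "'w measure" and B :: "real \<Rightarrow> 'w \<Rightarrow> real" and u X0 \<epsilon> W K C j
begin

text \<open>
  The distribution function of the \<open>k\<close>-th state differs from the Gibbs distribution function by at most
  \<open>k A h sqrt h\<close>: each step averages the previous difference, which does not enlarge its supremum, and adds the
  error of \<open>gibbs_almost_invariant\<close>.  So the laws of the final states converge weakly to the Gibbs law, while the
  states converge almost surely to the solution; compare characteristic functions.
\<close>

lemma gibbs_invariant:
  assumes u: "u = gibbs" and t: "0 \<le> t"
  shows "distr M borel (X t) = gibbs"
proof (cases "t = 0")
  case True
  have "AE \<omega> in M. X 0 \<omega> = X0 \<omega>"
    using brownian_path
  proof eventually_elim
    case (elim \<omega>)
    then have "continuous_on {0..} (\<lambda>s. sqrt \<epsilon> * B s \<omega>)" by (auto intro!: continuous_intros)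
    then show ?case using flow_solves(2)[of "\<lambda>s. sqrt \<epsilon> * B s \<omega>" 0 "X0 \<omega>"] elim by simp
  qed
  then have "distr M borel (X 0) = distr M borel X0"
    by (intro distr_cong_AE) (auto intro: X_measurable)
  then show ?thesis using True u distr_initial by simp
next
  case False
  with t have t: "0 < t" by simp
  interpret G: prob_space gibbs by (rule prob_space_gibbs)
  interpret G: real_distribution gibbs by unfold_locales simp_all
  obtain A where A: "0 \<le> A" "\<And>h z. 0 < h \<Longrightarrow> h \<le> 1 \<Longrightarrow>
    \<bar>(\<integral>x. cdf gibbs (z - h * b z - sqrt \<epsilon> * x) \<partial>gaussian (sqrt h)) - cdf gibbs z\<bar> \<le> A * (h * sqrt h)"
    using gibbs_almost_invariant by metis
  note [measurable] = chain_measurable[of t] X_measurable[of t]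
  have dist: "real_distribution (distr M borel (chain t n k))" for n k
    by (rule real_distribution_distr) (rule chain_measurable, use t in simp)
  have cdf_meas [measurable]: "cdf N \<in> borel_measurable borel" if "real_distribution N" for N
    by (intro borel_measurable_mono monoI finite_borel_measure.cdf_nondecreasing
        real_distribution.finite_borel_measure_M that)
  have bound: "\<bar>cdf (distr M borel (chain t n k)) z - cdf gibbs z\<bar> \<le> real k * (A * (t / real n * sqrt (t / real n)))"
    if n: "t < real n" "t * \<theta> < real n" for n k z
  proof (induction k arbitrary: z)
    case 0
    have "chain t n 0 = X0" by (auto simp: chain_0)
    then show ?case using u distr_initial by simp
  next
    case (Suc k)
    define h where "h = t / real n"
    have h: "0 < h" "h \<le> 1" "h * \<theta> < 1" using n t by (auto simp: h_def field_simps)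
    interpret N: prob_space "gaussian (sqrt h)" by (rule prob_space_gaussian) (use h in simp)
    interpret Y: real_distribution "distr M borel (chain t n k)" by (rule dist)
    let ?c = "\<lambda>x. z - h * b z - sqrt \<epsilon> * x" and ?F = "cdf (distr M borel (chain t n k))"
    note [measurable] = cdf_meas[OF dist] cdf_meas[OF G.real_distribution_axioms]
    have int: "integrable (gaussian (sqrt h)) (\<lambda>x. ?F (?c x))" "integrable (gaussian (sqrt h)) (\<lambda>x. cdf gibbs (?c x))"
      by (rule N.integrable_const_bound[of _ 1];
          simp add: Y.cdf_nonneg Y.cdf_bounded_prob G.cdf_nonneg G.cdf_bounded_prob abs_of_nonneg)+
    have "\<bar>(\<integral>x. ?F (?c x) \<partial>gaussian (sqrt h)) - (\<integral>x. cdf gibbs (?c x) \<partial>gaussian (sqrt h))\<bar>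
        = \<bar>\<integral>x. ?F (?c x) - cdf gibbs (?c x) \<partial>gaussian (sqrt h)\<bar>"
      using int by simp
    also have "\<dots> \<le> (\<integral>x. \<bar>?F (?c x) - cdf gibbs (?c x)\<bar> \<partial>gaussian (sqrt h))" by (rule integral_abs_bound)
    also have "\<dots> \<le> (\<integral>x. real k * (A * (h * sqrt h)) \<partial>gaussian (sqrt h))"
      using int Suc[of "?c _", folded h_def]
      by (intro integral_mono Bochner_Integration.integrable_diff integrable_abs N.integrable_const) auto
    also have "\<dots> = real k * (A * (h * sqrt h))" using N.prob_space by simp
    finally have 1: "\<bar>(\<integral>x. ?F (?c x) \<partial>gaussian (sqrt h)) - (\<integral>x. cdf gibbs (?c x) \<partial>gaussian (sqrt h))\<bar>
      \<le> real k * (A * (h * sqrt h))" .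
    have 2: "cdf (distr M borel (chain t n (Suc k))) z = (\<integral>x. ?F (?c x) \<partial>gaussian (sqrt h))"
      unfolding h_def by (rule chain_cdf_Suc) (use t n h in \<open>auto simp: h_def\<close>)
    show ?case unfolding 2 h_def[symmetric] using 1 A(2)[OF h(1,2), of z] by (simp add: distrib_right)
  qed
  have wc: "weak_conv_m (\<lambda>n. distr M borel (chain t n n)) gibbs"
    unfolding weak_conv_m_def weak_conv_def
  proof (intro allI impI)
    fix z
    have lim: "(\<lambda>n. A * t * sqrt (t / real n)) \<longlonglongrightarrow> A * t * sqrt 0"
      by (intro tendsto_intros lim_const_over_n)
    obtain N where N: "max t (t * \<theta>) < real N" using reals_Archimedean2 by blast
    have "\<forall>\<^sub>F n in sequentially. norm (cdf (distr M borel (chain t n n)) z - cdf gibbs z) \<le> A * t * sqrt (t / real n)"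
    proof (rule eventually_mono[OF eventually_ge_at_top[of N]])
      fix n assume "N \<le> n"
      then have n: "t < real n" "t * \<theta> < real n" using N by auto
      then have "real n * (A * (t / real n * sqrt (t / real n))) = A * t * sqrt (t / real n)"
        using t by (simp add: field_simps)
      then show "norm (cdf (distr M borel (chain t n n)) z - cdf gibbs z) \<le> A * t * sqrt (t / real n)"
        using bound[OF n, of n z] by simp
    qed
    then have "(\<lambda>n. cdf (distr M borel (chain t n n)) z - cdf gibbs z) \<longlonglongrightarrow> 0"
      by (rule Lim_null_comparison) (use lim in simp)
    then show "(\<lambda>n. cdf (distr M borel (chain t n n)) z) \<longlonglongrightarrow> cdf gibbs z"
      by (simp add: LIM_zero_iff)
  qed
  have Xdist: "real_distribution (distr M borel (X t))"
    by (rule real_distribution_distr) (rule X_measurable, use t in simp)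
  show ?thesis
  proof (rule Levy_uniqueness[OF Xdist G.real_distribution_axioms], rule ext)
    fix s
    have "char (distr M borel Y) s = (\<integral>\<omega>. iexp (s * Y \<omega>) \<partial>M)" if "Y \<in> borel_measurable M" for Y
      unfolding char_def using that by (subst integral_distr) auto
    then have "(\<lambda>n. char (distr M borel (chain t n n)) s) \<longlonglongrightarrow> char (distr M borel (X t)) s"
    proof -
      assume char_eq: "\<And>Y. Y \<in> borel_measurable M \<Longrightarrow> char (distr M borel Y) s = (\<integral>\<omega>. iexp (s * Y \<omega>) \<partial>M)"
      have "continuous_on UNIV (\<lambda>x. iexp (s * x))" by (intro continuous_intros)
      moreover have "norm (iexp (s * x)) \<le> 1" for x by simp
      ultimately have "(\<lambda>n. \<integral>\<omega>. iexp (s * chain t n n \<omega>) \<partial>M) \<longlonglongrightarrow> (\<integral>\<omega>. iexp (s * X t \<omega>) \<partial>M)"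
        using t by (intro expectation_chain_tendsto[where K=1]) auto
      moreover have "chain t n n \<in> borel_measurable M" "X t \<in> borel_measurable M" for n
        using t by (auto intro: chain_measurable X_measurable)
      ultimately show ?thesis by (simp only: char_eq)
    qed
    moreover have "(\<lambda>n. char (distr M borel (chain t n n)) s) \<longlonglongrightarrow> char gibbs s"
      by (rule levy_continuity1[OF dist G.real_distribution_axioms wc])
    ultimately show "char (distr M borel (X t)) s = char gibbs s" by (rule LIMSEQ_unique)
  qed
qed

end

text \<open>
  The function that is \<open>1\<close> on \<open>[l, r]\<close>, \<open>0\<close> outside of the neighbourhood of radius \<open>1 / (n + 1)\<close>, and linear
  in between.
\<close>

definition trapezoid :: "real \<Rightarrow> real \<Rightarrow> nat \<Rightarrow> real \<Rightarrow> real" where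
  "trapezoid l r n x = max 0 (1 - real (Suc n) * max 0 (max (l - x) (x - r)))"

lemma trapezoid_cont: "continuous_on S (trapezoid l r n)"
  unfolding trapezoid_def by (intro continuous_intros)

lemma trapezoid_bounds: "0 \<le> trapezoid l r n x" "trapezoid l r n x \<le> 1"
  unfolding trapezoid_def by auto

lemma trapezoid_inside: "x \<in> {l..r} \<Longrightarrow> trapezoid l r n x = 1"
  unfolding trapezoid_def by auto

lemma trapezoid_support: "\<bar>l\<bar> + \<bar>r\<bar> + 1 \<le> \<bar>x\<bar> \<Longrightarrow> trapezoid l r n x = 0"
proof -
  assume x: "\<bar>l\<bar> + \<bar>r\<bar> + 1 \<le> \<bar>x\<bar>"
  define m where "m = max 0 (max (l - x) (x - r))"
  have "1 \<le> m" using x unfolding m_def by linarith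
  then have "1 * 1 \<le> real (Suc n) * m" by (intro mult_mono) auto
  then show ?thesis unfolding trapezoid_def m_def[symmetric] by simp
qed

lemma trapezoid_tendsto: "(\<lambda>n. trapezoid l r n x) \<longlonglongrightarrow> indicator {l..r} x"
proof (cases "x \<in> {l..r}")
  case True
  then show ?thesis by (simp add: trapezoid_inside)
next
  case False
  define m where "m = max 0 (max (l - x) (x - r))"
  have m: "0 < m" using False unfolding m_def by auto
  obtain N where N: "1 / m < real N" using reals_Archimedean2 by blast
  have "trapezoid l r n x = 0" if "N \<le> n" for n
  proof -
    have "1 / m < real (Suc n)" using N that by linarith
    then have "1 < real (Suc n) * m" using m by (simp add: field_simps)
    then show ?thesis unfolding trapezoid_def m_def[symmetric] by simp
  qed
  then have "\<forall>\<^sub>F n in sequentially. trapezoid l r n x = 0"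
    by (auto simp: eventually_sequentially)
  then show ?thesis using False by (simp add: tendsto_eventually)
qed

lemma trapezoid_integral_tendsto:
  fixes g :: "real \<Rightarrow> real"
  assumes g: "integrable N g" and N: "sets N = sets borel"
  shows "(\<lambda>n. \<integral>x. trapezoid l r n x * g x \<partial>N) \<longlonglongrightarrow> (\<integral>x. indicator {l..r} x * g x \<partial>N)"
    and "(\<lambda>n. \<integral>x. trapezoid (- real n) (real n) 0 x * g x \<partial>N) \<longlonglongrightarrow> (\<integral>x. g x \<partial>N)"
proof -
  note [measurable_cong] = N
  have [measurable]: "g \<in> borel_measurable borel"
    using borel_measurable_integrable[OF g] by simp
  have [measurable]: "trapezoid l r n \<in> borel_measurable borel" for l r n
    by (rule borel_measurable_continuous_onI[OF trapezoid_cont])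
  have dom: "norm (trapezoid l r n x * g x) \<le> norm (g x)" for l r n x
    using trapezoid_bounds[of l r n x] by (simp add: abs_mult mult_left_le_one_le)
  show "(\<lambda>n. \<integral>x. trapezoid l r n x * g x \<partial>N) \<longlonglongrightarrow> (\<integral>x. indicator {l..r} x * g x \<partial>N)"
    by (rule integral_dominated_convergence[where w="\<lambda>x. norm (g x)"])
       (use g dom in \<open>auto intro!: tendsto_mult trapezoid_tendsto\<close>)
  have "(\<lambda>n. trapezoid (- real n) (real n) 0 x) \<longlonglongrightarrow> 1" for x
  proof -
    obtain m where "\<bar>x\<bar> < real m" using reals_Archimedean2 by blast
    then have "\<forall>\<^sub>F n in sequentially. trapezoid (- real n) (real n) 0 x = 1"
      by (intro eventually_mono[OF eventually_ge_at_top[of m]] trapezoid_inside) auto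
    then show ?thesis by (rule tendsto_eventually)
  qed
  then have "(\<lambda>n. trapezoid (- real n) (real n) 0 x * g x) \<longlonglongrightarrow> 1 * g x" for x
    by (intro tendsto_mult tendsto_const)
  then show "(\<lambda>n. \<integral>x. trapezoid (- real n) (real n) 0 x * g x \<partial>N) \<longlonglongrightarrow> (\<integral>x. g x \<partial>N)"
    by (intro integral_dominated_convergence[where w="\<lambda>x. norm (g x)"]) (use g dom in auto)
qed

context gibbs_drift
begin

text \<open>
  For the weight \<open>\<rho>\<close> and any \<open>k\<close> with compact support, the function \<open>f\<close> with \<open>f' = k / \<rho>\<close> satisfies
  \<open>b f' + \<epsilon> / 2 f'' = \<epsilon> / 2 k' / \<rho>\<close>.  A function is the derivative of some such \<open>k\<close> iff its integral vanishes;
  \<open>k' = \<rho> (\<eta>1 A2 - \<eta>2 A1)\<close> has this property when \<open>A1, A2\<close> are the integrals of \<open>\<eta>1 \<rho>, \<eta>2 \<rho>\<close>.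
\<close>

lemma generator_zero_proportional:
  fixes \<eta>1 \<eta>2 :: "real \<Rightarrow> real"
  assumes u: "prob_space u" "sets u = sets borel"
    and gen: "\<And>f f' f'' r F. \<lbrakk>\<And>x. (f has_real_derivative f' x) (at x); \<And>x. (f' has_real_derivative f'' x) (at x);
      continuous_on UNIV f''; \<And>x. \<bar>f x\<bar> \<le> F; \<And>x. r \<le> \<bar>x\<bar> \<Longrightarrow> f' x = 0; \<And>x. r \<le> \<bar>x\<bar> \<Longrightarrow> f'' x = 0\<rbrakk>
      \<Longrightarrow> (\<integral>x. b x * f' x \<partial>u) + \<epsilon> / 2 * (\<integral>x. f'' x \<partial>u) = 0"
    and \<eta>: "continuous_on UNIV \<eta>1" "continuous_on UNIV \<eta>2"
    and supp: "\<And>x. r \<le> \<bar>x\<bar> \<Longrightarrow> \<eta>1 x = 0" "\<And>x. r \<le> \<bar>x\<bar> \<Longrightarrow> \<eta>2 x = 0"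
  shows "(\<integral>x. \<eta>1 x \<partial>u) * (\<integral>x. \<eta>2 x * weight x \<partial>lborel) = (\<integral>x. \<eta>2 x \<partial>u) * (\<integral>x. \<eta>1 x * weight x \<partial>lborel)"
proof -
  interpret u: prob_space u by (rule u)
  define A1 where "A1 = (\<integral>x. \<eta>1 x * weight x \<partial>lborel)"
  define A2 where "A2 = (\<integral>x. \<eta>2 x * weight x \<partial>lborel)"
  have w_cont: "continuous_on UNIV weight"
    unfolding weight_def using noise_pos by (intro continuous_intros potential_cont) auto
  define \<kappa> where "\<kappa> = (\<lambda>x. (\<eta>1 x * weight x) * A2 - (\<eta>2 x * weight x) * A1)"
  have \<eta>w: "continuous_on UNIV (\<lambda>x. \<eta>1 x * weight x)" "continuous_on UNIV (\<lambda>x. \<eta>2 x * weight x)"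
    by (intro continuous_intros \<eta> w_cont)+
  have \<eta>w_int: "integrable lborel (\<lambda>x. \<eta>1 x * weight x)" "integrable lborel (\<lambda>x. \<eta>2 x * weight x)"
    by (rule compact_support_integrable[of _ r]; use \<eta>w supp in simp)+
  have \<kappa>_cont: "continuous_on UNIV \<kappa>" unfolding \<kappa>_def by (intro continuous_intros \<eta>w)
  have \<kappa>_supp: "\<kappa> x = 0" if "r \<le> \<bar>x\<bar>" for x using supp[OF that] by (simp add: \<kappa>_def)
  have \<kappa>_int: "integrable lborel \<kappa>" by (rule compact_support_integrable[OF \<kappa>_cont \<kappa>_supp])
  have \<kappa>_0: "(\<integral>x. \<kappa> x \<partial>lborel) = 0"
    unfolding \<kappa>_def using \<eta>w_int by (simp add: A1_def A2_def)
  define k where "k = (\<lambda>x. LINT y:{..x}|lborel. \<kappa> y)"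
  have k1: "(k has_real_derivative \<kappa> x) (at x)" for x
    unfolding k_def by (rule integral_atMost_deriv[OF \<kappa>_cont \<kappa>_int])
  have k_supp: "k x = 0" if "r \<le> \<bar>x\<bar>" for x
  proof (cases "r \<le> x")
    case True
    have "k x = (\<integral>y. \<kappa> y \<partial>lborel)" unfolding k_def set_lebesgue_integral_def
    proof (rule Bochner_Integration.integral_cong[OF refl])
      fix y show "indicator {..x} y *\<^sub>R \<kappa> y = \<kappa> y"
        using \<kappa>_supp[of y] True by (cases "y \<le> x") auto
    qed
    then show ?thesis using \<kappa>_0 by simp
  next
    case False
    then have "x \<le> - r" using that by auto
    have "k x = (\<integral>y. 0 \<partial>(lborel :: real measure))" unfolding k_def set_lebesgue_integral_def
    proof (rule Bochner_Integration.integral_cong[OF refl])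
      fix y show "indicator {..x} y *\<^sub>R \<kappa> y = 0"
        using \<kappa>_supp[of y] \<open>x \<le> - r\<close> by (cases "y \<le> x") auto
    qed
    then show ?thesis by simp
  qed
  have k_cont: "continuous_on UNIV k" using k1 by (meson DERIV_continuous continuous_at_imp_continuous_on)
  define f' where "f' = (\<lambda>x. k x / weight x)"
  define f'' where "f'' = (\<lambda>x. \<kappa> x / weight x - 2 / \<epsilon> * b x * (k x / weight x))"
  have f2: "(f' has_real_derivative f'' x) (at x)" for x
    unfolding f'_def f''_def using weight_pos[of x]
    by (auto intro!: derivative_eq_intros k1 weight_deriv simp: field_simps power2_eq_square)
  have w0: "weight x \<noteq> 0" for x using weight_pos[of x] by simp
  have f'_cont: "continuous_on UNIV f'" unfolding f'_def by (intro continuous_intros k_cont w_cont) (simp add: w0)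
  have f''_cont: "continuous_on UNIV f''" unfolding f''_def
    by (intro continuous_intros k_cont w_cont \<kappa>_cont drift_cont) (simp_all add: w0)
  have f'_supp: "f' x = 0" if "r \<le> \<bar>x\<bar>" for x using k_supp[OF that] by (simp add: f'_def)
  have f''_supp: "f'' x = 0" if "r \<le> \<bar>x\<bar>" for x using k_supp[OF that] \<kappa>_supp[OF that] by (simp add: f''_def)
  have f'_int: "integrable lborel f'" by (rule compact_support_integrable[OF f'_cont f'_supp])
  define f where "f = (\<lambda>x. LINT y:{..x}|lborel. f' y)"
  have f1: "(f has_real_derivative f' x) (at x)" for x
    unfolding f_def by (rule integral_atMost_deriv[OF f'_cont f'_int])
  have f_bdd: "\<bar>f x\<bar> \<le> (\<integral>y. \<bar>f' y\<bar> \<partial>lborel)" for x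
  proof -
    have "\<bar>f x\<bar> \<le> (\<integral>y. \<bar>indicator {..x} y *\<^sub>R f' y\<bar> \<partial>lborel)"
      unfolding f_def set_lebesgue_integral_def by (rule integral_abs_bound)
    also have "\<dots> \<le> (\<integral>y. \<bar>f' y\<bar> \<partial>lborel)"
      using f'_int integrable_mult_indicator[OF _ f'_int, of "{..x}"]
      by (intro integral_mono) (auto simp: indicator_def)
    finally show ?thesis .
  qed
  have G: "(\<integral>x. b x * f' x \<partial>u) + \<epsilon> / 2 * (\<integral>x. f'' x \<partial>u) = 0"
    by (rule gen[OF f1 f2 f''_cont f_bdd f'_supp f''_supp])
  have bint: "integrable u g" if g: "continuous_on UNIV g" "\<And>x. r \<le> \<bar>x\<bar> \<Longrightarrow> g x = 0" for g :: "real \<Rightarrow> real"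
  proof -
    obtain Kg where "\<And>x. \<bar>g x\<bar> \<le> Kg" using compact_support_bounded[OF g] by blast
    moreover have "g \<in> borel_measurable u"
      using borel_measurable_continuous_onI[OF g(1)] measurable_cong_sets[OF u(2) refl] by blast
    ultimately show ?thesis by (intro u.integrable_const_bound[of _ Kg]) auto
  qed
  have i1: "integrable u (\<lambda>x. b x * f' x)"
    by (rule bint) (auto intro!: continuous_intros drift_cont f'_cont simp: f'_supp)
  have i2: "integrable u f''" by (rule bint[OF f''_cont f''_supp])
  have "(\<integral>x. b x * f' x + \<epsilon> / 2 * f'' x \<partial>u) = 0" using G i1 i2 by simp
  moreover have "b x * f' x + \<epsilon> / 2 * f'' x = \<epsilon> / 2 * (\<eta>1 x * A2 - \<eta>2 x * A1)" for x
    using noise_pos w0[of x] by (simp add: f'_def f''_def \<kappa>_def field_simps)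
  ultimately have "(\<integral>x. \<epsilon> / 2 * (\<eta>1 x * A2 - \<eta>2 x * A1) \<partial>u) = 0" by (simp only:)
  then have "\<epsilon> / 2 * (\<integral>x. \<eta>1 x * A2 - \<eta>2 x * A1 \<partial>u) = 0" by (simp only: integral_mult_right_zero)
  then have "(\<integral>x. \<eta>1 x * A2 - \<eta>2 x * A1 \<partial>u) = 0" using noise_pos by simp
  moreover have "(\<integral>x. \<eta>1 x * A2 - \<eta>2 x * A1 \<partial>u) = (\<integral>x. \<eta>1 x \<partial>u) * A2 - (\<integral>x. \<eta>2 x \<partial>u) * A1"
    using bint[OF \<eta>(1) supp(1)] bint[OF \<eta>(2) supp(2)] by simp
  ultimately show ?thesis by (simp add: A1_def A2_def)
qed

text \<open>
  In the proportionality of the preceding lemma let \<open>\<eta>2\<close> increase to \<open>1\<close>, which fixes the constant, and then let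
  \<open>\<eta>1\<close> decrease to the indicator of an interval.
\<close>

lemma generator_zero_imp_gibbs:
  assumes u: "prob_space u" "sets u = sets borel"
    and gen: "\<And>f f' f'' r F. \<lbrakk>\<And>x. (f has_real_derivative f' x) (at x); \<And>x. (f' has_real_derivative f'' x) (at x);
      continuous_on UNIV f''; \<And>x. \<bar>f x\<bar> \<le> F; \<And>x. r \<le> \<bar>x\<bar> \<Longrightarrow> f' x = 0; \<And>x. r \<le> \<bar>x\<bar> \<Longrightarrow> f'' x = 0\<rbrakk>
      \<Longrightarrow> (\<integral>x. b x * f' x \<partial>u) + \<epsilon> / 2 * (\<integral>x. f'' x \<partial>u) = 0"
  shows "u = gibbs"
proof -
  interpret u: prob_space u by (rule u)
  interpret G: prob_space gibbs by (rule prob_space_gibbs)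
  have rd: "real_distribution u" "real_distribution gibbs"
    using u by (auto simp: real_distribution_def real_distribution_axioms_def G.prob_space_axioms)
  have one_u: "integrable u (\<lambda>_. 1 :: real)" by simp
  let ?A = "\<lambda>\<eta>. \<integral>x. \<eta> x * weight x \<partial>lborel"
  have cross: "(\<integral>x. trapezoid l r n x \<partial>u) * ?A (trapezoid l' r' n') = (\<integral>x. trapezoid l' r' n' x \<partial>u) * ?A (trapezoid l r n)"
    for l r n l' r' n'
    by (rule generator_zero_proportional[OF u gen, where r="\<bar>l\<bar> + \<bar>r\<bar> + 1 + (\<bar>l'\<bar> + \<bar>r'\<bar> + 1)"])
       (auto intro!: trapezoid_cont trapezoid_support)
  have step1: "(\<integral>x. trapezoid l r n x \<partial>u) * mass = ?A (trapezoid l r n)" for l r n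
  proof (rule LIMSEQ_unique)
    show "(\<lambda>i. (\<integral>x. trapezoid l r n x \<partial>u) * ?A (trapezoid (- real i) (real i) 0)) \<longlonglongrightarrow> (\<integral>x. trapezoid l r n x \<partial>u) * mass"
      unfolding mass_def by (intro tendsto_intros trapezoid_integral_tendsto(2) weight_integrable) simp
    have "(\<lambda>i. \<integral>x. trapezoid (- real i) (real i) 0 x \<partial>u) \<longlonglongrightarrow> 1"
      using trapezoid_integral_tendsto(2)[OF one_u u(2)] u.prob_space by simp
    then show "(\<lambda>i. (\<integral>x. trapezoid l r n x \<partial>u) * ?A (trapezoid (- real i) (real i) 0)) \<longlonglongrightarrow> ?A (trapezoid l r n)"
      unfolding cross[of l r n] using tendsto_mult[OF _ tendsto_const] by fastforce
  qed
  have interval: "measure u {l..r} = measure gibbs {l..r}" for l r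
  proof -
    have mu: "measure N {l..r} = (\<integral>x. indicator {l..r} x \<partial>N)" if "sets N = sets borel" for N :: "real measure"
    proof -
      have "space N = UNIV" using sets_eq_imp_space_eq[OF that] by simp
      then show ?thesis by simp
    qed
    have "measure u {l..r} * mass = (\<integral>x. indicator {l..r} x * weight x \<partial>lborel)"
    proof (rule LIMSEQ_unique)
      show "(\<lambda>n. (\<integral>x. trapezoid l r n x \<partial>u) * mass) \<longlonglongrightarrow> measure u {l..r} * mass"
        unfolding mu[OF u(2)] using trapezoid_integral_tendsto(1)[OF one_u u(2), of l r]
        by (intro tendsto_intros) simp
      show "(\<lambda>n. (\<integral>x. trapezoid l r n x \<partial>u) * mass) \<longlonglongrightarrow> (\<integral>x. indicator {l..r} x * weight x \<partial>lborel)"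
        unfolding step1 by (rule trapezoid_integral_tendsto(1)[OF weight_integrable]) simp
    qed
    moreover have "measure gibbs {l..r} * mass = (\<integral>x. indicator {l..r} x * weight x \<partial>lborel)"
      using mass_pos unfolding mu[OF sets_gibbs] by (subst gibbs_integral(2)) auto
    ultimately have "measure u {l..r} * mass = measure gibbs {l..r} * mass" by simp
    then show ?thesis using mass_pos by simp
  qed
  have "cdf u z = cdf gibbs z" for z
  proof (rule LIMSEQ_unique)
    have lim: "(\<lambda>n. measure N {- real n..z}) \<longlonglongrightarrow> cdf N z" if "real_distribution N" for N
    proof -
      interpret N: real_distribution N by (rule that)
      have "(\<lambda>n. measure N {- real n..z}) \<longlonglongrightarrow> measure N (\<Union>n. {- real n..z})"
        by (rule N.finite_Lim_measure_incseq) (auto simp: incseq_def)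
      moreover have "(\<Union>n. {- real n..z}) = {..z}"
      proof (intro equalityI subsetI)
        fix x assume "x \<in> {..z}"
        moreover obtain n where "- x < real n" using reals_Archimedean2 by blast
        ultimately show "x \<in> (\<Union>n. {- real n..z})" by (auto intro!: exI[of _ n])
      qed auto
      ultimately show ?thesis by (simp add: cdf_def)
    qed
    show "(\<lambda>n. measure u {- real n..z}) \<longlonglongrightarrow> cdf u z" by (rule lim[OF rd(1)])
    show "(\<lambda>n. measure u {- real n..z}) \<longlonglongrightarrow> cdf gibbs z" unfolding interval by (rule lim[OF rd(2)])
  qed
  then show ?thesis by (intro cdf_unique[OF rd]) auto
qed

text \<open>
  The integrand is a multiple of the derivative of the weight, which vanishes at infinity.
\<close>

lemma integral_drift_weight: "(\<integral>x. b x * weight x \<partial>lborel) = 0"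
proof -
  obtain A where A: "\<And>x. (1 + \<bar>x\<bar>) * gibbs_density x \<le> A" using poly_times_density_bounded[of 1] by auto
  have wA: "weight x \<le> A * mass / (1 + \<bar>x\<bar>)" for x
    using A[of x] mass_pos by (simp add: gibbs_density_def field_simps)
  have b_int: "integrable lborel (\<lambda>x. b x * weight x)"
    by (rule weight_integrable_poly[OF drift_growth]) measurable
  have lim: "((\<lambda>x. A * mass / (1 + \<bar>x\<bar>)) \<longlongrightarrow> 0) at_top" "((\<lambda>x. A * mass / (1 + \<bar>x\<bar>)) \<longlongrightarrow> 0) at_bot"
  proof -
    have "filterlim (\<lambda>x::real. 1 + \<bar>x\<bar>) at_top at_top"
      by (rule filterlim_at_top_mono[OF filterlim_ident]) (auto intro: always_eventually)
    then show "((\<lambda>x. A * mass / (1 + \<bar>x\<bar>)) \<longlongrightarrow> 0) at_top"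
      by (intro tendsto_divide_0[OF tendsto_const] filterlim_at_top_imp_at_infinity)
    have "filterlim (\<lambda>x::real. 1 + \<bar>x\<bar>) at_top at_bot"
      by (rule filterlim_at_top_mono[OF filterlim_uminus_at_top_at_bot]) (auto intro: always_eventually)
    then show "((\<lambda>x. A * mass / (1 + \<bar>x\<bar>)) \<longlongrightarrow> 0) at_bot"
      by (intro tendsto_divide_0[OF tendsto_const] filterlim_at_top_imp_at_infinity)
  qed
  have w_lim: "(weight \<longlongrightarrow> 0) F" if "((\<lambda>x. A * mass / (1 + \<bar>x\<bar>)) \<longlongrightarrow> 0) F" for F
    by (rule Lim_null_comparison[OF _ that])
       (auto intro!: always_eventually simp: wA abs_of_pos weight_pos)
  have "(LBINT x=-\<infinity>..\<infinity>. 2 / \<epsilon> * b x * weight x) = 0 - 0"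
  proof (rule interval_integral_FTC_integrable)
    show "(weight has_vector_derivative 2 / \<epsilon> * b x * weight x) (at x)" for x
      using weight_deriv by (simp add: has_real_derivative_iff_has_vector_derivative)
    have "continuous_on UNIV (\<lambda>x. 2 / \<epsilon> * b x * weight x)"
      unfolding weight_def using noise_pos by (intro continuous_intros drift_cont potential_cont) auto
    then show "isCont (\<lambda>x. 2 / \<epsilon> * b x * weight x) x" for x
      by (simp add: continuous_on_eq_continuous_at)
    show "set_integrable lborel (einterval (-\<infinity>) \<infinity>) (\<lambda>x. 2 / \<epsilon> * b x * weight x)"
      using integrable_mult_right[OF b_int, of "2 / \<epsilon>"]
      by (simp add: set_integrable_def mult.assoc einterval_def)
    show "((weight \<circ> real_of_ereal) \<longlongrightarrow> 0) (at_right (-\<infinity>))"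
      using w_lim[OF lim(2)] by (simp add: ereal_tendsto_simps1)
    show "((weight \<circ> real_of_ereal) \<longlongrightarrow> 0) (at_left \<infinity>)"
      using w_lim[OF lim(1)] by (simp add: ereal_tendsto_simps1)
  qed simp
  then have "(\<integral>x. 2 / \<epsilon> * (b x * weight x) \<partial>lborel) = 0"
    by (simp add: interval_lebesgue_integral_def set_lebesgue_integral_def einterval_def mult.assoc)
  then show ?thesis using noise_pos by simp
qed

end

section \<open>The mean force of a double well\<close>

text \<open>
  The numerator \<open>\<Phi>\<close> of the derivative of \<open>sinh (p x) / sinh (q x)\<close> vanishes at \<open>0\<close> and has derivative
  \<open>(p\<^sup>2 - q\<^sup>2) sinh (p x) sinh (q x) > 0\<close>.
\<close>

lemma sinh_ratio_strict:
  fixes p q x y :: real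
  assumes q: "0 < q" "q < p" and xy: "0 < x" "x < y"
  shows "sinh (p * x) * sinh (q * y) < sinh (p * y) * sinh (q * x)"
proof -
  define \<Phi> where "\<Phi> = (\<lambda>x. p * cosh (p * x) * sinh (q * x) - q * sinh (p * x) * cosh (q * x))"
  have \<Phi>_pos: "0 < \<Phi> z" if z: "0 < z" for z
  proof -
    have "\<Phi> 0 < \<Phi> z"
    proof (rule DERIV_pos_imp_increasing_open[OF z])
      show "continuous_on {0..z} \<Phi>" unfolding \<Phi>_def by (intro continuous_intros)
      fix s assume s: "0 < s" "s < z"
      have "(\<Phi> has_real_derivative (p * p - q * q) * (sinh (p * s) * sinh (q * s))) (at s)"
        unfolding \<Phi>_def by (auto intro!: derivative_eq_intros simp: algebra_simps)
      moreover have "0 < (p * p - q * q) * (sinh (p * s) * sinh (q * s))"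
        using s q mult_strict_mono[of q p q p] by (intro mult_pos_pos) auto
      ultimately show "\<exists>y. (\<Phi> has_real_derivative y) (at s) \<and> 0 < y" by blast
    qed
    then show ?thesis by (simp add: \<Phi>_def)
  qed
  have "sinh (p * x) / sinh (q * x) < sinh (p * y) / sinh (q * y)"
  proof (rule DERIV_pos_imp_increasing[OF xy(2)])
    fix z assume z: "x \<le> z" "z \<le> y"
    then have s0: "0 < sinh (q * z)" using q xy by simp
    then have "((\<lambda>z. sinh (p * z) / sinh (q * z)) has_real_derivative \<Phi> z / (sinh (q * z))\<^sup>2) (at z)"
      unfolding \<Phi>_def by (auto intro!: derivative_eq_intros simp: algebra_simps power2_eq_square)
    moreover have "0 < \<Phi> z / (sinh (q * z))\<^sup>2"
      using z xy by (intro divide_pos_pos \<Phi>_pos zero_less_power[OF s0]) auto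
    ultimately show "\<exists>D. ((\<lambda>z. sinh (p * z) / sinh (q * z)) has_real_derivative D) (at z) \<and> 0 < D" by blast
  qed
  moreover have "0 < sinh (q * x)" "0 < sinh (q * y)" using q xy by auto
  ultimately show ?thesis by (simp add: field_simps)
qed

locale convex_double_well =
  fixes V :: "real \<Rightarrow> real" and a \<alpha> :: real and q :: nat
  assumes well: "double_well V a"
    and interaction_pos: "0 < \<alpha>"
    and growth: "polynomial_growth V (quadratic_interaction \<alpha>) q"
    and convex_curvature: "convex_on UNIV (deriv (deriv V))"
begin

abbreviation V' :: "real \<Rightarrow> real" where "V' \<equiv> deriv V"
abbreviation V'' :: "real \<Rightarrow> real" where "V'' \<equiv> deriv (deriv V)"

lemma V_deriv: "(V has_real_derivative V' x) (at x)"
  and V'_deriv: "(V' has_real_derivative V'' x) (at x)"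
  and V''_cont: "continuous_on S V''"
proof -
  have d: "(deriv ^^ n) V differentiable (at x)" for n x
    using well by (simp add: double_well_def)
  show "(V has_real_derivative V' x) (at x)"
    using d[of 0 x] by (simp add: DERIV_deriv_iff_real_differentiable)
  show "(V' has_real_derivative V'' x) (at x)"
    using d[of 1 x] by (simp add: DERIV_deriv_iff_real_differentiable)
  have "continuous (at x) V''" for x
    using differentiable_imp_continuous_within[OF d[of 2 x]] by (simp add: numeral_2_eq_2)
  then show "continuous_on S V''" by (intro continuous_at_imp_continuous_on) auto
qed

lemma V_cont: "continuous_on S V" and V'_cont: "continuous_on S V'"
  using V_deriv V'_deriv by (meson DERIV_continuous continuous_at_imp_continuous_on)+

lemma V_measurable [measurable]: "V \<in> borel_measurable borel"
  and V'_measurable [measurable]: "V' \<in> borel_measurable borel"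
  by (intro borel_measurable_continuous_onI V_cont V'_cont)+

lemma V_even: "V (- x) = V x"
  using well by (simp add: double_well_def)

lemma V'_odd: "V' (- x) = - V' x"
proof -
  have "((\<lambda>x. V (- x)) has_real_derivative - V' (- x)) (at x)"
    using V_deriv[of "- x"] by (simp add: DERIV_mirror)
  then have "(V has_real_derivative - V' (- x)) (at x)" by (simp add: V_even)
  from DERIV_unique[OF this V_deriv] show ?thesis by simp
qed

lemma V''_even: "V'' (- x) = V'' x"
proof -
  have "((\<lambda>x. - V' (- x)) has_real_derivative V'' (- x)) (at x)"
    using V'_deriv[of "- x"] DERIV_minus[of "\<lambda>x. V' (- x)" "- V'' (- x)" x] by (simp add: DERIV_mirror)
  then have "(V' has_real_derivative V'' (- x)) (at x)" by (simp add: V'_odd)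
  from DERIV_unique[OF this V'_deriv] show ?thesis by simp
qed

lemma a_pos: "0 < a" and V'_zero_iff: "V' x = 0 \<longleftrightarrow> x = - a \<or> x = 0 \<or> x = a"
  and V''_0_neg: "V'' 0 < 0" and V''_pos: "a \<le> x \<Longrightarrow> 0 < V'' x"
  using well by (auto simp: double_well_def)

text \<open>
  The point \<open>x\<close> is a convex combination of \<open>- y\<close> and \<open>y\<close>, where \<open>V''\<close> takes the same value.
\<close>

lemma V''_mono:
  assumes "\<bar>x\<bar> \<le> y" "0 < y"
  shows "V'' x \<le> V'' y"
proof -
  define t where "t = (x + y) / (2 * y)"
  have t: "0 \<le> t" "t \<le> 1" using assms by (auto simp: t_def field_simps)
  have "(1 - t) * (- y) + t * y = x" using assms by (simp add: t_def field_simps)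
  then have "V'' x \<le> (1 - t) * V'' (- y) + t * V'' y"
    using convex_onD[OF convex_curvature t, of "- y" y] by simp
  then show ?thesis by (simp add: V''_even algebra_simps)
qed

lemma V''_min: "V'' 0 \<le> V'' x"
proof (cases "x = 0")
  case False
  then have "V'' 0 \<le> V'' \<bar>x\<bar>" by (intro V''_mono) auto
  then show ?thesis using V''_even[of x] by (cases "0 \<le> x") auto
qed simp

lemma V'_pos: "a < x \<Longrightarrow> 0 < V' x"
proof -
  assume x: "a < x"
  have "V' a < V' x"
    by (rule DERIV_pos_imp_increasing[OF x]) (use V'_deriv V''_pos in blast)
  then show ?thesis using V'_zero_iff[of a] by simp
qed

text \<open>
  \<open>V'\<close> has no zero in \<open>(0, a)\<close>, and it is negative immediately to the right of \<open>0\<close> because \<open>V'' 0 < 0\<close>.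
\<close>

lemma V'_neg: "0 < x \<Longrightarrow> x < a \<Longrightarrow> V' x < 0"
proof (rule ccontr)
  assume x: "0 < x" "x < a" and "\<not> V' x < 0"
  moreover have "V' x \<noteq> 0" using x by (simp add: V'_zero_iff)
  ultimately have x_pos: "0 < V' x" by simp
  obtain d where d: "d > 0" "\<And>h. 0 < h \<Longrightarrow> h < d \<Longrightarrow> V' (0 + h) < V' 0"
    using DERIV_neg_dec_right[OF V'_deriv V''_0_neg] by blast
  define h where "h = min (d / 2) (x / 2)"
  have h: "0 < h" "h < d" "h < x" using d x by (auto simp: h_def)
  have "V' 0 = 0" by (simp add: V'_zero_iff)
  then have "V' h < 0" using d(2)[OF h(1,2)] by simp
  then obtain z where "h \<le> z" "z \<le> x" "V' z = 0"
    using IVT'[of V' h 0 x] x_pos h V'_cont by auto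
  then show False using h x by (simp add: V'_zero_iff)
qed

lemma V'_nonneg: "a \<le> x \<Longrightarrow> 0 \<le> V' x"
  using V'_pos[of x] V'_zero_iff[of a] by (cases "x = a") auto

lemma V_ge_bottom: "V a \<le> V x"
proof -
  have *: "V a \<le> V x" if x: "0 \<le> x" for x
  proof (cases "x \<le> a")
    case True
    show ?thesis
    proof (rule DERIV_nonpos_imp_nonincreasing[OF True])
      fix z assume "x \<le> z" "z \<le> a"
      then have "V' z \<le> 0" using V'_neg[of z] V'_zero_iff[of z] x by (cases "z = 0 \<or> z = a") auto
      then show "\<exists>y. (V has_real_derivative y) (at z) \<and> y \<le> 0" using V_deriv by blast
    qed
  next
    case False
    show ?thesis
    proof (rule DERIV_nonneg_imp_nondecreasing[where f = V])
      fix z assume "a \<le> z" "z \<le> x"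
      then have "0 \<le> V' z" using V'_pos[of z] V'_zero_iff[of z] by (cases "z = a") auto
      then show "\<exists>y. (V has_real_derivative y) (at z) \<and> y \<ge> 0" using V_deriv by blast
    qed (use False in simp)
  qed
  show ?thesis using *[of x] *[of "- x"] V_even[of x] by (cases "0 \<le> x") auto
qed

text \<open>
  The potential of the frozen equation with mean \<open>m\<close>, with the constant \<open>\<alpha> m\<^sup>2 / 2\<close> omitted: it would cancel in
  the normalisation of the Gibbs law.
\<close>

definition energy :: "real \<Rightarrow> real \<Rightarrow> real" where
  "energy m x = V x + \<alpha> / 2 * x\<^sup>2 - \<alpha> * m * x"

definition drift :: "real \<Rightarrow> real \<Rightarrow> real" where
  "drift m x = - V' x - \<alpha> * x + \<alpha> * m"

definition drift' :: "real \<Rightarrow> real" where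
  "drift' x = - V'' x - \<alpha>"

lemma energy_deriv: "(energy m has_real_derivative - drift m x) (at x)"
  unfolding energy_def drift_def by (auto intro!: derivative_eq_intros V_deriv)

lemma energy_cont: "continuous_on S (energy m)"
  unfolding energy_def by (intro continuous_intros V_cont)

lemma energy_measurable [measurable]: "energy m \<in> borel_measurable borel"
  by (rule borel_measurable_continuous_onI[OF energy_cont])

text \<open>
  The lower bound is stated for \<open>- \<alpha> c \<bar>x\<bar>\<close> in place of \<open>- \<alpha> m x\<close> so that it holds uniformly for
  \<open>\<bar>m\<bar> \<le> c\<close>, as needed for continuity in \<open>m\<close>.  Complete two squares, one for the quartic and one for the
  linear term.
\<close>

lemma energy_coercive: "\<exists>K. \<forall>x. x\<^sup>2 - K \<le> V x + \<alpha> / 2 * x\<^sup>2 - \<alpha> * c * \<bar>x\<bar>"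
proof -
  obtain C4 C2 where C: "0 < C4" "0 < C2" "\<And>x. C4 * x ^ 4 - C2 * x\<^sup>2 \<le> V x"
    using well unfolding double_well_def by blast
  have "x\<^sup>2 - ((C2 + 2)\<^sup>2 / (4 * C4) + (\<alpha> * c)\<^sup>2 / 4) \<le> V x + \<alpha> / 2 * x\<^sup>2 - \<alpha> * c * \<bar>x\<bar>" for x
  proof -
    have "0 \<le> C4 * (x\<^sup>2 - (C2 + 2) / (2 * C4))\<^sup>2" using C by simp
    also have "\<dots> = C4 * x ^ 4 - (C2 + 2) * x\<^sup>2 + (C2 + 2)\<^sup>2 / (4 * C4)"
      using C by (simp add: power2_diff field_simps power2_eq_square power4_eq_xxxx)
    finally have 1: "(C2 + 2) * x\<^sup>2 - (C2 + 2)\<^sup>2 / (4 * C4) \<le> C4 * x ^ 4" by simp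
    have "0 \<le> (\<bar>x\<bar> - \<alpha> * c / 2)\<^sup>2" by simp
    also have "\<dots> = x\<^sup>2 - \<alpha> * c * \<bar>x\<bar> + (\<alpha> * c)\<^sup>2 / 4" by (simp add: power2_diff field_simps)
    finally have 2: "\<alpha> * c * \<bar>x\<bar> - (\<alpha> * c)\<^sup>2 / 4 \<le> x\<^sup>2" by simp
    have 3: "0 \<le> \<alpha> / 2 * x\<^sup>2" using interaction_pos by simp
    have "(C2 + 2) * x\<^sup>2 = C2 * x\<^sup>2 + 2 * x\<^sup>2" by (simp add: distrib_right)
    then show ?thesis using 1 2 3 C(3)[of x] by linarith
  qed
  then show ?thesis by blast
qed

lemma energy_ge_abs: "\<bar>m\<bar> \<le> c \<Longrightarrow> V x + \<alpha> / 2 * x\<^sup>2 - \<alpha> * c * \<bar>x\<bar> \<le> energy m x"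
proof -
  assume m: "\<bar>m\<bar> \<le> c"
  have "\<alpha> * m * x \<le> \<alpha> * (\<bar>m\<bar> * \<bar>x\<bar>)"
    using interaction_pos by (simp add: mult.assoc flip: abs_mult)
  also have "\<dots> \<le> \<alpha> * (c * \<bar>x\<bar>)" using m interaction_pos by (intro mult_left_mono mult_right_mono) auto
  finally show ?thesis by (simp add: energy_def mult.assoc)
qed

lemma one_le_poly: "1 \<le> (1 + \<bar>x\<bar>) ^ (2 * q)" "1 + \<bar>x\<bar> \<le> (1 + \<bar>x\<bar>) ^ (2 * q)" for x :: real
proof -
  show "1 \<le> (1 + \<bar>x\<bar>) ^ (2 * q)" by (rule one_le_power) simp
  have "1 \<le> q" using growth by (simp add: polynomial_growth_def)
  then have "(1 + \<bar>x\<bar>) ^ 1 \<le> (1 + \<bar>x\<bar>) ^ (2 * q)" by (intro power_increasing) auto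
  then show "1 + \<bar>x\<bar> \<le> (1 + \<bar>x\<bar>) ^ (2 * q)" by simp
qed

lemma V'_growth: "\<exists>c\<ge>0. \<forall>x. \<bar>V' x\<bar> \<le> c * (1 + \<bar>x\<bar>) ^ (2 * q)"
proof -
  obtain Cq where Cq: "0 < Cq" "\<And>x. \<bar>V' x\<bar> \<le> Cq * (1 + x ^ (2 * q))"
    using growth unfolding polynomial_growth_def by blast
  have "\<bar>V' x\<bar> \<le> (2 * Cq) * (1 + \<bar>x\<bar>) ^ (2 * q)" for x
  proof -
    have "x ^ (2 * q) = \<bar>x\<bar> ^ (2 * q)" by (simp add: power_mult)
    also have "\<dots> \<le> (1 + \<bar>x\<bar>) ^ (2 * q)" by (rule power_mono) auto
    finally have "Cq * (1 + x ^ (2 * q)) \<le> Cq * ((1 + \<bar>x\<bar>) ^ (2 * q) + (1 + \<bar>x\<bar>) ^ (2 * q))"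
      using Cq one_le_poly[of x] by (intro mult_left_mono add_mono) auto
    then show ?thesis using Cq(2)[of x] by simp
  qed
  then show ?thesis using Cq by (intro exI[of _ "2 * Cq"]) auto
qed

text \<open>
  As \<open>V''\<close> increases on the positive half-line, \<open>y V'' y \<le> V' (2 y) - V' y\<close> whenever \<open>V'' y \<ge> 0\<close>, so the growth
  bound for \<open>V'\<close> passes on to \<open>V''\<close>.  Taking \<open>y = 1 + \<bar>x\<bar>\<close> removes the factor \<open>y\<close> and covers the points near the
  origin as well.
\<close>

lemma V''_growth: "\<exists>c\<ge>0. \<forall>x. \<bar>V'' x\<bar> \<le> c * (1 + \<bar>x\<bar>) ^ (2 * q)"
proof -
  obtain c where c: "0 \<le> c" "\<And>x. \<bar>V' x\<bar> \<le> c * (1 + \<bar>x\<bar>) ^ (2 * q)"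
    using V'_growth by blast
  have upper: "V'' x \<le> 2 * c * 3 ^ (2 * q) * (1 + \<bar>x\<bar>) ^ (2 * q)" for x
  proof -
    define y where "y = 1 + \<bar>x\<bar>"
    have y: "1 \<le> y" by (simp add: y_def)
    have V'_le: "\<bar>V' z\<bar> \<le> c * (3 ^ (2 * q) * y ^ (2 * q))" if "0 \<le> z" "z \<le> 2 * y" for z
    proof -
      have "\<bar>V' z\<bar> \<le> c * (1 + \<bar>z\<bar>) ^ (2 * q)" by (rule c)
      also have "\<dots> \<le> c * (3 * y) ^ (2 * q)" using that y c by (intro mult_left_mono power_mono) auto
      finally show ?thesis by (simp only: power_mult_distrib)
    qed
    have "V'' y \<le> \<bar>V' (2 * y)\<bar> + \<bar>V' y\<bar>"
    proof (cases "0 \<le> V'' y")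
      case True
      obtain z where z: "y < z" "V' (2 * y) - V' y = (2 * y - y) * V'' z"
        using MVT2[of y "2 * y" V' V''] V'_deriv y by auto
      have "1 * V'' y \<le> y * V'' z"
        using V''_mono[of y z] z y True by (intro mult_mono) auto
      then show ?thesis using z(2) by simp
    next
      case False
      then show ?thesis by simp
    qed
    then have "V'' y \<le> 2 * (c * (3 ^ (2 * q) * y ^ (2 * q)))"
      using V'_le[of "2 * y"] V'_le[of y] y by simp
    moreover have "V'' x \<le> V'' y" by (rule V''_mono) (auto simp: y_def)
    ultimately show ?thesis by (simp add: y_def mult_ac)
  qed
  have "\<bar>V'' x\<bar> \<le> (2 * c * 3 ^ (2 * q) + \<bar>V'' 0\<bar>) * (1 + \<bar>x\<bar>) ^ (2 * q)" for x
  proof -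
    have "\<bar>V'' 0\<bar> * 1 \<le> \<bar>V'' 0\<bar> * (1 + \<bar>x\<bar>) ^ (2 * q)" by (intro mult_left_mono one_le_poly) auto
    moreover have "0 \<le> 2 * c * 3 ^ (2 * q) * (1 + \<bar>x\<bar>) ^ (2 * q)" using c by simp
    ultimately show ?thesis using upper[of x] V''_min[of x] by (simp add: distrib_right)
  qed
  moreover have "0 \<le> 2 * c * 3 ^ (2 * q) + \<bar>V'' 0\<bar>" using c by simp
  ultimately show ?thesis by blast
qed

lemma gibbs_drift_energy:
  assumes \<epsilon>: "0 < \<epsilon>"
  shows "\<exists>R K C. gibbs_drift (drift m) drift' (- V'' 0) R (energy m) \<epsilon> K C (2 * q)"
proof -
  obtain K where K: "\<And>x. x\<^sup>2 - K \<le> V x + \<alpha> / 2 * x\<^sup>2 - \<alpha> * \<bar>m\<bar> * \<bar>x\<bar>"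
    using energy_coercive by blast
  obtain c1 where c1: "0 \<le> c1" "\<And>x. \<bar>V' x\<bar> \<le> c1 * (1 + \<bar>x\<bar>) ^ (2 * q)" using V'_growth by blast
  obtain c2 where c2: "0 \<le> c2" "\<And>x. \<bar>V'' x\<bar> \<le> c2 * (1 + \<bar>x\<bar>) ^ (2 * q)" using V''_growth by blast
  define C where "C = c1 + c2 + \<alpha> * (1 + \<bar>m\<bar>)"
  have "gibbs_drift (drift m) drift' (- V'' 0) (max a \<bar>m\<bar>) (energy m) \<epsilon> K C (2 * q)"
  proof
    fix x :: real
    let ?u = "(1 + \<bar>x\<bar>) ^ (2 * q)"
    show "(drift m has_real_derivative drift' x) (at x)"
      unfolding drift_def drift'_def by (auto intro!: derivative_eq_intros V'_deriv)
    show "continuous_on UNIV drift'" unfolding drift'_def by (intro continuous_intros V''_cont)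
    show "drift' x \<le> - V'' 0" unfolding drift'_def using V''_min[of x] interaction_pos by simp
    show "0 \<le> - V'' 0" using V''_0_neg by simp
    show "0 \<le> max a \<bar>m\<bar>" by simp
    show "drift m x \<le> 0" if "max a \<bar>m\<bar> \<le> x"
    proof -
      have "0 \<le> V' x" using that by (intro V'_nonneg) auto
      moreover have "\<alpha> * m \<le> \<alpha> * x" using that interaction_pos by (intro mult_left_mono) auto
      ultimately show ?thesis by (simp add: drift_def)
    qed
    show "0 \<le> drift m x" if "x \<le> - max a \<bar>m\<bar>"
    proof -
      have "0 \<le> V' (- x)" using that by (intro V'_nonneg) auto
      moreover have "\<alpha> * x \<le> \<alpha> * m" using that interaction_pos by (intro mult_left_mono) auto
      ultimately show ?thesis by (simp add: drift_def V'_odd)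
    qed
    show "(energy m has_real_derivative - drift m x) (at x)" by (rule energy_deriv)
    show "0 < \<epsilon>" by (rule \<epsilon>)
    show "x\<^sup>2 - K \<le> energy m x" using K[of x] energy_ge_abs[of m "\<bar>m\<bar>" x] by simp
    have \<alpha>u: "\<alpha> * (1 + \<bar>m\<bar>) * (1 + \<bar>x\<bar>) \<le> \<alpha> * (1 + \<bar>m\<bar>) * ?u"
      using interaction_pos by (intro mult_left_mono one_le_poly) auto
    have "\<alpha> * \<bar>x\<bar> + \<alpha> * \<bar>m\<bar> \<le> \<alpha> * (1 + \<bar>m\<bar>) * (1 + \<bar>x\<bar>)"
      using interaction_pos by (simp add: algebra_simps)
    moreover have "\<bar>drift m x\<bar> \<le> \<bar>V' x\<bar> + (\<alpha> * \<bar>x\<bar> + \<alpha> * \<bar>m\<bar>)"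
    proof -
      have "\<bar>\<alpha> * x\<bar> = \<alpha> * \<bar>x\<bar>" "\<bar>\<alpha> * m\<bar> = \<alpha> * \<bar>m\<bar>" using interaction_pos by (simp_all add: abs_mult)
      then show ?thesis unfolding drift_def by linarith
    qed
    moreover have "0 \<le> c2 * ?u" "0 \<le> c1 * ?u" using c1 c2 by auto
    ultimately show "\<bar>drift m x\<bar> \<le> C * ?u" using c1(2)[of x] \<alpha>u unfolding C_def distrib_right by linarith
    have "\<alpha> * 1 \<le> \<alpha> * (1 + \<bar>m\<bar>) * (1 + \<bar>x\<bar>)"
      using interaction_pos by (simp add: algebra_simps)
    moreover have "\<bar>drift' x\<bar> \<le> \<bar>V'' x\<bar> + \<alpha>" unfolding drift'_def using interaction_pos by linarith
    ultimately show "\<bar>drift' x\<bar> \<le> C * ?u" using c2(2)[of x] \<alpha>u \<open>0 \<le> c1 * ?u\<close> unfolding C_def distrib_right by linarith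
  qed
  then show ?thesis by blast
qed

definition boltzmann :: "real \<Rightarrow> real \<Rightarrow> real \<Rightarrow> real" where
  "boltzmann \<epsilon> m x = exp (- 2 * energy m x / \<epsilon>)"

text \<open>
  Up to normalisation, the expectation of \<open>V'\<close> under the Gibbs law for \<open>m\<close>.
\<close>

definition mean_force :: "real \<Rightarrow> real \<Rightarrow> real" where
  "mean_force \<epsilon> m = (\<integral>x. V' x * boltzmann \<epsilon> m x \<partial>lborel)"

lemma boltzmann_pos: "0 < boltzmann \<epsilon> m x"
  by (simp add: boltzmann_def)

lemma boltzmann_measurable [measurable]: "boltzmann \<epsilon> m \<in> borel_measurable borel"
  unfolding boltzmann_def by measurable

lemma boltzmann_integrable:
  assumes \<epsilon>: "0 < \<epsilon>" and p: "\<And>x. \<bar>p x\<bar> \<le> A * (1 + \<bar>x\<bar>) ^ i" and [measurable]: "p \<in> borel_measurable borel"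
  shows "integrable lborel (\<lambda>x. p x * boltzmann \<epsilon> m x)"
proof -
  obtain K where K: "\<And>x. x\<^sup>2 - K \<le> V x + \<alpha> / 2 * x\<^sup>2 - \<alpha> * \<bar>m\<bar> * \<bar>x\<bar>"
    using energy_coercive by blast
  have "x\<^sup>2 - K \<le> energy m x" for x using K[of x] energy_ge_abs[of m "\<bar>m\<bar>" x] by simp
  then show ?thesis unfolding boltzmann_def
    by (rule polynomial_times_boltzmann_integrable[OF _ \<epsilon> p]) measurable
qed

lemma V'_boltzmann_integrable: "0 < \<epsilon> \<Longrightarrow> integrable lborel (\<lambda>x. V' x * boltzmann \<epsilon> m x)"
  using V'_growth by (metis boltzmann_integrable V'_measurable)

lemma boltzmann_tilt: "boltzmann \<epsilon> m x = boltzmann \<epsilon> 0 x * exp (2 * \<alpha> * m / \<epsilon> * x)"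
  by (simp add: boltzmann_def energy_def diff_divide_distrib add_divide_distrib algebra_simps flip: exp_add)

lemma boltzmann_reflect: "boltzmann \<epsilon> m (- x) = boltzmann \<epsilon> (- m) x"
  by (simp add: boltzmann_def energy_def V_even)

lemma mean_force_odd: "mean_force \<epsilon> (- m) = - mean_force \<epsilon> m"
proof -
  have "mean_force \<epsilon> m = (\<integral>x. V' (- x) * boltzmann \<epsilon> m (- x) \<partial>lborel)"
    unfolding mean_force_def
    using lborel_integral_real_affine[of "- 1" "\<lambda>x. V' x * boltzmann \<epsilon> m x" 0] by simp
  then show ?thesis by (simp add: V'_odd boltzmann_reflect mean_force_def)
qed

lemma mean_force_sinh:
  assumes \<epsilon>: "0 < \<epsilon>"
  shows "integrable lborel (\<lambda>x. V' x * boltzmann \<epsilon> 0 x * sinh (2 * \<alpha> * m / \<epsilon> * x))"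
    and "mean_force \<epsilon> m = (\<integral>x. V' x * boltzmann \<epsilon> 0 x * sinh (2 * \<alpha> * m / \<epsilon> * x) \<partial>lborel)"
proof -
  note int = V'_boltzmann_integrable[OF \<epsilon>, of m] V'_boltzmann_integrable[OF \<epsilon>, of "- m"]
  have eq: "V' x * boltzmann \<epsilon> 0 x * sinh (2 * \<alpha> * m / \<epsilon> * x)
      = (V' x * boltzmann \<epsilon> m x - V' x * boltzmann \<epsilon> (- m) x) / 2" for x
    unfolding boltzmann_tilt[of \<epsilon> m] boltzmann_tilt[of \<epsilon> "- m"] sinh_field_def
    by (simp add: algebra_simps)
  show "integrable lborel (\<lambda>x. V' x * boltzmann \<epsilon> 0 x * sinh (2 * \<alpha> * m / \<epsilon> * x))"
    unfolding eq using int by simp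
  show "mean_force \<epsilon> m = (\<integral>x. V' x * boltzmann \<epsilon> 0 x * sinh (2 * \<alpha> * m / \<epsilon> * x) \<partial>lborel)"
    unfolding eq using int mean_force_odd[of \<epsilon> m] by (simp add: mean_force_def)
qed

text \<open>
  For \<open>k = sinh (p a) / sinh (r a)\<close> the factors \<open>V' x\<close> and \<open>sinh (p x) - k sinh (r x)\<close> both change from negative to
  positive at \<open>x = a\<close>, so their product is positive for all \<open>x > 0\<close> other than \<open>a\<close>.  Integrated, this is
  \<open>mean_force m' - k mean_force m > 0\<close>.
\<close>

lemma mean_force_single_crossing:
  assumes \<epsilon>: "0 < \<epsilon>" and m: "0 < m" "m < m'"
  shows "\<exists>k>0. k * mean_force \<epsilon> m < mean_force \<epsilon> m'"
proof -
  define r where "r = 2 * \<alpha> * m / \<epsilon>"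
  define p where "p = 2 * \<alpha> * m' / \<epsilon>"
  have rp: "0 < r" "r < p" using \<epsilon> m interaction_pos by (auto simp: r_def p_def divide_strict_right_mono)
  define k where "k = sinh (p * a) / sinh (r * a)"
  have sa: "0 < sinh (r * a)" "0 < sinh (p * a)" using rp a_pos by auto
  then have k: "0 < k" by (simp add: k_def)
  define D where "D = (\<lambda>x. V' x * boltzmann \<epsilon> 0 x * sinh (p * x) - k * (V' x * boltzmann \<epsilon> 0 x * sinh (r * x)))"
  have D_int: "integrable lborel D" and D_eq: "(\<integral>x. D x \<partial>lborel) = mean_force \<epsilon> m' - k * mean_force \<epsilon> m"
    unfolding D_def
    using mean_force_sinh[OF \<epsilon>, of m, folded r_def] mean_force_sinh[OF \<epsilon>, of m', folded p_def] by auto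
  have D_alt: "D x = boltzmann \<epsilon> 0 x * (V' x * (sinh (p * x) - k * sinh (r * x)))" for x
    by (simp add: D_def algebra_simps)
  have D_pos: "0 < D x" if x: "0 < x" "x \<noteq> a" for x
  proof (cases "x < a")
    case True
    have "sinh (p * x) * sinh (r * a) < sinh (p * a) * sinh (r * x)"
      using sinh_ratio_strict[OF rp x(1) True] .
    then have "sinh (p * x) < k * sinh (r * x)" using sa by (simp add: k_def field_simps)
    then show ?thesis unfolding D_alt using V'_neg[OF x(1) True] boltzmann_pos
      by (intro mult_pos_pos mult_neg_neg) auto
  next
    case False
    then have "a < x" using x by simp
    have "sinh (p * a) * sinh (r * x) < sinh (p * x) * sinh (r * a)"
      using sinh_ratio_strict[OF rp a_pos \<open>a < x\<close>] .
    then have "k * sinh (r * x) < sinh (p * x)" using sa by (simp add: k_def field_simps)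
    then show ?thesis unfolding D_alt using V'_pos[OF \<open>a < x\<close>] boltzmann_pos
      by (intro mult_pos_pos) auto
  qed
  have D_even: "D (- x) = D x" for x
    by (simp add: D_alt V'_odd boltzmann_reflect) (simp add: algebra_simps)
  have D_nz: "0 < D x" if "x \<noteq> 0" "x \<noteq> a" "x \<noteq> - a" for x
    using D_pos[of x] D_pos[of "- x"] D_even[of x] that by (cases "0 < x") auto
  have D_nonneg: "0 \<le> D x" for x
  proof (cases "x = 0 \<or> x = a \<or> x = - a")
    case True
    then have "V' x = 0" by (auto simp: V'_zero_iff)
    then show ?thesis by (simp add: D_alt)
  next
    case False
    then show ?thesis using D_nz[of x] by simp
  qed
  have "(\<integral>x. D x \<partial>lborel) \<noteq> 0"
  proof
    assume "(\<integral>x. D x \<partial>lborel) = 0"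
    then have "AE x in lborel. D x = 0"
      using integral_nonneg_eq_0_iff_AE[OF D_int] D_nonneg by auto
    moreover have "AE x in lborel. x \<noteq> 0" "AE x in lborel. x \<noteq> a" "AE x in lborel. x \<noteq> - a"
      by (rule AE_lborel_singleton)+
    ultimately have "AE x in (lborel :: real measure). False"
      by eventually_elim (metis D_nz less_irrefl)
    then show False using AE_lborel_False by simp
  qed
  moreover have "0 \<le> (\<integral>x. D x \<partial>lborel)" by (intro integral_nonneg_AE) (simp add: D_nonneg)
  ultimately show ?thesis using D_eq k by (intro exI[of _ k]) auto
qed

text \<open>
  On \<open>[2 a, 3 a]\<close>, where \<open>V' > 0\<close>, the factor \<open>sinh (p x)\<close> is at least \<open>sinh (2 p a) = 2 sinh (p a) cosh (p a)\<close>, while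
  on \<open>[- a, a]\<close> it is at most \<open>sinh (p a)\<close> in absolute value.  For large \<open>p\<close> the additional factor \<open>2 cosh (p a)\<close>
  wins.
\<close>

lemma mean_force_eventually_pos:
  assumes \<epsilon>: "0 < \<epsilon>"
  shows "\<exists>m>c. 0 < mean_force \<epsilon> m"
proof -
  let ?g = "\<lambda>x. V' x * boltzmann \<epsilon> 0 x"
  have g_int: "integrable lborel ?g" by (rule V'_boltzmann_integrable[OF \<epsilon>])
  have g_abs: "integrable lborel (\<lambda>x. \<bar>?g x\<bar>)" using g_int by (rule integrable_abs)
  define C1 where "C1 = (\<integral>x. \<bar>?g x\<bar> \<partial>lborel)"
  have ind_int: "integrable lborel (\<lambda>x. indicator {2*a..3*a} x * ?g x)"
    using integrable_mult_indicator[OF _ g_int, of "{2*a..3*a}"] by simp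
  define C2 where "C2 = (\<integral>x. indicator {2*a..3*a} x * ?g x \<partial>lborel)"
  have g_pos: "0 < ?g x" if "a < x" for x using V'_pos[OF that] boltzmann_pos by simp
  have C1: "0 \<le> C1" unfolding C1_def by (intro integral_nonneg_AE) auto
  have C2: "0 < C2"
  proof -
    have nonneg: "0 \<le> indicator {2*a..3*a} x * ?g x" for x :: real
      using g_pos[of x] a_pos by (auto simp: indicator_def)
    have "C2 \<noteq> 0"
    proof
      assume "C2 = 0"
      then have "AE x in lborel. indicator {2*a..3*a} x * ?g x = 0"
        unfolding C2_def using integral_nonneg_eq_0_iff_AE[OF ind_int] nonneg by auto
      then have "AE x in lborel. x \<notin> {2*a..3*a}"
      proof eventually_elim
        case (elim x)
        then show ?case using g_pos[of x] a_pos by (auto simp: indicator_def split: if_splits)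
      qed
      then have "{2*a..3*a} \<in> null_sets lborel" by (subst AE_iff_null_sets) auto
      then have "emeasure lborel {2*a..3*a} = 0" by (simp add: null_sets_def)
      then show False using a_pos by simp
    qed
    moreover have "0 \<le> C2" unfolding C2_def by (intro integral_nonneg_AE) (simp add: nonneg)
    ultimately show ?thesis by simp
  qed
  obtain m where m: "0 < m" "c < m" "C1 / C2 \<le> 2 * \<alpha> * m / \<epsilon> * a"
  proof -
    \<comment> \<open>The second entry solves \<open>2 \<alpha> m / \<epsilon> * a = C1 / C2\<close>.\<close>
    define m where "m = max (\<bar>c\<bar> + 1) (C1 / C2 * \<epsilon> / (2 * \<alpha> * a))"
    have "C1 / C2 = 2 * \<alpha> * (C1 / C2 * \<epsilon> / (2 * \<alpha> * a)) / \<epsilon> * a"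
      using \<epsilon> a_pos interaction_pos by simp
    also have "\<dots> \<le> 2 * \<alpha> * m / \<epsilon> * a"
      using \<epsilon> a_pos interaction_pos by (intro mult_right_mono divide_right_mono mult_left_mono) (auto simp: m_def)
    finally show ?thesis by (intro that[of m]) (auto simp: m_def)
  qed
  define p where "p = 2 * \<alpha> * m / \<epsilon>"
  have p: "0 < p" using m interaction_pos \<epsilon> by (simp add: p_def)
  have sa: "0 < sinh (p * a)" using p a_pos by simp
  have ch: "C1 / C2 < 2 * cosh (p * a)"
  proof -
    have "C1 / C2 < 1 + p * a" using m(3) by (simp add: p_def)
    also have "\<dots> \<le> exp (p * a)" by (rule exp_ge_add_one_self)
    also have "\<dots> \<le> 2 * cosh (p * a)" by (simp add: cosh_field_def)
    finally show ?thesis .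
  qed
  let ?D = "\<lambda>x. sinh (p * a) * (2 * cosh (p * a) * (indicator {2*a..3*a} x * ?g x) - \<bar>?g x\<bar>)"
  have D_le: "?D x \<le> ?g x * sinh (p * x)" for x
  proof -
    have pos: "?D x \<le> ?g x * sinh (p * x)" if x: "0 \<le> x" for x
    proof -
      consider "x \<le> a" | "a < x" "x \<notin> {2*a..3*a}" | "x \<in> {2*a..3*a}" by linarith
      then show ?thesis
      proof cases
        case 1
        have "\<bar>?g x * sinh (p * x)\<bar> \<le> \<bar>?g x\<bar> * sinh (p * a)"
          unfolding abs_mult[of "?g x"] using 1 x p by (intro mult_left_mono) auto
        moreover have "indicator {2*a..3*a} x = (0::real)" using 1 a_pos by auto
        ultimately show ?thesis by (simp add: mult.commute abs_le_iff)
      next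
        case 2
        have "0 \<le> ?g x * sinh (p * x)" using less_imp_le[OF g_pos[OF 2(1)]] p x
          by (intro mult_nonneg_nonneg[of "?g x"]) auto
        moreover have "?D x \<le> 0" using 2 sa by (simp add: mult_nonneg_nonpos)
        ultimately show ?thesis by linarith
      next
        case 3
        have gx: "0 < ?g x" using 3 a_pos by (intro g_pos) auto
        have "?D x \<le> sinh (p * a) * (2 * cosh (p * a) * ?g x)"
          using 3 sa gx by (intro mult_left_mono) auto
        also have "\<dots> = ?g x * sinh (2 * (p * a))" by (simp add: sinh_double)
        also have "\<dots> \<le> ?g x * sinh (p * x)" using gx 3 p by (intro mult_left_mono) auto
        finally show ?thesis .
      qed
    qed
    show ?thesis
    proof (cases "0 \<le> x")
      case True then show ?thesis by (rule pos)
    next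
      case False
      have "?D x = - (sinh (p * a) * \<bar>?g x\<bar>)" using False a_pos by simp
      also have "\<dots> \<le> ?D (- x)"
      proof -
        have "\<bar>?g (- x)\<bar> = \<bar>?g x\<bar>" by (simp add: V'_odd boltzmann_reflect)
        moreover have "0 \<le> indicator {2*a..3*a} (- x) * ?g (- x)"
          using g_pos[of "- x"] a_pos by (auto simp: indicator_def)
        moreover have "0 \<le> 2 * cosh (p * a)" by simp
        ultimately have "- \<bar>?g x\<bar> \<le> 2 * cosh (p * a) * (indicator {2*a..3*a} (- x) * ?g (- x)) - \<bar>?g (- x)\<bar>"
          by simp
        from mult_left_mono[OF this, of "sinh (p * a)"] show ?thesis using sa by simp
      qed
      also have "\<dots> \<le> ?g (- x) * sinh (p * (- x))" using False by (intro pos) simp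
      also have "\<dots> = ?g x * sinh (p * x)" by (simp add: V'_odd boltzmann_reflect)
      finally show ?thesis .
    qed
  qed
  have "0 < sinh (p * a) * (2 * cosh (p * a) * C2 - C1)"
    using sa ch C2 by (simp add: field_simps)
  also have "\<dots> = (\<integral>x. ?D x \<partial>lborel)"
    unfolding C1_def C2_def using ind_int g_abs by simp
  also have "\<dots> \<le> (\<integral>x. ?g x * sinh (p * x) \<partial>lborel)"
    using D_le ind_int g_abs mean_force_sinh(1)[OF \<epsilon>, of m, folded p_def] by (intro integral_mono) auto
  also have "\<dots> = mean_force \<epsilon> m" unfolding p_def by (rule mean_force_sinh(2)[OF \<epsilon>, symmetric])
  finally show ?thesis using m by blast
qed

lemma mean_force_cont:
  assumes \<epsilon>: "0 < \<epsilon>"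
  shows "continuous_on S (mean_force \<epsilon>)"
proof (intro continuous_at_imp_continuous_on ballI)
  fix m
  show "isCont (mean_force \<epsilon>) m"
    unfolding continuous_at_sequentially
  proof (intro allI impI)
    fix s assume s: "s \<longlonglongrightarrow> m"
    then obtain c where c: "\<And>n. \<bar>s n\<bar> \<le> c"
      using convergent_imp_Bseq[of s] by (auto simp: convergent_def Bseq_def)
    obtain K where K: "\<And>x. x\<^sup>2 - K \<le> V x + \<alpha> / 2 * x\<^sup>2 - \<alpha> * c * \<bar>x\<bar>"
      using energy_coercive by blast
    obtain c1 where c1: "\<And>x. \<bar>V' x\<bar> \<le> c1 * (1 + \<bar>x\<bar>) ^ (2 * q)" using V'_growth by blast
    let ?w = "\<lambda>x. \<bar>V' x\<bar> * exp (- 2 * (V x + \<alpha> / 2 * x\<^sup>2 - \<alpha> * c * \<bar>x\<bar>) / \<epsilon>)"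
    show "(mean_force \<epsilon> \<circ> s) \<longlonglongrightarrow> mean_force \<epsilon> m"
      unfolding comp_def mean_force_def
    proof (rule integral_dominated_convergence[where w="?w"])
      show "integrable lborel ?w"
        by (rule polynomial_times_boltzmann_integrable[OF K \<epsilon>, where C=c1 and j="2*q"]) (use c1 in auto)
      show "AE x in lborel. (\<lambda>n. V' x * boltzmann \<epsilon> (s n) x) \<longlonglongrightarrow> V' x * boltzmann \<epsilon> m x"
        unfolding boltzmann_def energy_def using s \<epsilon> by (intro AE_I2 tendsto_intros) auto
      show "AE x in lborel. norm (V' x * boltzmann \<epsilon> (s n) x) \<le> ?w x" for n
      proof (rule AE_I2)
        fix x
        have "- 2 * energy (s n) x / \<epsilon> \<le> - 2 * (V x + \<alpha> / 2 * x\<^sup>2 - \<alpha> * c * \<bar>x\<bar>) / \<epsilon>"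
          using energy_ge_abs[OF c[of n], of x] \<epsilon> by (intro divide_right_mono) auto
        then show "norm (V' x * boltzmann \<epsilon> (s n) x) \<le> ?w x"
          by (simp add: abs_mult boltzmann_def mult_left_mono)
      qed
    qed measurable
  qed
qed

lemma abs_diff_le_poly: "\<bar>x - m\<bar> \<le> (1 + \<bar>m\<bar>) * (1 + \<bar>x\<bar>)" for x m :: real
proof -
  have "(1 + \<bar>m\<bar>) * (1 + \<bar>x\<bar>) = 1 + \<bar>m\<bar> + \<bar>x\<bar> + \<bar>m\<bar> * \<bar>x\<bar>" by (simp add: algebra_simps)
  moreover have "0 \<le> \<bar>m\<bar> * \<bar>x\<bar>" by simp
  ultimately show ?thesis by linarith
qed

text \<open>
  The drift \<open>- V' x - \<alpha> (x - m)\<close> has integral \<open>0\<close> against the Boltzmann weight.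
\<close>

lemma force_balance:
  assumes \<epsilon>: "0 < \<epsilon>"
  shows "mean_force \<epsilon> m = - \<alpha> * (\<integral>x. (x - m) * boltzmann \<epsilon> m x \<partial>lborel)"
proof -
  obtain R K C where "gibbs_drift (drift m) drift' (- V'' 0) R (energy m) \<epsilon> K C (2 * q)"
    using gibbs_drift_energy[OF \<epsilon>] by blast
  then interpret gibbs_drift "drift m" drift' "- V'' 0" R "energy m" \<epsilon> K C "2 * q" .
  have w: "weight = boltzmann \<epsilon> m" by (auto simp: weight_def boltzmann_def)
  have x_int: "integrable lborel (\<lambda>x. (x - m) * boltzmann \<epsilon> m x)"
  proof (rule boltzmann_integrable[OF \<epsilon>, where A="1 + \<bar>m\<bar>" and i=1])
    show "\<bar>x - m\<bar> \<le> (1 + \<bar>m\<bar>) * (1 + \<bar>x\<bar>) ^ 1" for x using abs_diff_le_poly[of x m] by simp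
  qed measurable
  have "0 = (\<integral>x. drift m x * boltzmann \<epsilon> m x \<partial>lborel)" using integral_drift_weight unfolding w by simp
  also have "\<dots> = (\<integral>x. - (V' x * boltzmann \<epsilon> m x) - \<alpha> * ((x - m) * boltzmann \<epsilon> m x) \<partial>lborel)"
    by (intro Bochner_Integration.integral_cong) (auto simp: drift_def algebra_simps)
  also have "\<dots> = - mean_force \<epsilon> m - \<alpha> * (\<integral>x. (x - m) * boltzmann \<epsilon> m x \<partial>lborel)"
    using V'_boltzmann_integrable[OF \<epsilon>, of m] x_int by (simp add: mean_force_def)
  finally show ?thesis by simp
qed

text \<open>
  For \<open>m = a / 2\<close> and \<open>x \<le> m\<close> the energy is at least \<open>w\<close>, the smaller of its values at \<open>m\<close> and \<open>a\<close>: on \<open>[0, m]\<close>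
  both \<open>V\<close> and \<open>(x - m)\<^sup>2\<close> decrease, and for \<open>x \<le> 0\<close> we have \<open>V x \<ge> V a\<close> and \<open>\<bar>x - m\<bar> \<ge> a - m\<close>.  The energy
  strictly decreases at \<open>m\<close> and strictly increases at \<open>a\<close>, so it takes values below \<open>w\<close> right of \<open>m\<close>.
\<close>

lemma energy_gap:
  "\<exists>w \<delta> c d. 0 < \<delta> \<and> a / 2 < c \<and> c < d \<and> (\<forall>x\<le>a / 2. w \<le> energy (a / 2) x) \<and>
     (\<forall>x\<in>{c..d}. energy (a / 2) x \<le> w - \<delta>)"
proof -
  define m where "m = a / 2"
  let ?U = "energy m"
  have m: "0 < m" "m < a" using a_pos by (auto simp: m_def)
  define w where "w = min (?U m) (?U a)"
  have lower: "w \<le> ?U x" if x: "x \<le> m" for x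
  proof (cases "0 \<le> x")
    case True
    have "?U m \<le> ?U x"
    proof (rule DERIV_nonpos_imp_nonincreasing[OF x])
      fix z assume z: "x \<le> z" "z \<le> m"
      then have "V' z \<le> 0" using V'_neg[of z] V'_zero_iff[of z] True m by (cases "z = 0") auto
      moreover have "\<alpha> * z \<le> \<alpha> * m" using z interaction_pos by simp
      ultimately have "- drift m z \<le> 0" by (simp add: drift_def)
      then show "\<exists>y. (?U has_real_derivative y) (at z) \<and> y \<le> 0" using energy_deriv by blast
    qed
    then show ?thesis by (simp add: w_def)
  next
    case False
    then have "0 \<le> x * (x - a)" by (intro mult_nonpos_nonpos) (use a_pos in auto)
    then have "0 \<le> \<alpha> / 2 * (x * (x - a))"
      using interaction_pos mult_nonneg_nonneg[of "\<alpha> / 2" "x * (x - a)"] by simp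
    then have "?U a \<le> ?U x" using V_ge_bottom[of x]
      by (simp add: energy_def m_def power2_eq_square algebra_simps)
    then show ?thesis by (simp add: w_def)
  qed
  have "\<exists>x>m. ?U x < w"
  proof (cases "?U m \<le> ?U a")
    case True
    have "- drift m m < 0" using V'_neg[of m] m by (simp add: drift_def)
    then obtain d where d: "d > 0" "\<And>h. 0 < h \<Longrightarrow> h < d \<Longrightarrow> ?U (m + h) < ?U m"
      using DERIV_neg_dec_right[OF energy_deriv] by blast
    then have "?U (m + d / 2) < ?U m" by (intro d) auto
    then show ?thesis using True d(1) by (intro exI[of _ "m + d / 2"]) (auto simp: w_def)
  next
    case False
    have "0 < - drift m a"
      using V'_zero_iff[of a] m interaction_pos by (simp add: drift_def)
    then obtain d where d: "d > 0" "\<And>h. 0 < h \<Longrightarrow> h < d \<Longrightarrow> ?U (a - h) < ?U a"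
      using DERIV_pos_inc_left[OF energy_deriv] by blast
    define h where "h = min (d / 2) ((a - m) / 2)"
    have h: "0 < h" "h < d" "m < a - h" using d m by (auto simp: h_def min_def field_simps)
    have "?U (a - h) < ?U a" using h by (intro d)
    then show ?thesis using False h by (intro exI[of _ "a - h"]) (auto simp: w_def)
  qed
  then obtain c where c: "m < c" "?U c < w" by blast
  define \<delta> where "\<delta> = (w - ?U c) / 2"
  have \<delta>: "0 < \<delta>" using c by (simp add: \<delta>_def)
  have "isCont ?U c" using energy_cont[of UNIV m] by (simp add: continuous_on_eq_continuous_at)
  then obtain e where e: "e > 0" "\<And>x. \<bar>x - c\<bar> < e \<Longrightarrow> \<bar>?U x - ?U c\<bar> < \<delta>"
    using \<delta> unfolding continuous_at_eps_delta dist_real_def by blast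
  have "?U x \<le> w - \<delta>" if "x \<in> {c..c + e / 2}" for x
  proof -
    have "\<bar>?U x - ?U c\<bar> < \<delta>" using that e(1) by (intro e) auto
    moreover have "w - \<delta> = ?U c + \<delta>" by (simp add: \<delta>_def field_simps)
    ultimately show ?thesis by linarith
  qed
  then show ?thesis using \<delta> c e lower unfolding m_def
    by (intro exI[of _ w] exI[of _ \<delta>] exI[of _ c] exI[of _ "c + e / 2"]) auto
qed

text \<open>
  By \<open>force_balance\<close> it suffices that \<open>x - m\<close> has a positive integral against the weight for \<open>m = a / 2\<close>.  The part
  \<open>x \<le> m\<close> contributes at least \<open>- C exp (- 2 w / \<epsilon>)\<close> with \<open>C\<close> independent of \<open>\<epsilon> \<le> 1\<close>, because
  \<open>(energy m x - w) / \<epsilon> \<ge> energy m x - w\<close> there; the interval \<open>[c, d]\<close> contributes a positive multiple of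
  \<open>exp (- 2 (w - \<delta>) / \<epsilon>)\<close>, which is exponentially larger.
\<close>

lemma mean_force_neg_small_noise:
  "\<exists>\<epsilon>0>0. \<forall>\<epsilon>. 0 < \<epsilon> \<and> \<epsilon> < \<epsilon>0 \<longrightarrow> mean_force \<epsilon> (a / 2) < 0"
proof -
  define m where "m = a / 2"
  let ?U = "energy m"
  obtain w \<delta> c d where gap: "0 < \<delta>" "m < c" "c < d" "\<And>x. x \<le> m \<Longrightarrow> w \<le> ?U x"
    "\<And>x. x \<in> {c..d} \<Longrightarrow> ?U x \<le> w - \<delta>"
    using energy_gap unfolding m_def by blast
  let ?f = "\<lambda>x. \<bar>x - m\<bar> * exp (2 * w) * boltzmann 1 m x"
  have f_int: "integrable lborel ?f"
  proof (rule boltzmann_integrable[where A="exp (2 * w) * (1 + \<bar>m\<bar>)" and i=1])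
    show "\<bar>\<bar>x - m\<bar> * exp (2 * w)\<bar> \<le> exp (2 * w) * (1 + \<bar>m\<bar>) * (1 + \<bar>x\<bar>) ^ 1" for x
      using mult_left_mono[OF abs_diff_le_poly[of x m], of "exp (2 * w)"] by (simp add: abs_mult mult_ac)
  qed auto
  define C where "C = (\<integral>x. ?f x \<partial>lborel)"
  have C: "0 \<le> C" unfolding C_def
    by (intro integral_nonneg_AE) (auto intro!: AE_I2 mult_nonneg_nonneg simp: less_imp_le[OF boltzmann_pos])
  define L where "L = (c - m) * (d - c)"
  have L: "0 < L" using gap by (simp add: L_def)
  define \<epsilon>0 where "\<epsilon>0 = min 1 (2 * \<delta> * L / (C + 1))"
  have "0 < \<epsilon>0" using gap L C by (simp add: \<epsilon>0_def)
  moreover have "mean_force \<epsilon> m < 0" if \<epsilon>: "0 < \<epsilon>" "\<epsilon> < \<epsilon>0" for \<epsilon>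
  proof -
    have \<epsilon>1: "\<epsilon> < 1" using \<epsilon> by (simp add: \<epsilon>0_def)
    let ?g = "\<lambda>x. (x - m) * boltzmann \<epsilon> m x"
    let ?h = "\<lambda>x. exp (- 2 * w / \<epsilon>) * ((c - m) * exp (2 * \<delta> / \<epsilon>) * indicator {c..d} x - ?f x)"
    have g_int: "integrable lborel ?g"
    proof (rule boltzmann_integrable[OF \<epsilon>(1), where A="1 + \<bar>m\<bar>" and i=1])
      show "\<bar>x - m\<bar> \<le> (1 + \<bar>m\<bar>) * (1 + \<bar>x\<bar>) ^ 1" for x using abs_diff_le_poly[of x m] by simp
    qed measurable
    have ind_int: "integrable lborel (indicator {c..d} :: real \<Rightarrow> real)"
      by (rule integrable_real_indicator) (use gap in auto)
    have f_nonneg: "0 \<le> ?f x" for x using boltzmann_pos[of 1 m x] by simp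
    have le: "?h x \<le> ?g x" for x
    proof (cases "x \<le> m")
      case True
      have "(- 2 * ?U x / \<epsilon>) \<le> - 2 * w / \<epsilon> + (2 * w - 2 * ?U x)"
      proof -
        have "(?U x - w) * 1 \<le> (?U x - w) * (1 / \<epsilon>)"
          using gap(4)[OF True] \<epsilon>(1) \<epsilon>1 by (intro mult_left_mono) auto
        then have "?U x - w \<le> ?U x / \<epsilon> - w / \<epsilon>" by (simp add: diff_divide_distrib)
        moreover have "- 2 * ?U x / \<epsilon> = - (2 * (?U x / \<epsilon>))" "- 2 * w / \<epsilon> = - (2 * (w / \<epsilon>))" by simp_all
        ultimately show ?thesis by linarith
      qed
      then have "boltzmann \<epsilon> m x \<le> exp (- 2 * w / \<epsilon>) * (exp (2 * w) * boltzmann 1 m x)"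
        by (simp add: boltzmann_def flip: exp_add)
      then have "\<bar>x - m\<bar> * boltzmann \<epsilon> m x \<le> \<bar>x - m\<bar> * (exp (- 2 * w / \<epsilon>) * (exp (2 * w) * boltzmann 1 m x))"
        by (intro mult_left_mono) auto
      moreover have "indicator {c..d} x = (0::real)" using True gap by auto
      moreover have "\<bar>x - m\<bar> = m - x" using True by simp
      ultimately show ?thesis by (simp add: algebra_simps)
    next
      case False
      show ?thesis
      proof (cases "x \<in> {c..d}")
        case True
        have "?h x \<le> exp (- 2 * w / \<epsilon>) * ((c - m) * exp (2 * \<delta> / \<epsilon>))"
          using True f_nonneg[of x] by simp
        also have "\<dots> = (c - m) * exp (- 2 * (w - \<delta>) / \<epsilon>)"
        proof -
          have "- 2 * (w - \<delta>) / \<epsilon> = - 2 * w / \<epsilon> + 2 * \<delta> / \<epsilon>"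
            by (simp add: diff_divide_distrib right_diff_distrib)
          then show ?thesis by (simp only: exp_add mult_ac)
        qed
        also have "\<dots> \<le> (x - m) * boltzmann \<epsilon> m x"
        proof (rule mult_mono)
          show "exp (- 2 * (w - \<delta>) / \<epsilon>) \<le> boltzmann \<epsilon> m x"
            unfolding boltzmann_def exp_le_cancel_iff using gap(5)[OF True] \<epsilon>
            by (intro divide_right_mono) auto
        qed (use True gap in auto)
        finally show ?thesis .
      next
        case out: False
        then have "?h x = - (exp (- 2 * w / \<epsilon>) * ?f x)" by simp
        also have "\<dots> \<le> 0" using f_nonneg[of x] by simp
        also have "0 \<le> ?g x" using False boltzmann_pos[of \<epsilon> m x] by simp
        finally show ?thesis .
      qed
    qed
    have "C < 2 * \<delta> / \<epsilon> * L"
    proof -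
      have "\<epsilon> < 2 * \<delta> * L / (C + 1)" using \<epsilon> by (simp add: \<epsilon>0_def)
      then have "\<epsilon> * (C + 1) < 2 * \<delta> * L" using C by (simp add: field_simps)
      then have "C + 1 < 2 * \<delta> * L / \<epsilon>" using \<epsilon> by (simp add: field_simps)
      then show ?thesis by simp
    qed
    also have "\<dots> \<le> exp (2 * \<delta> / \<epsilon>) * L"
    proof (rule mult_right_mono)
      show "2 * \<delta> / \<epsilon> \<le> exp (2 * \<delta> / \<epsilon>)"
        using exp_ge_add_one_self[of "2 * \<delta> / \<epsilon>"] by linarith
    qed (use L in simp)
    finally have "0 < exp (- 2 * w / \<epsilon>) * ((c - m) * exp (2 * \<delta> / \<epsilon>) * (d - c) - C)"
      by (simp add: L_def mult_ac)
    also have "\<dots> = (\<integral>x. ?h x \<partial>lborel)"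
      unfolding C_def using f_int ind_int gap by simp
    also have "\<dots> \<le> (\<integral>x. ?g x \<partial>lborel)"
      using f_int ind_int g_int le by (intro integral_mono) auto
    finally show ?thesis using force_balance[OF \<epsilon>(1), of m] interaction_pos by simp
  qed
  ultimately show ?thesis unfolding m_def by blast
qed

lemma three_balanced_means:
  assumes \<epsilon>: "0 < \<epsilon>" and neg: "mean_force \<epsilon> (a / 2) < 0"
  shows "\<exists>m>0. {m. mean_force \<epsilon> m = 0} = {- m, 0, m}"
proof -
  obtain p where p: "a / 2 < p" "0 < mean_force \<epsilon> p" using mean_force_eventually_pos[OF \<epsilon>] by blast
  obtain m where m: "a / 2 \<le> m" "mean_force \<epsilon> m = 0"
    using IVT'[of "mean_force \<epsilon>" "a / 2" 0 p] neg p mean_force_cont[OF \<epsilon>] by auto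
  have m0: "0 < m" using m a_pos by simp
  have "m' = m" if m': "0 < m'" "mean_force \<epsilon> m' = 0" for m'
  proof (cases m' m rule: linorder_cases)
    case less
    then show ?thesis using mean_force_single_crossing[OF \<epsilon> m'(1) less] m m' by auto
  next
    case greater
    then show ?thesis using mean_force_single_crossing[OF \<epsilon> m0 greater] m m' by auto
  qed
  moreover have "mean_force \<epsilon> 0 = 0" using mean_force_odd[of \<epsilon> 0] by simp
  ultimately have "{m. mean_force \<epsilon> m = 0} = {- m, 0, m}"
    using m(2) mean_force_odd[of \<epsilon>]
    by (auto, metis minus_minus neg_equal_0_iff_equal linorder_neqE_linordered_idom neg_0_less_iff_less)
  then show ?thesis using m0 by blast
qed

end

section \<open>Stationary measures of the self-stabilizing diffusion\<close>

text \<open>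
  Gronwall's inequality is applied to the indefinite integral of \<open>\<gamma>\<close>, which is continuous even if \<open>\<gamma>\<close> is not.
\<close>

lemma gronwall_null:
  fixes \<gamma> :: "real \<Rightarrow> real"
  assumes int: "\<gamma> integrable_on {0..T}" and nonneg: "\<And>s. 0 \<le> \<gamma> s" and T: "0 \<le> T" and K: "0 \<le> K"
    and le: "\<And>t. 0 \<le> t \<Longrightarrow> t \<le> T \<Longrightarrow> \<gamma> t \<le> K * integral {0..t} \<gamma>"
  shows "integral {0..T} \<gamma> = 0"
proof -
  let ?\<Gamma> = "\<lambda>t. integral {0..t} \<gamma>"
  have cont: "continuous_on {0..T} ?\<Gamma>" by (rule indefinite_integral_continuous_1[OF int])
  have sub: "\<gamma> integrable_on {0..t}" if "t \<le> T" for t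
    using integrable_subinterval_real[OF int, of 0 t] that by simp
  have "?\<Gamma> T \<le> 0 * exp (K * T)"
  proof (rule gronwall[OF cont T K])
    fix t assume t: "0 \<le> t" "t \<le> T"
    have "?\<Gamma> t \<le> integral {0..t} (\<lambda>s. K * ?\<Gamma> s)"
    proof (rule integral_le)
      show "\<gamma> integrable_on {0..t}" using t by (intro sub)
      show "(\<lambda>s. K * ?\<Gamma> s) integrable_on {0..t}"
        using t by (intro integrable_continuous_real continuous_intros continuous_on_subset[OF cont]) auto
    qed (use le t in auto)
    then show "?\<Gamma> t \<le> 0 + K * integral {0..t} ?\<Gamma>" by simp
  qed
  moreover have "0 \<le> ?\<Gamma> T" using nonneg by (intro integral_nonneg int)
  ultimately show ?thesis by simp
qed

context convex_double_well
begin

definition gibbs_law :: "real \<Rightarrow> real \<Rightarrow> real measure" where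
  "gibbs_law \<epsilon> m = density lborel (\<lambda>x. ennreal (boltzmann \<epsilon> m x / (\<integral>x. boltzmann \<epsilon> m x \<partial>lborel)))"

lemma gibbs_law_eq:
  assumes "gibbs_drift (drift m) drift' \<theta> R (energy m) \<epsilon> K C j"
  shows "gibbs_drift.gibbs (energy m) \<epsilon> = gibbs_law \<epsilon> m"
proof -
  interpret gibbs_drift "drift m" drift' \<theta> R "energy m" \<epsilon> K C j by (rule assms)
  show ?thesis
    unfolding gibbs_def gibbs_law_def gibbs_density_def mass_def weight_def boltzmann_def ..
qed

lemma gibbs_law_facts:
  assumes \<epsilon>: "0 < \<epsilon>"
  shows "prob_space (gibbs_law \<epsilon> m)" "sets (gibbs_law \<epsilon> m) = sets borel"
    and "integrable (gibbs_law \<epsilon> m) (\<lambda>x. x ^ i)"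
    and "(\<integral>x. x \<partial>gibbs_law \<epsilon> m) = m \<longleftrightarrow> mean_force \<epsilon> m = 0"
proof -
  obtain R K C where G: "gibbs_drift (drift m) drift' (- V'' 0) R (energy m) \<epsilon> K C (2 * q)"
    using gibbs_drift_energy[OF \<epsilon>] by blast
  interpret gibbs_drift "drift m" drift' "- V'' 0" R "energy m" \<epsilon> K C "2 * q" by (rule G)
  note eq = gibbs_law_eq[OF G, symmetric]
  show "prob_space (gibbs_law \<epsilon> m)" "sets (gibbs_law \<epsilon> m) = sets borel"
    unfolding eq by (rule prob_space_gibbs sets_gibbs)+
  have pow: "integrable lborel (\<lambda>x. x ^ i * weight x)" for i
  proof (rule weight_integrable_poly[where A=1 and i=i])
    show "\<bar>x ^ i\<bar> \<le> 1 * (1 + \<bar>x\<bar>) ^ i" for x :: real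
      by (simp add: power_abs power_mono)
  qed simp
  then show "integrable (gibbs_law \<epsilon> m) (\<lambda>x. x ^ i)"
    unfolding eq by (subst gibbs_integral(1)) auto
  have w: "weight = boltzmann \<epsilon> m" by (auto simp: weight_def boltzmann_def)
  have int: "integrable lborel (\<lambda>x. x * boltzmann \<epsilon> m x)" "integrable lborel (boltzmann \<epsilon> m)"
    using pow[of 1] weight_integrable unfolding w by simp_all
  have mass: "mass = (\<integral>x. boltzmann \<epsilon> m x \<partial>lborel)" unfolding mass_def w ..
  have "(\<integral>x. (x - m) * boltzmann \<epsilon> m x \<partial>lborel) = (\<integral>x. x * boltzmann \<epsilon> m x \<partial>lborel) - m * mass"
    unfolding mass using int by (simp add: left_diff_distrib)
  then have "mean_force \<epsilon> m = 0 \<longleftrightarrow> (\<integral>x. x * boltzmann \<epsilon> m x \<partial>lborel) = m * mass"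
    using force_balance[OF \<epsilon>, of m] interaction_pos by simp
  moreover have "(\<integral>x. x \<partial>gibbs_law \<epsilon> m) = (\<integral>x. x * boltzmann \<epsilon> m x \<partial>lborel) / mass"
    unfolding eq by (subst gibbs_integral(2)) (auto simp: w)
  ultimately show "(\<integral>x. x \<partial>gibbs_law \<epsilon> m) = m \<longleftrightarrow> mean_force \<epsilon> m = 0"
    using mass_pos by (simp add: nonzero_divide_eq_eq)
qed

text \<open>
  Rewrites the self-consistent equation with mean function \<open>ms\<close> as the equation frozen at \<open>m\<close> with the
  additional drift \<open>\<alpha> (ms s - m)\<close>.
\<close>

lemma path_equation:
  fixes Y ms :: "real \<Rightarrow> real"
  assumes Y: "continuous_on {0..} Y" and ms: "set_integrable lborel {0..t} ms"
  shows "- (LINT s:{0..t}|lborel. V' (Y s)) - \<alpha> * (LINT s:{0..t}|lborel. Y s - ms s)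
    = integral {0..t} (\<lambda>s. drift m (Y s)) + integral {0..t} (\<lambda>s. \<alpha> * (ms s - m))"
proof -
  have Yt: "continuous_on {0..t} Y" by (rule continuous_on_subset[OF Y]) auto
  have V'Y: "continuous_on {0..t} (\<lambda>s. V' (Y s))"
    by (rule continuous_on_compose2[OF V'_cont[of UNIV] Yt]) auto
  have i1: "set_integrable lborel {0..t} (\<lambda>s. V' (Y s))" by (rule borel_integrable_atLeastAtMost'[OF V'Y])
  have i2: "set_integrable lborel {0..t} Y" by (rule borel_integrable_atLeastAtMost'[OF Yt])
  have i3: "set_integrable lborel {0..t} (\<lambda>s. m)" by (rule borel_integrable_atLeastAtMost') simp
  have i4: "set_integrable lborel {0..t} (\<lambda>s. drift m (Y s))"
    unfolding drift_def by (intro borel_integrable_atLeastAtMost' continuous_intros V'Y Yt)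
  have i5: "set_integrable lborel {0..t} (\<lambda>s. \<alpha> * (ms s - m))"
    using ms i3 by (intro set_integrable_mult_right set_integral_diff(1)) auto
  have i6: "set_integrable lborel {0..t} (\<lambda>s. Y s - ms s)" using i2 ms by (rule set_integral_diff(1))
  have "integral {0..t} (\<lambda>s. drift m (Y s)) + integral {0..t} (\<lambda>s. \<alpha> * (ms s - m))
      = (LINT s:{0..t}|lborel. drift m (Y s)) + (LINT s:{0..t}|lborel. \<alpha> * (ms s - m))"
    by (simp only: set_borel_integral_eq_integral(2)[OF i4] set_borel_integral_eq_integral(2)[OF i5])
  also have "\<dots> = (LINT s:{0..t}|lborel. drift m (Y s) + \<alpha> * (ms s - m))"
    by (rule set_integral_add(2)[OF i4 i5, symmetric])
  also have "\<dots> = (LINT s:{0..t}|lborel. (- V' (Y s)) - \<alpha> * (Y s - ms s))"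
    by (rule set_lebesgue_integral_cong) (auto simp: drift_def algebra_simps)
  also have "\<dots> = (LINT s:{0..t}|lborel. - V' (Y s)) - (LINT s:{0..t}|lborel. \<alpha> * (Y s - ms s))"
    using i1 i6 by (intro set_integral_diff(2) set_integrable_mult_right)
      (auto simp: set_integrable_def)
  also have "\<dots> = - (LINT s:{0..t}|lborel. V' (Y s)) - \<alpha> * (LINT s:{0..t}|lborel. Y s - ms s)"
    by (simp add: set_lebesgue_integral_def)
  finally show ?thesis by simp
qed

text \<open>
  Under a stationary law the mean function is constant, so the given solution coincides with the limit of the scheme
  for the frozen drift, to which the results of the preceding sections apply.
\<close>

lemma stationary_imp_balanced:
  fixes M :: "'w measure"
  assumes \<epsilon>: "0 < \<epsilon>" and space: "noise_space M B" and stat: "stationary_measure M B V \<alpha> q \<epsilon> u"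
  shows "\<exists>m. mean_force \<epsilon> m = 0 \<and> u = gibbs_law \<epsilon> m"
proof -
  have u: "prob_space u" "sets u = sets borel" using stat by (auto simp: stationary_measure_def)
  obtain X0 where X0: "initial_value M B u X0"
    using space u unfolding noise_space_def by blast
  have M: "prob_space M" "brownian_motion M B" using space by (auto simp: noise_space_def)
  obtain Y where sol: "self_stabilizing_solution M B V \<alpha> \<epsilon> X0 Y"
    and law: "\<And>t. 0 \<le> t \<Longrightarrow> distr M borel (Y t) = u"
    using stat X0 unfolding stationary_measure_def by blast
  define m where "m = (\<integral>x. x \<partial>u)"
  obtain R K C where G: "gibbs_drift (drift m) drift' (- V'' 0) R (energy m) \<epsilon> K C (2 * q)"
    using gibbs_drift_energy[OF \<epsilon>] by blast
  interpret prob_space M by (rule M)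
  interpret gibbs_drift "drift m" drift' "- V'' 0" R "energy m" \<epsilon> K C "2 * q" by (rule G)
  interpret driven_gibbs "drift m" drift' "- V'' 0" R M B u X0 \<epsilon> "energy m" K C "2 * q"
    by unfold_locales (use M X0 \<epsilon> in auto)
  have mean: "law_mean M (Y s) = m" if "0 \<le> s" for s using law[OF that] by (simp add: law_mean_def m_def)
  have eq: "AE \<omega> in M. \<forall>t\<ge>0. Y t \<omega> = X t \<omega>"
  proof -
    have "AE \<omega> in M. continuous_on {0..} (\<lambda>t. Y t \<omega>) \<and>
       (\<forall>t\<ge>0. Y t \<omega> = X0 \<omega> + sqrt \<epsilon> * B t \<omega> - (LINT s:{0..t}|lborel. V' (Y s \<omega>))
          - \<alpha> * (LINT s:{0..t}|lborel. Y s \<omega> - law_mean M (Y s)))"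
      using sol unfolding self_stabilizing_solution_def by blast
    with brownian_path show ?thesis
    proof eventually_elim
      case (elim \<omega>)
      then have cont: "continuous_on {0..} (\<lambda>t. Y t \<omega>)" and B0: "B 0 \<omega> = 0" by auto
      have path: "Y t \<omega> = X0 \<omega> + sqrt \<epsilon> * B t \<omega> + integral {0..t} (\<lambda>s. drift m (Y s \<omega>))" if t: "0 \<le> t" for t
      proof -
        have "set_integrable lborel {0..t} (\<lambda>s. law_mean M (Y s))"
          using sol t unfolding self_stabilizing_solution_def by blast
        note pe = path_equation[OF cont this, of m]
        have "Y t \<omega> = X0 \<omega> + sqrt \<epsilon> * B t \<omega> - (LINT s:{0..t}|lborel. V' (Y s \<omega>))
            - \<alpha> * (LINT s:{0..t}|lborel. Y s \<omega> - law_mean M (Y s))"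
          using elim t by blast
        with pe have "Y t \<omega> = X0 \<omega> + sqrt \<epsilon> * B t \<omega> + (integral {0..t} (\<lambda>s. drift m (Y s \<omega>))
            + integral {0..t} (\<lambda>s. \<alpha> * (law_mean M (Y s) - m)))"
          by linarith
        moreover have "integral {0..t} (\<lambda>s. \<alpha> * (law_mean M (Y s) - m)) = integral {0..t} (\<lambda>s. 0)"
          by (rule integral_cong) (simp add: mean)
        ultimately show ?thesis by simp
      qed
      show ?case
      proof (intro allI impI)
        fix t :: real assume t: "0 \<le> t"
        have "(\<lambda>n. euler (t / real n) (X0 \<omega>) (increment (\<lambda>s. sqrt \<epsilon> * B s \<omega>) t n) n) \<longlonglongrightarrow> Y t \<omega>"
          by (rule euler_tendsto) (use cont B0 t path in \<open>auto intro: continuous_on_subset\<close>)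
        then show "Y t \<omega> = X t \<omega>" unfolding flow_def by (rule limI[symmetric])
      qed
    qed
  qed
  have X_law: "distr M borel (X t) = u" if t: "0 \<le> t" for t
  proof -
    have "Y t \<in> borel_measurable M"
      using sol t unfolding self_stabilizing_solution_def by (blast intro: history_measurableD)
    then have "distr M borel (Y t) = distr M borel (X t)"
      using eq t by (intro distr_cong_AE) (auto intro: X_measurable)
    then show ?thesis using law[OF t] by simp
  qed
  have "u = gibbs"
    by (rule generator_zero_imp_gibbs[OF u]) (rule stationary_generator_zero[OF _ _ _ _ _ _ X_law])
  then have "u = gibbs_law \<epsilon> m" using gibbs_law_eq[OF G] by simp
  moreover from this have "mean_force \<epsilon> m = 0" using gibbs_law_facts(4)[OF \<epsilon>, of m] m_def by simp
  ultimately show ?thesis by blast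
qed

text \<open>
  The frozen solution \<open>X\<close> keeps the Gibbs law, hence its mean \<open>m\<close>, and therefore solves the self-consistent
  equation.  Any other solution \<open>Y\<close> with the same noise and initial value has the extra drift
  \<open>p s = \<alpha> (ms s - m)\<close>; the comparison estimate bounds \<open>\<bar>Y - X\<bar>\<close> by the integral of \<open>\<bar>p\<bar>\<close>, and
  \<open>\<bar>p s\<bar>\<close> by the expectation of \<open>\<alpha> \<bar>Y s - X s\<bar>\<close>, so \<open>p\<close> vanishes.
\<close>

lemma balanced_imp_stationary:
  fixes M :: "'w measure"
  assumes \<epsilon>: "0 < \<epsilon>" and space: "noise_space M B" and bal: "mean_force \<epsilon> m = 0"
  shows "stationary_measure M B V \<alpha> q \<epsilon> (gibbs_law \<epsilon> m)"
  unfolding stationary_measure_def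
proof (intro conjI allI impI)
  let ?u = "gibbs_law \<epsilon> m"
  show "prob_space ?u" "sets ?u = sets borel" "integrable ?u (\<lambda>x. x ^ (8 * q\<^sup>2))"
    by (rule gibbs_law_facts[OF \<epsilon>])+
  fix X0 assume X0: "initial_value M B ?u X0"
  have M: "prob_space M" "brownian_motion M B" using space by (auto simp: noise_space_def)
  have mean_u: "(\<integral>x. x \<partial>?u) = m" using gibbs_law_facts(4)[OF \<epsilon>] bal by simp
  have int_u: "integrable ?u (\<lambda>x. x)" using gibbs_law_facts(3)[OF \<epsilon>, of m 1] by simp
  obtain R K C where G: "gibbs_drift (drift m) drift' (- V'' 0) R (energy m) \<epsilon> K C (2 * q)"
    using gibbs_drift_energy[OF \<epsilon>] by blast
  interpret prob_space M by (rule M)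
  interpret gibbs_drift "drift m" drift' "- V'' 0" R "energy m" \<epsilon> K C "2 * q" by (rule G)
  interpret driven_gibbs "drift m" drift' "- V'' 0" R M B ?u X0 \<epsilon> "energy m" K C "2 * q"
    by unfold_locales (use M X0 \<epsilon> in auto)
  have X_law: "distr M borel (X t) = ?u" if "0 \<le> t" for t
    using gibbs_invariant[OF _ that] gibbs_law_eq[OF G] by simp
  have X_mean: "law_mean M (X t) = m" if "0 \<le> t" for t
    using X_law[OF that] mean_u by (simp add: law_mean_def)
  have X_path: "AE \<omega> in M. continuous_on {0..} (\<lambda>t. X t \<omega>) \<and>
      (\<forall>t\<ge>0. X t \<omega> = X0 \<omega> + sqrt \<epsilon> * B t \<omega> + integral {0..t} (\<lambda>s. drift m (X s \<omega>)))"
    using brownian_path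
  proof eventually_elim
    case (elim \<omega>)
    then have "continuous_on {0..} (\<lambda>s. sqrt \<epsilon> * B s \<omega>)" "sqrt \<epsilon> * B 0 \<omega> = 0" by (auto intro!: continuous_intros)
    from flow_solves(1,2)[OF this, where x="X0 \<omega>"] show ?case by auto
  qed
  show "\<exists>X. self_stabilizing_solution M B V \<alpha> \<epsilon> X0 X"
  proof (intro exI[of _ "\<lambda>t \<omega>. X t \<omega>"])
    have mean_int: "set_integrable lborel {0..t} (\<lambda>s. law_mean M (X s))" for t
    proof -
      have "set_integrable lborel {0..t} (\<lambda>s. m)" by (rule borel_integrable_atLeastAtMost') simp
      then show ?thesis by (rule set_integrable_cong[THEN iffD1, rotated -1]) (auto simp: X_mean)
    qed
    have "AE \<omega> in M. continuous_on {0..} (\<lambda>t. X t \<omega>) \<and>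
       (\<forall>t\<ge>0. X t \<omega> = X0 \<omega> + sqrt \<epsilon> * B t \<omega> - (LINT s:{0..t}|lborel. V' (X s \<omega>))
          - \<alpha> * (LINT s:{0..t}|lborel. X s \<omega> - law_mean M (X s)))"
      using X_path
    proof eventually_elim
      case (elim \<omega>)
      then have cont: "continuous_on {0..} (\<lambda>t. X t \<omega>)" by blast
      show ?case
      proof (intro conjI allI impI cont)
        fix t :: real assume t: "0 \<le> t"
        have "integral {0..t} (\<lambda>s. \<alpha> * (law_mean M (X s) - m)) = integral {0..t} (\<lambda>s. 0)"
          by (rule integral_cong) (simp add: X_mean)
        then have "integral {0..t} (\<lambda>s. \<alpha> * (law_mean M (X s) - m)) = 0" by simp
        moreover have "X t \<omega> = X0 \<omega> + sqrt \<epsilon> * B t \<omega> + integral {0..t} (\<lambda>s. drift m (X s \<omega>))"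
          using elim t by blast
        ultimately show "X t \<omega> = X0 \<omega> + sqrt \<epsilon> * B t \<omega> - (LINT s:{0..t}|lborel. V' (X s \<omega>))
            - \<alpha> * (LINT s:{0..t}|lborel. X s \<omega> - law_mean M (X s))"
          using path_equation[OF cont mean_int[of t], of m] by linarith
      qed
    qed
    note path = this
    show "self_stabilizing_solution M B V \<alpha> \<epsilon> X0 (\<lambda>t \<omega>. X t \<omega>)"
      unfolding self_stabilizing_solution_def
    proof (intro conjI allI impI path)
      fix s :: real assume s: "0 \<le> s"
      show "X s \<in> borel_measurable (history M B X0 s)" by (rule flow_measurable_history[OF s])
      show "integrable (distr M borel (X s)) (\<lambda>x. x)" unfolding X_law[OF s] by (rule int_u)
      show "set_integrable lborel {0..s} (\<lambda>s. law_mean M (X s))" by (rule mean_int)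
    qed
  qed
  fix Y and t :: real assume sol: "self_stabilizing_solution M B V \<alpha> \<epsilon> X0 Y" and t: "0 \<le> t"
  define ms where "ms = (\<lambda>s. law_mean M (Y s))"
  define p where "p = (\<lambda>s. \<alpha> * (ms s - m))"
  have Y_meas: "Y s \<in> borel_measurable M" if "0 \<le> s" for s
    using sol that unfolding self_stabilizing_solution_def by (blast intro: history_measurableD)
  have ms_int: "set_integrable lborel {0..s} ms" if "0 \<le> s" for s
    using sol that unfolding self_stabilizing_solution_def ms_def by blast
  have p_abs: "p absolutely_integrable_on {0..s}" if s: "0 \<le> s" for s
  proof -
    have "set_integrable lborel {0..s} (\<lambda>s. m)" by (rule borel_integrable_atLeastAtMost') simp
    then have pi: "set_integrable lborel {0..s} p"
      unfolding p_def by (intro set_integrable_mult_right set_integral_diff(1) ms_int s)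
    then have "p integrable_on {0..s}" "(\<lambda>s. norm (p s)) integrable_on {0..s}"
      using set_borel_integral_eq_integral(1)[OF pi]
        set_borel_integral_eq_integral(1)[OF set_integrable_norm[OF pi]] by auto
    then show ?thesis by (auto simp: absolutely_integrable_on_def)
  qed
  have Y_path: "AE \<omega> in M. continuous_on {0..} (\<lambda>t. Y t \<omega>) \<and>
      (\<forall>t\<ge>0. Y t \<omega> = X0 \<omega> + sqrt \<epsilon> * B t \<omega> + (integral {0..t} (\<lambda>s. drift m (Y s \<omega>)) + integral {0..t} p))"
  proof -
    have "AE \<omega> in M. continuous_on {0..} (\<lambda>t. Y t \<omega>) \<and>
       (\<forall>t\<ge>0. Y t \<omega> = X0 \<omega> + sqrt \<epsilon> * B t \<omega> - (LINT s:{0..t}|lborel. V' (Y s \<omega>))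
          - \<alpha> * (LINT s:{0..t}|lborel. Y s \<omega> - ms s))"
      using sol unfolding self_stabilizing_solution_def ms_def by blast
    then show ?thesis
    proof eventually_elim
      case (elim \<omega>)
      then have cont: "continuous_on {0..} (\<lambda>t. Y t \<omega>)" by blast
      show ?case
      proof (intro conjI allI impI cont)
        fix t :: real assume t: "0 \<le> t"
        have "Y t \<omega> = X0 \<omega> + sqrt \<epsilon> * B t \<omega> - (LINT s:{0..t}|lborel. V' (Y s \<omega>))
            - \<alpha> * (LINT s:{0..t}|lborel. Y s \<omega> - ms s)"
          using elim t by blast
        then show "Y t \<omega> = X0 \<omega> + sqrt \<epsilon> * B t \<omega> + (integral {0..t} (\<lambda>s. drift m (Y s \<omega>)) + integral {0..t} p)"
          using path_equation[OF cont ms_int[OF t], of m, folded p_def] by linarith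
      qed
    qed
  qed
  have dist: "AE \<omega> in M. \<bar>Y s \<omega> - X s \<omega>\<bar> \<le> integral {0..s} (\<lambda>r. \<bar>p r\<bar>) * exp (- V'' 0 * s)" if s: "0 \<le> s" for s
    using X_path Y_path
  proof eventually_elim
    case (elim \<omega>)
    then have cont: "continuous_on {0..s} (\<lambda>t. Y t \<omega>)" "continuous_on {0..s} (\<lambda>t. X t \<omega>)"
      by (auto intro: continuous_on_subset)
    show ?case
    proof (rule comparison[OF cont p_abs[OF s] s])
      fix r assume r: "r \<in> {0..s}"
      have "(\<lambda>s. drift m (Y s \<omega>)) integrable_on {0..r}" "(\<lambda>s. drift m (X s \<omega>)) integrable_on {0..r}"
        using r by (auto intro!: integrable_continuous_real drift_cont_compose intro: continuous_on_subset[OF cont(1)] continuous_on_subset[OF cont(2)])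
      then have "integral {0..r} (\<lambda>s. drift m (Y s \<omega>) - drift m (X s \<omega>))
          = integral {0..r} (\<lambda>s. drift m (Y s \<omega>)) - integral {0..r} (\<lambda>s. drift m (X s \<omega>))"
        by (rule Henstock_Kurzweil_Integration.integral_diff)
      moreover have "Y r \<omega> = X0 \<omega> + sqrt \<epsilon> * B r \<omega> + (integral {0..r} (\<lambda>s. drift m (Y s \<omega>)) + integral {0..r} p)"
        "X r \<omega> = X0 \<omega> + sqrt \<epsilon> * B r \<omega> + integral {0..r} (\<lambda>s. drift m (X s \<omega>))"
        using elim r by auto
      ultimately show "Y r \<omega> - X r \<omega> = integral {0..r} (\<lambda>s. drift m (Y s \<omega>) - drift m (X s \<omega>)) + integral {0..r} p"
        by linarith
    qed
  qed
  have mean_dist: "\<bar>p s\<bar> \<le> \<alpha> * exp (- V'' 0 * t) * integral {0..s} (\<lambda>r. \<bar>p r\<bar>)" if s: "0 \<le> s" "s \<le> t" for s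
  proof -
    let ?c = "integral {0..s} (\<lambda>r. \<bar>p r\<bar>) * exp (- V'' 0 * s)"
    have intY: "integrable M (Y s)"
    proof -
      have "integrable (distr M borel (Y s)) (\<lambda>x. x)"
        using sol s(1) unfolding self_stabilizing_solution_def by blast
      then show ?thesis using integrable_distr_eq[OF Y_meas[OF s(1)], of "\<lambda>x. x"] by simp
    qed
    have intX: "integrable M (X s)"
    proof -
      have "integrable (distr M borel (X s)) (\<lambda>x. x)" unfolding X_law[OF s(1)] by (rule int_u)
      then show ?thesis using integrable_distr_eq[OF X_measurable[OF s(1)], of "\<lambda>x. x"] by simp
    qed
    have "ms s = expectation (Y s)"
      unfolding ms_def law_mean_def by (rule integral_distr[OF Y_meas[OF s(1)]]) simp
    moreover have "m = expectation (X s)"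
    proof -
      have "law_mean M (X s) = expectation (X s)"
        unfolding law_mean_def by (rule integral_distr[OF X_measurable[OF s(1)]]) simp
      then show ?thesis by (rule trans[OF X_mean[OF s(1), symmetric]])
    qed
    ultimately have "ms s - m = expectation (\<lambda>\<omega>. Y s \<omega> - X s \<omega>)" using intX intY by simp
    then have "\<bar>ms s - m\<bar> \<le> expectation (\<lambda>\<omega>. \<bar>Y s \<omega> - X s \<omega>\<bar>)" by (simp add: integral_abs_bound)
    also have "\<dots> \<le> expectation (\<lambda>\<omega>. ?c)"
      using intX intY dist[OF s(1)] by (intro integral_mono_AE) auto
    also have "\<dots> = ?c" by (simp add: prob_space)
    also have "\<dots> \<le> integral {0..s} (\<lambda>r. \<bar>p r\<bar>) * exp (- V'' 0 * t)"
    proof (rule mult_left_mono)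
      show "exp (- V'' 0 * s) \<le> exp (- V'' 0 * t)" using s V''_0_neg by (simp add: mult_left_mono_neg)
      show "0 \<le> integral {0..s} (\<lambda>r. \<bar>p r\<bar>)"
        using p_abs[OF s(1)] by (intro integral_nonneg) (auto simp: absolutely_integrable_on_def)
    qed
    finally have "\<alpha> * \<bar>ms s - m\<bar> \<le> \<alpha> * (integral {0..s} (\<lambda>r. \<bar>p r\<bar>) * exp (- V'' 0 * t))"
      using interaction_pos by (intro mult_left_mono) auto
    then show ?thesis using interaction_pos by (simp add: p_def abs_mult mult_ac)
  qed
  have "integral {0..t} (\<lambda>r. \<bar>p r\<bar>) = 0"
    by (rule gronwall_null[OF _ _ t _ mean_dist])
       (use p_abs[OF t] interaction_pos in \<open>auto simp: absolutely_integrable_on_def\<close>)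
  then have "AE \<omega> in M. Y t \<omega> = X t \<omega>" using dist[OF t] by simp
  then have "distr M borel (Y t) = distr M borel (X t)"
    by (intro distr_cong_AE) (auto intro: X_measurable Y_meas t)
  then show "distr M borel (Y t) = ?u" using X_law[OF t] by simp
qed

lemma stationary_measures_eq:
  assumes "0 < \<epsilon>" "noise_space M B"
  shows "{u. stationary_measure M B V \<alpha> q \<epsilon> u} = gibbs_law \<epsilon> ` {m. mean_force \<epsilon> m = 0}"
  using stationary_imp_balanced[OF assms] balanced_imp_stationary[OF assms] by (auto simp: image_iff)

lemma gibbs_law_inj: "0 < \<epsilon> \<Longrightarrow> inj_on (gibbs_law \<epsilon>) {m. mean_force \<epsilon> m = 0}"
  by (rule inj_onI) (metis gibbs_law_facts(4) mem_Collect_eq)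

end

theorem theorem3p2:
  fixes V :: "real \<Rightarrow> real" and a \<alpha> :: real and q :: nat
  assumes "double_well V a"
    and "\<alpha> > 0"
    and "polynomial_growth V (quadratic_interaction \<alpha>) q"
    and "convex_on UNIV (deriv (deriv V))"
  shows "\<exists>\<epsilon>0>0. \<forall>\<epsilon>. 0 < \<epsilon> \<and> \<epsilon> < \<epsilon>0 \<longrightarrow>
           (\<forall>(M :: 'w measure) B. noise_space M B \<longrightarrow>
              card {u. stationary_measure M B V \<alpha> q \<epsilon> u} = 3)"
proof -
  interpret convex_double_well V a \<alpha> q by unfold_locales (use assms in auto)
  obtain \<epsilon>0 where \<epsilon>0: "0 < \<epsilon>0" "\<And>\<epsilon>. 0 < \<epsilon> \<Longrightarrow> \<epsilon> < \<epsilon>0 \<Longrightarrow> mean_force \<epsilon> (a / 2) < 0"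
    using mean_force_neg_small_noise by blast
  have "card {u. stationary_measure M B V \<alpha> q \<epsilon> u} = 3"
    if \<epsilon>: "0 < \<epsilon>" "\<epsilon> < \<epsilon>0" and M: "noise_space M B" for \<epsilon> and M :: "'w measure" and B
  proof -
    obtain m where m: "0 < m" "{m. mean_force \<epsilon> m = 0} = {- m, 0, m}"
      using three_balanced_means[OF \<epsilon>(1) \<epsilon>0(2)[OF \<epsilon>]] by blast
    have "card {u. stationary_measure M B V \<alpha> q \<epsilon> u} = card {m. mean_force \<epsilon> m = 0}"
      unfolding stationary_measures_eq[OF \<epsilon>(1) M] by (rule card_image[OF gibbs_law_inj[OF \<epsilon>(1)]])
    also have "\<dots> = card {- m, 0, m}" unfolding m(2) ..
    also have "\<dots> = 3" using m(1) by simp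
    finally show ?thesis .
  qed
  then show ?thesis using \<epsilon>0(1) by blast
qed

end
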